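(* Let $\alpha>0$, $\kappa\in\mathbb{R}$ and $f_{wb}\in(0,1)$ be constants independent of $n$. Let $n$ be large, let $m=\alpha n$ and let $H$ be an $m\times n$ matrix with i.i.d. standard normal components. Define $$\xi_{wb}=\min_{\mathbf{x},\mathbf{d}}\ \max_{\lambda}\ \left(\kappa\lambda^T\mathrm{diag}(\mathbf{d})\mathbf{1}-\lambda^T\mathrm{diag}(\mathbf{d})H\mathbf{x}\right),$$ where the minimum is over all $\mathbf{x}\in\mathbb{R}^n$ with $\|\mathbf{x}\|_2=1$ and all $\mathbf{d}\in\{0,1\}^m$ with $\sum_{i=1}^m\mathbf{d}_i=(1-f_{wb})m$, and the maximum is over all $\lambda\in\mathbb{R}^m$ with $\|\lambda\|_2=1$ and $\lambda_i\ge 0$ for $1\le i\le m$. Set $$\widehat{\nu_{wb}}=\left(\sqrt{2}\,\mathrm{erfinv}(1-2f_{wb})+\kappa\right)^2,\qquad \widehat{f_{err}}(\kappa)=\frac{1}{\sqrt{2\pi}}\int_{-\kappa}^{\sqrt{\widehat{\nu_{wb}}}-\kappa}(t+\kappa)^2e^{-\frac{t^2}{2}}\,dt.$$ Let $\epsilon_1^{(m)},\epsilon_1^{(n)},\epsilon_5^{(g)}>0$ be arbitrarily small constants independent of $n$, and let $\xi_{wb}^{(l)}$ be a scalar such that $$(1-\epsilon_1^{(m)})\sqrt{\alpha\widehat{f_{err}}(\kappa)}-(1+\epsilon_1^{(n)})-\epsilon_5^{(g)}>\frac{\xi_{wb}^{(l)}}{\sqrt{n}}.$$ Then $$\lim_{n\to\infty}P\left(\xi_{wb}\ge\xi_{wb}^{(l)}\right)\ge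 1$$ (that is, the limit equals $1$).
   Context: $\mathbf{1}$ is the $m$-dimensional column vector of all ones and $\mathrm{diag}(\mathbf{d})$ is the $m\times m$ diagonal matrix with the entries of $\mathbf{d}$ on its diagonal. $\mathrm{erf}(z)=\frac{2}{\sqrt{\pi}}\int_0^z e^{-t^2}dt$ and $\mathrm{erfinv}$ is its inverse function on $(-1,1)$. The number $f_{wb}$ is the allowed fraction of incorrectly stored patterns. The limit $n\to\infty$ is taken with $\alpha,\kappa,f_{wb}$ fixed, over those $n$ for which $m=\alpha n$ and $(1-f_{wb})m$ are integers; $\xi_{wb}^{(l)}$ may depend on $n$. Probability is with respect to $H$.
   Formalization: The additional assumption √2·erfinv(1−2f_wb)+κ ≥ 0 is made; without it the claim fails, e.g. for κ=0, f_wb=3/4, α=1000, all ε equal to 0.1 and ξ_wb^(l)=√n, where ξ_wb ≤ 0 with probability tending to 1. *)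

theory Defs
  imports "HOL-Probability.Probability"
begin

text \<open>
  Since the dimensions vary inside the statement, vectors and matrices are functions on \<open>nat\<close>
  read on \<open>{..<n}\<close> and \<open>{..<m}\<close>; their values elsewhere do not influence anything below.
\<close>

definition erf :: "real \<Rightarrow> real" where
  "erf z = 2 / sqrt pi * (LBINT t=0..z. exp (- t\<^sup>2))"

text \<open>\<open>erf\<close> is a bijection of the reals onto \<open>(-1, 1)\<close>; outside that interval \<open>erfinv\<close> is
  unspecified.\<close>

definition erfinv :: "real \<Rightarrow> real" where
  "erfinv = inv erf"

definition num_patterns :: "real \<Rightarrow> nat \<Rightarrow> nat" where
  "num_patterns \<alpha> n = nat \<lfloor>\<alpha> * real n\<rfloor>"

text \<open>The dimensions over which the limit is taken; on them \<open>num_patterns\<close> is exactly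
  \<open>\<alpha> * n\<close>.\<close>

definition admissible_dims :: "real \<Rightarrow> real \<Rightarrow> nat set" where
  "admissible_dims \<alpha> f = {n. \<alpha> * real n \<in> \<int> \<and> (1 - f) * (\<alpha> * real n) \<in> \<int>}"

definition along_dims :: "real \<Rightarrow> real \<Rightarrow> nat filter" where
  "along_dims \<alpha> f = inf sequentially (principal (admissible_dims \<alpha> f))"

definition unit_sphere :: "nat \<Rightarrow> (nat \<Rightarrow> real) set" where
  "unit_sphere n = {x. L2_set x {..<n} = 1}"

definition nonneg_unit_sphere :: "nat \<Rightarrow> (nat \<Rightarrow> real) set" where
  "nonneg_unit_sphere m = {l \<in> unit_sphere m. \<forall>i<m. l i \<ge> 0}"

definition selections :: "nat \<Rightarrow> real \<Rightarrow> (nat \<Rightarrow> real) set" where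
  "selections m f = {d. (\<forall>i<m. d i \<in> {0, 1}) \<and> (\<Sum>i<m. d i) = (1 - f) * real m}"

text \<open>\<open>\<kappa> \<lambda>\<^sup>T diag(d) 1 - \<lambda>\<^sup>T diag(d) H x\<close>\<close>

definition perceptron_form ::
    "nat \<Rightarrow> nat \<Rightarrow> real \<Rightarrow> (nat \<Rightarrow> nat \<Rightarrow> real) \<Rightarrow> (nat \<Rightarrow> real) \<Rightarrow> (nat \<Rightarrow> real) \<Rightarrow> (nat \<Rightarrow> real) \<Rightarrow> real" where
  "perceptron_form m n \<kappa> H x d l =
     \<kappa> * (\<Sum>i<m. l i * d i) - (\<Sum>i<m. l i * d i * (\<Sum>j<n. H i j * x j))"

text \<open>For \<open>n, m > 0\<close> and \<open>(1 - f) m\<close> an integer in \<open>{0..m}\<close> the index sets are nonempty and, up to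
  irrelevant coordinates, compact, so that supremum and infimum are attained.\<close>

definition xi_wb :: "nat \<Rightarrow> nat \<Rightarrow> real \<Rightarrow> real \<Rightarrow> (nat \<Rightarrow> nat \<Rightarrow> real) \<Rightarrow> real" where
  "xi_wb m n \<kappa> f H =
     (INF (x, d) \<in> unit_sphere n \<times> selections m f.
        SUP l \<in> nonneg_unit_sphere m. perceptron_form m n \<kappa> H x d l)"

definition nu_wb :: "real \<Rightarrow> real \<Rightarrow> real" where
  "nu_wb f \<kappa> = (sqrt 2 * erfinv (1 - 2 * f) + \<kappa>)\<^sup>2"

definition f_err :: "real \<Rightarrow> real \<Rightarrow> real" where
  "f_err f \<kappa> =
     1 / sqrt (2 * pi) *
       (LBINT t=-\<kappa>..sqrt (nu_wb f \<kappa>) - \<kappa>. (t + \<kappa>)\<^sup>2 * exp (- (t\<^sup>2 / 2)))"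

definition iid_std_normal_matrix ::
    "'a measure \<Rightarrow> nat \<Rightarrow> nat \<Rightarrow> (nat \<Rightarrow> nat \<Rightarrow> 'a \<Rightarrow> real) \<Rightarrow> bool" where
  "iid_std_normal_matrix M m n H \<longleftrightarrow>
     prob_space.indep_vars M (\<lambda>_. borel) (\<lambda>(i, j). H i j) ({..<m} \<times> {..<n}) \<and>
     (\<forall>i<m. \<forall>j<n. distributed M lborel (H i j) std_normal_density)"

end

theory Submission
  imports Defs
begin

text \<open>
  For fixed \<open>x\<close> and \<open>d\<close> the maximum over \<open>\<lambda>\<close> is the Euclidean norm of the positive part of
  \<open>diag(d) (\<kappa> 1 - H x)\<close>. Gordon's comparison inequality replaces \<open>\<lambda>\<^sup>T diag(d) H x\<close>, up to one scalar
  Gaussian, by \<open>g\<^sup>T diag(d) \<lambda> + \<bar>diag(d) \<lambda>\<bar> h\<^sup>T x\<close> with independent Gaussian vectors \<open>g\<close> and \<open>h\<close>, for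
  which the minimax is at least the root of the sum of the \<open>(1 - f) m\<close> smallest losses
  \<open>(max 0 (\<kappa> + g\<^sub>i))\<^sup>2\<close>, minus \<open>\<bar>h\<bar>\<close>. Capping the losses at their \<open>(1 - f)\<close>-quantile bounds this sum
  from below by an i.i.d. sum, so Chebyshev's inequality makes both terms concentrate with
  failure probability \<open>O(1 / n)\<close>. Gordon's inequality is proved for finite index sets by rotating
  one Gaussian vector into the other and integrating by parts; the spheres are replaced by nets
  fine enough for the dimension at hand. Since Gordon's
  inequality compares probabilities, no concentration of the minimax itself is needed.
\<close>

section \<open>Smooth functions with nonnegative cross derivatives\<close>

text \<open>The minimax is of order \<open>sqrt n\<close>, so an error bounded independently of n is
  harmless, and this sets the precision of every step. The smooth form of Gordon's inequality shifts
  the threshold by 1, rounding \<lambda> to a net costs at most 1 and rounding x at most 1; their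
  sum 3 and the scalar Gaussian are both absorbed by \<epsilon>5g. Write u = diag(d) \<lambda>. The
  matrix process has variance |u|^2 and the comparison process 2 |u|^2, so the scalar has to be
  multiplied by |u|, which varies inside a block because \<lambda> may put weight on discarded rows.
  With the scalar included, the covariances differ by (|u| |u'| - <u, u'>) (1 - <x, x'>): zero
  inside a block, where x = x', and nonnegative everywhere by Cauchy-Schwarz. Capping treats all
  selections d at once, without a union bound: a discarded row loses at most the cap, and exactly f
  m rows are discarded. The quantile is the right level for the cap because the capped loss then has
  mean \<open>f_err\<close> plus f times the cap, so the deduction cancels.\<close>

definition clamp01 :: "real \<Rightarrow> real" where
  "clamp01 x = max 0 (min 1 x)"

lemma clamp01_range: "0 \<le> clamp01 x" "clamp01 x \<le> 1"
  by (auto simp: clamp01_def)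

lemma clamp01_lipschitz: "\<bar>clamp01 x - clamp01 y\<bar> \<le> \<bar>x - y\<bar>"
  by (auto simp: clamp01_def max_def min_def)

text \<open>At the kinks of \<open>clamp01\<close>, and where it is constant, \<open>q'\<close>
  vanishes at the clamped point. There \<open>q\<close> moves by less than any multiple of the
  distance, and the 1-Lipschitz \<open>clamp01\<close> passes this estimate on to the
  composite.\<close>

lemma DERIV_clamp01_comp:
  fixes q q' :: "real \<Rightarrow> real"
  assumes q: "\<And>x. (q has_real_derivative q' x) (at x)" and "q' 0 = 0" "q' 1 = 0"
  shows "((\<lambda>x. q (clamp01 x)) has_real_derivative q' (clamp01 x)) (at x)"
proof (cases "0 < x \<and> x < 1")
  case True
  then have "\<forall>\<^sub>F y in nhds x. y \<in> {0<..<1}"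
    by (intro eventually_nhds_in_open) auto
  then have "\<forall>\<^sub>F y in nhds x. q (clamp01 y) = q y"
    by eventually_elim (auto simp: clamp01_def)
  then show ?thesis
    using q[of x] True by (subst DERIV_cong_ev[OF refl _ refl, where g = q]) (auto simp: clamp01_def)
next
  case False
  then have zero: "q' (clamp01 x) = 0"
    using assms by (auto simp: clamp01_def max_def min_def)
  define y0 where "y0 = clamp01 x"
  have d0: "(q has_derivative (\<lambda>_. 0)) (at y0)"
    using q[of y0] zero by (simp add: has_field_derivative_def y0_def lambda_zero)
  have "((\<lambda>x. q (clamp01 x)) has_derivative (\<lambda>_. 0)) (at x)"
    unfolding has_derivative_at_alt
  proof (intro conjI allI impI)
    fix e :: real assume "e > 0"
    then obtain d where d: "d > 0" "\<And>y. norm (y - y0) < d \<Longrightarrow> norm (q y - q y0 - 0) \<le> e * norm (y - y0)"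
      using d0 unfolding has_derivative_at_alt by blast
    have "norm (q (clamp01 y) - q (clamp01 x) - 0) \<le> e * norm (y - x)" if "norm (y - x) < d" for y
    proof -
      have "norm (q (clamp01 y) - q y0 - 0) \<le> e * norm (clamp01 y - y0)"
        using that clamp01_lipschitz[of y x] by (intro d(2)) (auto simp: y0_def)
      also have "\<dots> \<le> e * norm (y - x)"
        using clamp01_lipschitz[of y x] \<open>e > 0\<close> by (intro mult_left_mono) (auto simp: y0_def)
      finally show ?thesis by (simp add: y0_def)
    qed
    then show "\<exists>d>0. \<forall>y. norm (y - x) < d \<longrightarrow>
        norm (q (clamp01 y) - q (clamp01 x) - 0) \<le> e * norm (y - x)"
      using d(1) by blast
  qed simp
  then show ?thesis
    using zero by (simp add: has_field_derivative_def lambda_zero)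
qed

text \<open>Two derivatives are needed because integration by parts is applied to first derivatives.
  The number 60 covers both derivatives of the quintic chosen below.\<close>

lemma smooth_step_exists:
  obtains \<eta> \<eta>' \<eta>'' :: "real \<Rightarrow> real" where
    "\<And>x. (\<eta> has_real_derivative \<eta>' x) (at x)" "\<And>x. (\<eta>' has_real_derivative \<eta>'' x) (at x)"
    "\<And>x. x \<le> 0 \<Longrightarrow> \<eta> x = 1" "\<And>x. 1 \<le> x \<Longrightarrow> \<eta> x = 0"
    "\<And>x. 0 \<le> \<eta> x" "\<And>x. \<eta> x \<le> 1" "\<And>x. \<eta>' x \<le> 0" "\<And>x. \<bar>\<eta>' x\<bar> \<le> 60" "\<And>x. \<bar>\<eta>'' x\<bar> \<le> 60"
    "\<eta> \<in> borel_measurable borel" "\<eta>' \<in> borel_measurable borel" "\<eta>'' \<in> borel_measurable borel"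
proof -
  \<comment> \<open>The quintic \<open>10 y^3 - 15 y^4 + 6 y^5\<close> rises from 0 to 1 with first
    and second derivatives zero at both ends. This is what \<open>DERIV_clamp01_comp\<close> asks of
    \<open>q\<close> and then again of \<open>q'\<close>.\<close>
  define q q' q'' :: "real \<Rightarrow> real" where
    "q = (\<lambda>y. 1 - (10 * y^3 - 15 * y^4 + 6 * y^5))"
    and "q' = (\<lambda>y. - 30 * (y * (1 - y))\<^sup>2)"
    and "q'' = (\<lambda>y. - 60 * ((y * (1 - y)) * (1 - 2 * y)))"
  have q: "(q has_real_derivative q' x) (at x)" for x
    unfolding q_def q'_def by (auto intro!: derivative_eq_intros simp: algebra_simps power2_eq_square power3_eq_cube power4_eq_xxxx)
  have q': "(q' has_real_derivative q'' x) (at x)" for x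
    unfolding q''_def q'_def by (auto intro!: derivative_eq_intros simp: algebra_simps power2_eq_square)
  have meas [measurable]: "clamp01 \<in> borel_measurable borel"
    unfolding clamp01_def by measurable
  have anti: "q (clamp01 x) \<le> q 0" "q 1 \<le> q (clamp01 x)" for x
  proof -
    have "q z \<le> q y" if "y \<le> z" for y z
    proof (rule DERIV_nonpos_imp_nonincreasing[OF that])
      fix x show "\<exists>y. DERIV q x :> y \<and> y \<le> 0"
        using q[of x] by (auto simp: q'_def intro!: exI[of _ "q' x"])
    qed
    then show "q (clamp01 x) \<le> q 0" "q 1 \<le> q (clamp01 x)"
      using clamp01_range[of x] by auto
  qed
  have b: "\<bar>y * (1 - y)\<bar> \<le> 1" if "y \<in> {0..1}" for y :: real
    using that by (auto simp: abs_mult intro!: mult_le_one)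
  show ?thesis
  proof (rule that[of "\<lambda>x. q (clamp01 x)" "\<lambda>x. q' (clamp01 x)" "\<lambda>x. q'' (clamp01 x)"])
    fix x :: real
    define y where "y = clamp01 x"
    have y: "0 \<le> y" "y \<le> 1" using clamp01_range[of x] by (auto simp: y_def)
    show "((\<lambda>x. q (clamp01 x)) has_real_derivative q' (clamp01 x)) (at x)"
      by (rule DERIV_clamp01_comp[OF q]) (auto simp: q'_def)
    show "((\<lambda>x. q' (clamp01 x)) has_real_derivative q'' (clamp01 x)) (at x)"
      by (rule DERIV_clamp01_comp[OF q']) (auto simp: q''_def)
    show "0 \<le> q (clamp01 x)" "q (clamp01 x) \<le> 1"
      using anti[of x] by (auto simp: q_def)
    show "q' (clamp01 x) \<le> 0" by (simp add: q'_def)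
    have "(y * (1 - y))\<^sup>2 \<le> 1" using b[of y] y by (simp add: abs_square_le_1)
    then show "\<bar>q' (clamp01 x)\<bar> \<le> 60"
      by (simp add: q'_def y_def)
    have "\<bar>(y * (1 - y)) * (1 - 2 * y)\<bar> \<le> 1"
      using b[of y] y unfolding abs_mult[of "y * (1 - y)"] by (intro mult_le_one) auto
    then show "\<bar>q'' (clamp01 x)\<bar> \<le> 60"
      by (simp add: q''_def y_def abs_mult)
  next
    show "(\<lambda>x. q (clamp01 x)) \<in> borel_measurable borel" unfolding q_def by measurable
    show "(\<lambda>x. q' (clamp01 x)) \<in> borel_measurable borel" unfolding q'_def by measurable
    show "(\<lambda>x. q'' (clamp01 x)) \<in> borel_measurable borel" unfolding q''_def by measurable
  qed (auto simp: q_def clamp01_def)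
qed

text \<open>Differentiability is phrased as a chain rule along curves in the coordinates \<open>P\<close>, because the
  function space carries no norm.\<close>

definition has_gradient_on ::
    "'p set \<Rightarrow> (('p \<Rightarrow> real) \<Rightarrow> real) \<Rightarrow> ('p \<Rightarrow> ('p \<Rightarrow> real) \<Rightarrow> real) \<Rightarrow> bool" where
  "has_gradient_on P F D \<longleftrightarrow>
     (\<forall>w w' t. (\<forall>p\<in>P. ((\<lambda>s. w s p) has_real_derivative w' p) (at t)) \<longrightarrow>
        ((\<lambda>s. F (w s)) has_real_derivative (\<Sum>p\<in>P. D p (w t) * w' p)) (at t))"

text \<open>Global bounds give integrability under every affine image of a Gaussian vector, and they
  supply the dominating function for differentiation under the integral.\<close>

definition bounded_measurable :: "(('p \<Rightarrow> real) \<Rightarrow> real) \<Rightarrow> bool" where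
  "bounded_measurable F \<longleftrightarrow>
     F \<in> borel_measurable (Pi\<^sub>M UNIV (\<lambda>_. borel)) \<and> (\<exists>B. \<forall>w. \<bar>F w\<bar> \<le> B)"

definition smooth2 ::
    "'p set \<Rightarrow> (('p \<Rightarrow> real) \<Rightarrow> real) \<Rightarrow> ('p \<Rightarrow> ('p \<Rightarrow> real) \<Rightarrow> real) \<Rightarrow>
      ('p \<Rightarrow> 'p \<Rightarrow> ('p \<Rightarrow> real) \<Rightarrow> real) \<Rightarrow> bool" where
  "smooth2 P F D D2 \<longleftrightarrow> has_gradient_on P F D \<and> (\<forall>p\<in>P. has_gradient_on P (D p) (D2 p)) \<and>
     bounded_measurable F \<and> (\<forall>p\<in>P. bounded_measurable (D p)) \<and>
     (\<forall>p\<in>P. \<forall>q\<in>P. bounded_measurable (D2 p q))"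

lemma has_gradient_on_mult:
  assumes "has_gradient_on P F D" "has_gradient_on P G E"
  shows "has_gradient_on P (\<lambda>w. F w * G w) (\<lambda>p w. D p w * G w + F w * E p w)"
  unfolding has_gradient_on_def
proof (intro allI impI)
  fix w :: "real \<Rightarrow> 'a \<Rightarrow> real" and w' t
  assume h: "\<forall>p\<in>P. ((\<lambda>s. w s p) has_real_derivative w' p) (at t)"
  have "((\<lambda>s. F (w s)) has_real_derivative (\<Sum>p\<in>P. D p (w t) * w' p)) (at t)"
    "((\<lambda>s. G (w s)) has_real_derivative (\<Sum>p\<in>P. E p (w t) * w' p)) (at t)"
    using assms h unfolding has_gradient_on_def by blast+
  from DERIV_mult[OF this]
  show "((\<lambda>s. F (w s) * G (w s)) has_real_derivative
          (\<Sum>p\<in>P. (D p (w t) * G (w t) + F (w t) * E p (w t)) * w' p)) (at t)"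
    by (rule DERIV_cong) (simp add: sum_distrib_left sum_distrib_right sum.distrib algebra_simps)
qed

lemma has_gradient_on_add:
  assumes "has_gradient_on P F D" "has_gradient_on P G E"
  shows "has_gradient_on P (\<lambda>w. F w + G w) (\<lambda>p w. D p w + E p w)"
  unfolding has_gradient_on_def
proof (intro allI impI)
  fix w :: "real \<Rightarrow> 'a \<Rightarrow> real" and w' t
  assume h: "\<forall>p\<in>P. ((\<lambda>s. w s p) has_real_derivative w' p) (at t)"
  have "((\<lambda>s. F (w s)) has_real_derivative (\<Sum>p\<in>P. D p (w t) * w' p)) (at t)"
    "((\<lambda>s. G (w s)) has_real_derivative (\<Sum>p\<in>P. E p (w t) * w' p)) (at t)"
    using assms h unfolding has_gradient_on_def by blast+
  from DERIV_add[OF this]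
  show "((\<lambda>s. F (w s) + G (w s)) has_real_derivative
          (\<Sum>p\<in>P. (D p (w t) + E p (w t)) * w' p)) (at t)"
    by (rule DERIV_cong) (simp add: sum.distrib algebra_simps)
qed

lemma has_gradient_on_const: "has_gradient_on P (\<lambda>_. c) (\<lambda>_ _. 0)"
  by (simp add: has_gradient_on_def)

lemma has_gradient_on_coordinate:
  assumes "finite P" "p \<in> P" and \<eta>: "\<And>x. (\<eta> has_real_derivative \<eta>' x) (at x)"
  shows "has_gradient_on P (\<lambda>w. \<eta> (w p)) (\<lambda>q w. if q = p then \<eta>' (w p) else 0)"
  unfolding has_gradient_on_def
proof (intro allI impI)
  fix w :: "real \<Rightarrow> 'a \<Rightarrow> real" and w' t
  assume h: "\<forall>p\<in>P. ((\<lambda>s. w s p) has_real_derivative w' p) (at t)"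
  have "((\<lambda>s. \<eta> (w s p)) has_real_derivative \<eta>' (w t p) * w' p) (at t)"
    using DERIV_chain2[OF \<eta>] h assms(2) by blast
  then show "((\<lambda>s. \<eta> (w s p)) has_real_derivative
      (\<Sum>q\<in>P. (if q = p then \<eta>' (w t p) else 0) * w' q)) (at t)"
    using assms(1,2) by (simp add: if_distrib[where f = "\<lambda>x. x * _"] sum.delta cong: if_cong)
qed

lemma bounded_measurable_mult:
  assumes "bounded_measurable F" "bounded_measurable G"
  shows "bounded_measurable (\<lambda>w. F w * G w)"
proof -
  obtain B C where "\<And>w. \<bar>F w\<bar> \<le> B" "\<And>w. \<bar>G w\<bar> \<le> C"
    using assms unfolding bounded_measurable_def by blast
  then have "\<bar>F w * G w\<bar> \<le> B * C" for w
    unfolding abs_mult by (intro mult_mono) (auto intro: order_trans[OF abs_ge_zero])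
  then show ?thesis using assms unfolding bounded_measurable_def by auto
qed

lemma bounded_measurable_add:
  assumes "bounded_measurable F" "bounded_measurable G"
  shows "bounded_measurable (\<lambda>w. F w + G w)"
proof -
  obtain B C where "\<And>w. \<bar>F w\<bar> \<le> B" "\<And>w. \<bar>G w\<bar> \<le> C"
    using assms unfolding bounded_measurable_def by blast
  then have "\<bar>F w + G w\<bar> \<le> B + C" for w
    by (meson abs_triangle_ineq add_mono order_trans)
  then show ?thesis using assms unfolding bounded_measurable_def by auto
qed

lemma bounded_measurable_const: "bounded_measurable (\<lambda>_. c)"
  by (auto simp: bounded_measurable_def)

lemma bounded_measurable_coordinate:
  assumes "\<eta> \<in> borel_measurable borel" "\<And>x. \<bar>\<eta> x\<bar> \<le> B"
  shows "bounded_measurable (\<lambda>w. \<eta> (w p))"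
  unfolding bounded_measurable_def
  using assms by (auto intro!: measurable_compose[OF measurable_component_singleton])

lemma smooth2_mult:
  assumes F: "smooth2 P F D D2" and G: "smooth2 P G E E2"
  shows "smooth2 P (\<lambda>w. F w * G w) (\<lambda>p w. D p w * G w + F w * E p w)
    (\<lambda>p q w. (D2 p q w * G w + D p w * E q w) + (D q w * E p w + F w * E2 p q w))"
  using assms unfolding smooth2_def
  by (auto intro!: has_gradient_on_mult has_gradient_on_add bounded_measurable_mult bounded_measurable_add)

lemma smooth2_const: "smooth2 P (\<lambda>_. c) (\<lambda>_ _. 0) (\<lambda>_ _ _. 0)"
  by (simp add: smooth2_def has_gradient_on_const bounded_measurable_const)

lemma smooth2_one_minus:
  assumes "smooth2 P F D D2"
  shows "smooth2 P (\<lambda>w. 1 - F w) (\<lambda>p w. - D p w) (\<lambda>p q w. - D2 p q w)"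
proof -
  have m: "bounded_measurable (\<lambda>w. - G w)" if "bounded_measurable G" for G :: "('a \<Rightarrow> real) \<Rightarrow> real"
    using bounded_measurable_mult[OF bounded_measurable_const[of "-1"] that] by simp
  have a: "bounded_measurable (\<lambda>w. 1 - G w)" if "bounded_measurable G" for G :: "('a \<Rightarrow> real) \<Rightarrow> real"
    using bounded_measurable_add[OF bounded_measurable_const[of 1] m[OF that]] by simp
  have gm: "has_gradient_on P (\<lambda>w. - G w) (\<lambda>p w. - E p w)" if "has_gradient_on P G E" for G E
    using has_gradient_on_mult[OF has_gradient_on_const[of P "-1"] that] by simp
  have ga: "has_gradient_on P (\<lambda>w. 1 - G w) (\<lambda>p w. - E p w)" if "has_gradient_on P G E" for G E
    using has_gradient_on_add[OF has_gradient_on_const[of P 1] gm[OF that]] by simp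
  show ?thesis
    using assms unfolding smooth2_def by (auto intro!: m a gm ga)
qed

lemma smooth2_coordinate:
  assumes "finite P" "p \<in> P"
    and "\<And>x. (\<eta> has_real_derivative \<eta>' x) (at x)" "\<And>x. (\<eta>' has_real_derivative \<eta>'' x) (at x)"
    and "\<And>x. \<bar>\<eta> x\<bar> \<le> B" "\<And>x. \<bar>\<eta>' x\<bar> \<le> B" "\<And>x. \<bar>\<eta>'' x\<bar> \<le> B"
    and "\<eta> \<in> borel_measurable borel" "\<eta>' \<in> borel_measurable borel" "\<eta>'' \<in> borel_measurable borel"
  shows "smooth2 P (\<lambda>w. \<eta> (w p)) (\<lambda>q w. if q = p then \<eta>' (w p) else 0)
    (\<lambda>q r w. if q = p \<and> r = p then \<eta>'' (w p) else 0)"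
  unfolding smooth2_def
proof (intro conjI ballI)
  show "has_gradient_on P (\<lambda>w. \<eta> (w p)) (\<lambda>q w. if q = p then \<eta>' (w p) else 0)"
    by (rule has_gradient_on_coordinate) fact+
  show "bounded_measurable (\<lambda>w. \<eta> (w p))"
    by (rule bounded_measurable_coordinate[where B = B]) fact+
next
  fix q assume "q \<in> P"
  show "has_gradient_on P (\<lambda>w. if q = p then \<eta>' (w p) else 0)
      (\<lambda>r w. if q = p \<and> r = p then \<eta>'' (w p) else 0)"
    using has_gradient_on_coordinate[OF assms(1,2,4)] has_gradient_on_const[of P 0] by (cases "q = p") auto
  show "bounded_measurable (\<lambda>w. if q = p then \<eta>' (w p) else 0)"
    using bounded_measurable_coordinate[OF assms(9,6)] bounded_measurable_const[of 0] by (cases "q = p") auto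
  fix r assume "r \<in> P"
  show "bounded_measurable (\<lambda>w. if q = p \<and> r = p then \<eta>'' (w p) else 0)"
    using bounded_measurable_coordinate[OF assms(10,7)] bounded_measurable_const[of 0]
    by (cases "q = p \<and> r = p") auto
qed

text \<open>Describes smooth stand-ins for the event that no coordinate of block \<open>i\<close>
  exceeds the threshold. Such a function reads one block only, so its mixed derivatives across
  blocks vanish.\<close>

definition block_function :: "'p set \<Rightarrow> ('p \<Rightarrow> 'b) \<Rightarrow> 'b \<Rightarrow> (('p \<Rightarrow> real) \<Rightarrow> real) \<Rightarrow> bool" where
  "block_function P b i F \<longleftrightarrow> (\<exists>D D2. smooth2 P F D D2 \<and> (\<forall>w. 0 \<le> F w \<and> F w \<le> 1) \<and>
     (\<forall>p\<in>P. \<forall>w. D p w \<le> 0) \<and> (\<forall>p\<in>P. b p \<noteq> i \<longrightarrow> (\<forall>w. D p w = 0)) \<and>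
     (\<forall>p\<in>P. \<forall>q\<in>P. b p \<noteq> b q \<longrightarrow> (\<forall>w. D2 p q w = 0)))"

text \<open>The class to which Gordon's argument applies. Second derivatives are constrained only
  across blocks, since inside a block the covariances of the two processes agree. The sign of the
  first derivatives makes the class closed under products, whose cross derivatives contain products
  of first derivatives.\<close>

definition crosspositive :: "'p set \<Rightarrow> ('p \<Rightarrow> 'b) \<Rightarrow> (('p \<Rightarrow> real) \<Rightarrow> real) \<Rightarrow> bool" where
  "crosspositive P b F \<longleftrightarrow> (\<exists>D D2. smooth2 P F D D2 \<and> (\<forall>w. 0 \<le> F w \<and> F w \<le> 1) \<and>
     (\<forall>p\<in>P. \<forall>w. 0 \<le> D p w) \<and>
     (\<forall>p\<in>P. \<forall>q\<in>P. b p \<noteq> b q \<longrightarrow> (\<forall>w. 0 \<le> D2 p q w)))"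

lemma block_function_mult:
  assumes "block_function P b i F" "block_function P b i G"
  shows "block_function P b i (\<lambda>w. F w * G w)"
proof -
  from assms(1) obtain D D2 where F: "smooth2 P F D D2" "\<And>w. 0 \<le> F w" "\<And>w. F w \<le> 1"
      "\<And>p w. p \<in> P \<Longrightarrow> D p w \<le> 0" "\<And>p w. p \<in> P \<Longrightarrow> b p \<noteq> i \<Longrightarrow> D p w = 0"
      "\<And>p q w. p \<in> P \<Longrightarrow> q \<in> P \<Longrightarrow> b p \<noteq> b q \<Longrightarrow> D2 p q w = 0"
    unfolding block_function_def by (elim exE conjE) blast
  from assms(2) obtain E E2 where G: "smooth2 P G E E2" "\<And>w. 0 \<le> G w" "\<And>w. G w \<le> 1"
      "\<And>p w. p \<in> P \<Longrightarrow> E p w \<le> 0" "\<And>p w. p \<in> P \<Longrightarrow> b p \<noteq> i \<Longrightarrow> E p w = 0"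
      "\<And>p q w. p \<in> P \<Longrightarrow> q \<in> P \<Longrightarrow> b p \<noteq> b q \<Longrightarrow> E2 p q w = 0"
    unfolding block_function_def by (elim exE conjE) blast
  \<comment> \<open>Two coordinates from different blocks cannot both lie in block \<open>i\<close>,
    so one of the factors is zero.\<close>
  have cross: "D p w * E q w = 0" if "p \<in> P" "q \<in> P" "b p \<noteq> b q" for p q w
    using F(5)[of p w] G(5)[of q w] that by (cases "b p = i") auto
  let ?D = "\<lambda>p w. D p w * G w + F w * E p w"
  let ?D2 = "\<lambda>p q w. (D2 p q w * G w + D p w * E q w) + (D q w * E p w + F w * E2 p q w)"
  have "smooth2 P (\<lambda>w. F w * G w) ?D ?D2" by (rule smooth2_mult[OF F(1) G(1)])
  moreover have "0 \<le> F w * G w \<and> F w * G w \<le> 1" for w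
    using F(2,3)[of w] G(2,3)[of w] by (simp add: mult_le_one)
  moreover have "?D p w \<le> 0" if "p \<in> P" for p w
    by (intro add_nonpos_nonpos mult_nonpos_nonneg mult_nonneg_nonpos F G that)
  moreover have "?D p w = 0" if "p \<in> P" "b p \<noteq> i" for p w
    using F(5) G(5) that by simp
  moreover have "?D2 p q w = 0" if "p \<in> P" "q \<in> P" "b p \<noteq> b q" for p q w
    by (simp add: F(6)[OF that] G(6)[OF that] cross[OF that] cross[OF that(2,1) not_sym[OF that(3)]] del: mult_eq_0_iff)
  ultimately show ?thesis
    unfolding block_function_def by (intro exI[of _ ?D] exI[of _ ?D2]) blast
qed

lemma crosspositive_mult:
  assumes "crosspositive P b F" "crosspositive P b G"
  shows "crosspositive P b (\<lambda>w. F w * G w)"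
proof -
  from assms(1) obtain D D2 where F: "smooth2 P F D D2" "\<And>w. 0 \<le> F w" "\<And>w. F w \<le> 1"
      "\<And>p w. p \<in> P \<Longrightarrow> 0 \<le> D p w"
      "\<And>p q w. p \<in> P \<Longrightarrow> q \<in> P \<Longrightarrow> b p \<noteq> b q \<Longrightarrow> 0 \<le> D2 p q w"
    unfolding crosspositive_def by (elim exE conjE) blast
  from assms(2) obtain E E2 where G: "smooth2 P G E E2" "\<And>w. 0 \<le> G w" "\<And>w. G w \<le> 1"
      "\<And>p w. p \<in> P \<Longrightarrow> 0 \<le> E p w"
      "\<And>p q w. p \<in> P \<Longrightarrow> q \<in> P \<Longrightarrow> b p \<noteq> b q \<Longrightarrow> 0 \<le> E2 p q w"
    unfolding crosspositive_def by (elim exE conjE) blast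
  let ?D = "\<lambda>p w. D p w * G w + F w * E p w"
  let ?D2 = "\<lambda>p q w. (D2 p q w * G w + D p w * E q w) + (D q w * E p w + F w * E2 p q w)"
  have "smooth2 P (\<lambda>w. F w * G w) ?D ?D2" by (rule smooth2_mult[OF F(1) G(1)])
  moreover have "0 \<le> F w * G w \<and> F w * G w \<le> 1" for w
    using F(2,3)[of w] G(2,3)[of w] by (simp add: mult_le_one)
  moreover have "0 \<le> ?D p w" if "p \<in> P" for p w
    by (intro add_nonneg_nonneg mult_nonneg_nonneg F G that)
  moreover have "0 \<le> ?D2 p q w" if "p \<in> P" "q \<in> P" "b p \<noteq> b q" for p q w
    by (intro add_nonneg_nonneg mult_nonneg_nonneg F G that)
  ultimately show ?thesis
    unfolding crosspositive_def by (intro exI[of _ ?D] exI[of _ ?D2]) blast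
qed

lemma crosspositive_one_minus:
  assumes "block_function P b i F"
  shows "crosspositive P b (\<lambda>w. 1 - F w)"
proof -
  from assms obtain D D2 where "smooth2 P F D D2" "\<And>w. 0 \<le> F w" "\<And>w. F w \<le> 1"
      "\<And>p w. p \<in> P \<Longrightarrow> D p w \<le> 0"
      "\<And>p q w. p \<in> P \<Longrightarrow> q \<in> P \<Longrightarrow> b p \<noteq> b q \<Longrightarrow> D2 p q w = 0"
    unfolding block_function_def by (elim exE conjE) blast
  then show ?thesis
    unfolding crosspositive_def
    by (intro exI[of _ "\<lambda>p w. - D p w"] exI[of _ "\<lambda>p q w. - D2 p q w"]) (auto intro: smooth2_one_minus)
qed

lemma block_function_prod:
  assumes "finite J" "\<And>p. p \<in> J \<Longrightarrow> block_function P b i (F p)"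
  shows "block_function P b i (\<lambda>w. \<Prod>p\<in>J. F p w)"
  using assms
proof (induction J rule: finite_induct)
  case empty
  show ?case
    unfolding block_function_def
    by (intro exI[of _ "\<lambda>_ _. 0"] exI[of _ "\<lambda>_ _ _. 0"]) (auto simp: smooth2_const)
next
  case (insert p J)
  then show ?case by (auto intro!: block_function_mult)
qed

lemma crosspositive_prod:
  assumes "finite I" "\<And>i. i \<in> I \<Longrightarrow> crosspositive P b (F i)"
  shows "crosspositive P b (\<lambda>w. \<Prod>i\<in>I. F i w)"
  using assms
proof (induction I rule: finite_induct)
  case empty
  show ?case
    unfolding crosspositive_def
    by (intro exI[of _ "\<lambda>_ _. 0"] exI[of _ "\<lambda>_ _ _. 0"]) (auto simp: smooth2_const)
next
  case (insert p J)
  then show ?case by (auto intro!: crosspositive_mult)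
qed

text \<open>A smooth substitute for the event that every block contains a coordinate exceeding the
  threshold; the transition takes place between the thresholds \<open>0\<close> and \<open>1\<close>.\<close>

lemma crosspositive_minmax_exists:
  fixes P :: "'p set" and b :: "'p \<Rightarrow> 'b"
  assumes "finite P"
  obtains F where "crosspositive P b F"
    "\<And>w. 0 < F w \<Longrightarrow> \<forall>i\<in>b ` P. \<exists>p\<in>P. b p = i \<and> 0 < w p"
    "\<And>w. \<forall>i\<in>b ` P. \<exists>p\<in>P. b p = i \<and> 1 \<le> w p \<Longrightarrow> F w = 1"
proof -
  obtain \<eta> \<eta>' \<eta>'' :: "real \<Rightarrow> real" where d: "\<And>x. (\<eta> has_real_derivative \<eta>' x) (at x)" "\<And>x. (\<eta>' has_real_derivative \<eta>'' x) (at x)"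
    and v: "\<And>x. x \<le> 0 \<Longrightarrow> \<eta> x = 1" "\<And>x. 1 \<le> x \<Longrightarrow> \<eta> x = 0"
    and r: "\<And>x. 0 \<le> \<eta> x" "\<And>x. \<eta> x \<le> 1" "\<And>x. \<eta>' x \<le> 0" "\<And>x. \<bar>\<eta>' x\<bar> \<le> 60" "\<And>x. \<bar>\<eta>'' x\<bar> \<le> 60"
    and m: "\<eta> \<in> borel_measurable borel" "\<eta>' \<in> borel_measurable borel" "\<eta>'' \<in> borel_measurable borel"
    by (rule smooth_step_exists) blast
  have r': "\<bar>\<eta> x\<bar> \<le> 60" for x using r(1,2)[of x] by auto
  have base: "block_function P b (b p) (\<lambda>w :: 'p \<Rightarrow> real. \<eta> (w p))" if "p \<in> P" for p :: 'p
    unfolding block_function_def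
    by (rule exI, rule exI, intro conjI, rule smooth2_coordinate[OF assms that d r' r(4,5) m]) (use r in auto)
  \<comment> \<open>The inner product is 1 if no coordinate of the block is positive and 0 as soon
    as one reaches 1. Its complement therefore imitates the existential quantifier within a block,
    and the outer product the universal quantifier over blocks.\<close>
  define F where "F w = (\<Prod>i\<in>b ` P. 1 - (\<Prod>p\<in>{p\<in>P. b p = i}. \<eta> (w p)))" for w :: "'p \<Rightarrow> real"
  show ?thesis
  proof
    show "crosspositive P b F"
      unfolding F_def[abs_def] using assms base
      by (intro crosspositive_prod crosspositive_one_minus block_function_prod) auto
  next
    fix w :: "'p \<Rightarrow> real" assume pos: "0 < F w"
    show "\<forall>i\<in>b ` P. \<exists>p\<in>P. b p = i \<and> 0 < w p"
    proof (rule ccontr)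
      assume "\<not> ?thesis"
      then obtain i where i: "i \<in> b ` P" "\<And>p. p \<in> P \<Longrightarrow> b p = i \<Longrightarrow> w p \<le> 0"
        by (meson not_less)
      then have "(\<Prod>p\<in>{p\<in>P. b p = i}. \<eta> (w p)) = 1" by (auto intro!: prod.neutral v)
      then have "F w = 0" unfolding F_def using i(1) assms by (intro prod_zero) auto
      then show False using pos by simp
    qed
  next
    fix w :: "'p \<Rightarrow> real" assume h: "\<forall>i\<in>b ` P. \<exists>p\<in>P. b p = i \<and> 1 \<le> w p"
    have "(\<Prod>p\<in>{p\<in>P. b p = i}. \<eta> (w p)) = 0" if "i \<in> b ` P" for i
      using h that assms v(2) by (intro prod_zero) auto
    then show "F w = 1" by (simp add: F_def)
  qed
qed

section \<open>Gaussian integration by parts and Gordon's inequality\<close>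

lemma integrable_mult_bounded:
  fixes f g :: "'a \<Rightarrow> real"
  assumes f: "integrable M f" and g: "g \<in> borel_measurable M" and bound: "\<And>x. \<bar>g x\<bar> \<le> B"
  shows "integrable M (\<lambda>x. f x * g x)"
proof (rule Bochner_Integration.integrable_bound)
  show "integrable M (\<lambda>x. B * f x)" using f by simp
  show "(\<lambda>x. f x * g x) \<in> borel_measurable M" using f g by simp
  have "\<bar>f x\<bar> * \<bar>g x\<bar> \<le> \<bar>f x\<bar> * \<bar>B\<bar>" for x
    using bound[of x] by (intro mult_left_mono) auto
  then show "AE x in M. norm (f x * g x) \<le> norm (B * f x)"
    by (simp add: abs_mult mult.commute)
qed

section \<open>Products of the standard normal distribution\<close>

abbreviation gaussian :: "'k set \<Rightarrow> ('k \<Rightarrow> real) measure" where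
  "gaussian K \<equiv> Pi\<^sub>M K (\<lambda>_. std_normal_distribution)"

lemma prob_space_std_normal: "prob_space std_normal_distribution"
  using real_dist_normal_dist by (simp add: real_distribution_def)

lemma borel_measurable_std_normalI:
  "\<phi> \<in> borel_measurable borel \<Longrightarrow> \<phi> \<in> borel_measurable std_normal_distribution"
  by simp

lemma
  fixes f :: "real \<Rightarrow> real"
  assumes f: "f \<in> borel_measurable borel"
  shows integrable_std_normal_iff: "integrable std_normal_distribution f \<longleftrightarrow>
      integrable lborel (\<lambda>x. std_normal_density x * f x)"
    and integral_std_normal: "(\<integral>x. f x \<partial>std_normal_distribution) =
      (\<integral>x. std_normal_density x * f x \<partial>lborel)"
proof -
  show "integrable std_normal_distribution f \<longleftrightarrow>
      integrable lborel (\<lambda>x. std_normal_density x * f x)"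
    by (subst integrable_density) (simp_all add: f normal_density_nonneg)
  show "(\<integral>x. f x \<partial>std_normal_distribution) =
      (\<integral>x. std_normal_density x * f x \<partial>lborel)"
    by (subst integral_density) (simp_all add: f normal_density_nonneg)
qed

lemma product_prob_space_std_normal: "product_prob_space (\<lambda>_. std_normal_distribution)"
  by (rule product_prob_spaceI) (rule prob_space_std_normal)

lemma prob_space_gaussian: "prob_space (gaussian K)"
  by (rule prob_space_PiM) (rule prob_space_std_normal)

lemma distr_gaussian_component:
  assumes "k \<in> K"
  shows "distr (gaussian K) std_normal_distribution (\<lambda>z. z k) = std_normal_distribution"
  using product_prob_space.PiM_component[OF product_prob_space_std_normal assms] .

lemma
  fixes \<phi> :: "real \<Rightarrow> real"
  assumes k: "k \<in> K" and [measurable]: "\<phi> \<in> borel_measurable borel"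
  shows integrable_gaussian_component_iff:
      "integrable (gaussian K) (\<lambda>z. \<phi> (z k)) \<longleftrightarrow> integrable std_normal_distribution \<phi>"
    and integral_gaussian_component:
      "(\<integral>z. \<phi> (z k) \<partial>gaussian K) = (\<integral>x. \<phi> x \<partial>std_normal_distribution)"
proof -
  have m: "(\<lambda>z. z k) \<in> measurable (gaussian K) std_normal_distribution"
    using k by (rule measurable_component_singleton)
  have [measurable]: "\<phi> \<in> borel_measurable std_normal_distribution" by simp
  show "integrable (gaussian K) (\<lambda>z. \<phi> (z k)) \<longleftrightarrow> integrable std_normal_distribution \<phi>"
    using integrable_distr_eq[OF m, of \<phi>] distr_gaussian_component[OF k] by simp
  show "(\<integral>z. \<phi> (z k) \<partial>gaussian K) = (\<integral>x. \<phi> x \<partial>std_normal_distribution)"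
    using integral_distr[OF m, of \<phi>] distr_gaussian_component[OF k] by simp
qed

lemma measurable_gaussian_component:
  "k \<in> K \<Longrightarrow> (\<lambda>z. z k) \<in> borel_measurable (gaussian K)"
  using measurable_component_singleton[of k K "\<lambda>_. std_normal_distribution"] by simp

lemma integrable_gaussian_component:
  "k \<in> K \<Longrightarrow> integrable (gaussian K) (\<lambda>z. z k)"
  using integrable_gaussian_component_iff[of k K "\<lambda>x. x"]
    integrable_std_normal_distribution_moment[of 1] by simp

lemma DERIV_std_normal_density:
  "(std_normal_density has_real_derivative - x * std_normal_density x) (at x)"
  unfolding std_normal_density_def
  by (auto intro!: derivative_eq_intros simp: field_simps)

lemma std_normal_density_minus: "std_normal_density (- x) = std_normal_density x"
  by (simp add: std_normal_density_def)

lemma std_normal_density_at_top: "((\<lambda>n. std_normal_density (real n)) \<longlonglongrightarrow> 0)"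
proof (rule tendsto_sandwich[of "\<lambda>_. 0"])
  show "\<forall>\<^sub>F n in sequentially. std_normal_density (real n) \<le> 2 / real n"
    using eventually_gt_at_top[of 0]
  proof eventually_elim
    case (elim n)
    have "1 + (real n)\<^sup>2 / 2 \<le> exp ((real n)\<^sup>2 / 2)" by (rule exp_ge_add_one_self)
    moreover have "real n \<le> (real n)\<^sup>2" using elim by (simp add: power2_eq_square)
    ultimately have "real n / 2 \<le> exp ((real n)\<^sup>2 / 2)" by linarith
    then have "exp (- ((real n)\<^sup>2 / 2)) \<le> 2 / real n"
      using elim by (simp add: exp_minus field_simps)
    moreover have "1 / sqrt (2 * pi) \<le> 1"
      using pi_gt3 by (simp add: real_le_rsqrt)
    ultimately have "1 / sqrt (2 * pi) * exp (- ((real n)\<^sup>2 / 2)) \<le> 1 * (2 / real n)"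
      by (intro mult_mono) auto
    then show ?case by (simp add: std_normal_density_def)
  qed
  show "(\<lambda>n. 2 / real n) \<longlonglongrightarrow> 0"
    by (rule lim_const_over_n)
qed (auto simp: normal_density_nonneg)

text \<open>The boundary terms come from the fundamental theorem for the Henstock-Kurzweil integral,
  which applies to discontinuous derivatives \<open>g'\<close> as well.\<close>

lemma stein_identity:
  fixes g g' :: "real \<Rightarrow> real"
  assumes g: "\<And>x. (g has_real_derivative g' x) (at x)"
    and bounds: "\<And>x. \<bar>g x\<bar> \<le> B" "\<And>x. \<bar>g' x\<bar> \<le> B"
    and [measurable]: "g' \<in> borel_measurable borel"
  shows "(\<integral>x. x * g x \<partial>std_normal_distribution) = (\<integral>x. g' x \<partial>std_normal_distribution)"
proof -
  interpret prob_space std_normal_distribution by (rule prob_space_std_normal)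
  have "continuous_on UNIV g"
    using DERIV_isCont[OF g] by (auto intro: continuous_at_imp_continuous_on)
  then have [measurable]: "g \<in> borel_measurable borel" by (rule borel_measurable_continuous_onI)
  \<comment> \<open>The derivative of \<open>h\<close> is the difference of the two integrands, so
    the claim becomes that \<open>h'\<close> integrates to zero.\<close>
  define h where "h x = - (std_normal_density x * g x)" for x
  define h' where "h' x = std_normal_density x * (x * g x) - std_normal_density x * g' x" for x
  have h: "(h has_real_derivative h' x) (at x)" for x
    unfolding h_def h'_def
    by (rule derivative_eq_intros DERIV_std_normal_density g refl)+ (simp add: algebra_simps)
  have i1: "integrable std_normal_distribution (\<lambda>x. x * g x)"
  proof (rule integrable_mult_bounded[OF _ _ bounds(1)])
    show "integrable std_normal_distribution (\<lambda>x. x)"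
      using integrable_std_normal_distribution_moment[of 1] by (simp only: power_one_right)
    show "g \<in> borel_measurable std_normal_distribution"
      by (rule borel_measurable_std_normalI) fact
  qed
  have i2: "integrable std_normal_distribution g'"
  proof (rule integrable_const_bound)
    show "AE x in std_normal_distribution. norm (g' x) \<le> B"
      unfolding real_norm_def by (intro AE_I2 bounds)
    show "g' \<in> borel_measurable std_normal_distribution"
      by (rule borel_measurable_std_normalI) fact
  qed
  have l1: "integrable lborel (\<lambda>x. std_normal_density x * (x * g x))"
    by (rule iffD1[OF integrable_std_normal_iff i1]) measurable
  have l2: "integrable lborel (\<lambda>x. std_normal_density x * g' x)"
    by (rule iffD1[OF integrable_std_normal_iff i2]) measurable
  have int: "integrable lborel h'"
    unfolding h'_def using l1 l2 by simp
  \<comment> \<open>On \<open>[- n, n]\<close> the integral of \<open>h'\<close> is the increment of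
    \<open>h\<close>, which tends to zero because \<open>g\<close> is bounded and the density
    decays. Dominated convergence passes to the whole line.\<close>
  have "(\<lambda>n. \<integral>x. indicator {- real n..real n} x *\<^sub>R h' x \<partial>lborel) \<longlonglongrightarrow> (\<integral>x. h' x \<partial>lborel)"
  proof (rule integral_dominated_convergence[where w = "\<lambda>x. norm (h' x)"])
    show "AE x in lborel. (\<lambda>n. indicator {- real n..real n} x *\<^sub>R h' x) \<longlonglongrightarrow> h' x"
    proof (rule AE_I2)
      fix x :: real
      have "\<forall>\<^sub>F n in sequentially. indicator {- real n..real n} x *\<^sub>R h' x = h' x"
        using eventually_ge_at_top[of "nat \<lceil>\<bar>x\<bar>\<rceil>"]
      proof eventually_elim
        case (elim n)
        then have "\<bar>x\<bar> \<le> real n" by linarith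
        then show ?case by (simp add: indicator_def abs_le_iff)
      qed
      then show "(\<lambda>n. indicator {- real n..real n} x *\<^sub>R h' x) \<longlonglongrightarrow> h' x"
        by (rule tendsto_eventually)
    qed
  qed (use int in \<open>auto simp: indicator_def\<close>)
  moreover have "(\<integral>x. indicator {- real n..real n} x *\<^sub>R h' x \<partial>lborel) = h (real n) - h (- real n)" for n
  proof -
    have "(h' has_integral h (real n) - h (- real n)) {- real n..real n}"
      using h by (intro fundamental_theorem_of_calculus)
        (auto simp: has_real_derivative_iff_has_vector_derivative[symmetric] intro: has_field_derivative_at_within)
    moreover have "set_integrable lborel {- real n..real n} h'"
      unfolding set_integrable_def using int by (intro integrable_mult_indicator) auto
    ultimately show ?thesis
      using set_borel_integral_eq_integral(2)[of "{- real n..real n}" h']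
      by (simp add: set_lebesgue_integral_def integral_unique)
  qed
  moreover have "(\<lambda>n. h (real n) - h (- real n)) \<longlonglongrightarrow> 0"
  proof (rule Lim_null_comparison)
    show "\<forall>\<^sub>F n in sequentially. norm (h (real n) - h (- real n)) \<le> std_normal_density (real n) * (2 * B)"
    proof (rule always_eventually, rule allI)
      fix n
      have "h (real n) - h (- real n) = std_normal_density (real n) * (g (- real n) - g (real n))"
        by (simp add: h_def std_normal_density_minus algebra_simps)
      moreover have "\<bar>g (- real n) - g (real n)\<bar> \<le> 2 * B"
        using bounds(1)[of "real n"] bounds(1)[of "- real n"] by linarith
      ultimately show "norm (h (real n) - h (- real n)) \<le> std_normal_density (real n) * (2 * B)"
        by (simp add: abs_mult normal_density_nonneg mult_left_mono)
    qed
    show "(\<lambda>n. std_normal_density (real n) * (2 * B)) \<longlonglongrightarrow> 0"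
      by (rule tendsto_mult_left_zero[OF std_normal_density_at_top])
  qed
  ultimately have "(\<integral>x. h' x \<partial>lborel) = 0"
    using LIMSEQ_unique by simp
  then have "(\<integral>x. std_normal_density x * (x * g x) \<partial>lborel) = (\<integral>x. std_normal_density x * g' x \<partial>lborel)"
    unfolding h'_def using l1 l2 by simp
  then show ?thesis
    by (simp add: integral_std_normal)
qed

text \<open>Fubini isolates coordinate \<open>k\<close>, and \<open>stein_identity\<close> applies
  for each fixed value of the other coordinates.\<close>

lemma stein_identity_gaussian:
  fixes G G' :: "('k \<Rightarrow> real) \<Rightarrow> real"
  assumes K: "finite K" "k \<in> K"
    and m: "G \<in> borel_measurable (gaussian K)" "G' \<in> borel_measurable (gaussian K)"
    and bounds: "\<And>z. \<bar>G z\<bar> \<le> B" "\<And>z. \<bar>G' z\<bar> \<le> B"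
    and deriv: "\<And>z s. ((\<lambda>s. G (z(k := s))) has_real_derivative G' (z(k := s))) (at s)"
  shows "(\<integral>z. z k * G z \<partial>gaussian K) = (\<integral>z. G' z \<partial>gaussian K)"
proof -
  interpret product_prob_space "\<lambda>_. std_normal_distribution" by (rule product_prob_space_std_normal)
  interpret GK: prob_space "gaussian K" by (rule prob_space_gaussian)
  define L where "L = K - {k}"
  have L: "K = insert k L" "finite L" "k \<notin> L" using K by (auto simp: L_def)
  have i1: "integrable (gaussian K) (\<lambda>z. z k * G z)"
    by (rule integrable_mult_bounded[OF integrable_gaussian_component[OF K(2)] m(1) bounds(1)])
  have i2: "integrable (gaussian K) G'"
  proof (rule GK.integrable_const_bound)
    show "AE z in gaussian K. norm (G' z) \<le> B"
      unfolding real_norm_def by (intro AE_I2 bounds)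
  qed fact
  have "(\<integral>z. z k * G z \<partial>gaussian K) =
      (\<integral>z. (\<integral>s. s * G (z(k := s)) \<partial>std_normal_distribution) \<partial>gaussian L)"
    using product_integral_insert[OF L(2,3) i1[unfolded L(1)]] L(1) by simp
  also have "\<dots> = (\<integral>z. (\<integral>s. G' (z(k := s)) \<partial>std_normal_distribution) \<partial>gaussian L)"
  proof (rule Bochner_Integration.integral_cong[OF refl])
    fix z assume z: "z \<in> space (gaussian L)"
    have "(\<lambda>s. G' (z(k := s))) \<in> borel_measurable std_normal_distribution"
      using measurable_comp[OF measurable_component_update[OF z L(3)] m(2)[unfolded L(1)]]
      by (simp only: comp_def)
    then show "(\<integral>s. s * G (z(k := s)) \<partial>std_normal_distribution) =
        (\<integral>s. G' (z(k := s)) \<partial>std_normal_distribution)"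
      by (intro stein_identity[where g = "\<lambda>s. G (z(k := s))", OF deriv bounds]) simp
  qed
  also have "\<dots> = (\<integral>z. G' z \<partial>gaussian K)"
    using product_integral_insert[OF L(2,3) i2[unfolded L(1)]] L(1) by simp
  finally show ?thesis .
qed

section \<open>Gaussian interpolation\<close>

text \<open>The mean value inequality bounds all difference quotients by \<open>g\<close>, so
  dominated convergence applies along every sequence tending to \<open>t\<close>.\<close>

lemma DERIV_under_integral:
  fixes h h' :: "real \<Rightarrow> 'a \<Rightarrow> real"
  assumes h: "\<And>t. integrable M (h t)" and h': "h' t \<in> borel_measurable M"
    and deriv: "\<And>t x. x \<in> space M \<Longrightarrow> ((\<lambda>t. h t x) has_real_derivative h' t x) (at t)"
    and dom: "integrable M g" "\<And>t x. x \<in> space M \<Longrightarrow> \<bar>h' t x\<bar> \<le> g x"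
  shows "((\<lambda>t. \<integral>x. h t x \<partial>M) has_real_derivative (\<integral>x. h' t x \<partial>M)) (at t)"
  unfolding has_field_derivative_iff tendsto_at_iff_sequentially comp_def
proof (intro allI impI)
  fix X :: "nat \<Rightarrow> real"
  assume X: "\<forall>i. X i \<in> UNIV - {t}" "X \<longlonglongrightarrow> t"
  have eq: "((\<integral>x. h (X i) x \<partial>M) - (\<integral>x. h t x \<partial>M)) / (X i - t) = (\<integral>x. (h (X i) x - h t x) / (X i - t) \<partial>M)" for i
    using h by simp
  show "(\<lambda>i. ((\<integral>x. h (X i) x \<partial>M) - (\<integral>x. h t x \<partial>M)) / (X i - t)) \<longlonglongrightarrow> (\<integral>x. h' t x \<partial>M)"
    unfolding eq
  proof (rule integral_dominated_convergence[where w = g])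
    show "AE x in M. (\<lambda>i. (h (X i) x - h t x) / (X i - t)) \<longlonglongrightarrow> h' t x"
    proof (rule AE_I2)
      fix x assume "x \<in> space M"
      from deriv[OF this, of t] X
      show "(\<lambda>i. (h (X i) x - h t x) / (X i - t)) \<longlonglongrightarrow> h' t x"
        unfolding has_field_derivative_iff tendsto_at_iff_sequentially comp_def by blast
    qed
    show "AE x in M. norm ((h (X i) x - h t x) / (X i - t)) \<le> g x" for i
    proof (rule AE_I2)
      fix x assume x: "x \<in> space M"
      have "norm (h (X i) x - h t x) \<le> g x * norm (X i - t)"
        by (rule field_differentiable_bound[of UNIV "\<lambda>t. h t x" "\<lambda>t. h' t x"])
          (use deriv[OF x] dom(2)[OF x] in auto)
      moreover have "X i \<noteq> t" using X(1) by auto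
      ultimately show "norm ((h (X i) x - h t x) / (X i - t)) \<le> g x"
        by (simp add: norm_divide pos_divide_le_eq)
    qed
    show "(\<lambda>x. (h (X i) x - h t x) / (X i - t)) \<in> borel_measurable M" for i
      using h by (intro borel_measurable_divide borel_measurable_diff borel_measurable_integrable) auto
    show "(\<lambda>x. h' t x) \<in> borel_measurable M" "integrable M g" by fact+
  qed
qed

lemma has_gradient_onD:
  assumes "has_gradient_on P F D" "\<And>p. p \<in> P \<Longrightarrow> ((\<lambda>s. w s p) has_real_derivative w' p) (at t)"
  shows "((\<lambda>s. F (w s)) has_real_derivative (\<Sum>p\<in>P. D p (w t) * w' p)) (at t)"
  using assms unfolding has_gradient_on_def by blast

lemma integral_mult_sum_gaussian:
  fixes A :: "'k \<Rightarrow> real"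
  assumes "finite K" and G: "G \<in> borel_measurable (gaussian K)" "\<And>z. \<bar>G z\<bar> \<le> B"
  shows "integrable (gaussian K) (\<lambda>z. G z * (\<Sum>k\<in>K. A k * z k))"
    and "(\<integral>z. G z * (\<Sum>k\<in>K. A k * z k) \<partial>gaussian K) = (\<Sum>k\<in>K. A k * (\<integral>z. z k * G z \<partial>gaussian K))"
proof -
  have i: "integrable (gaussian K) (\<lambda>z. z k * G z)" if "k \<in> K" for k
    by (rule integrable_mult_bounded[OF integrable_gaussian_component[OF that] G])
  have eq: "G z * (\<Sum>k\<in>K. A k * z k) = (\<Sum>k\<in>K. A k * (z k * G z))" for z
    by (simp add: sum_distrib_left mult_ac)
  show "integrable (gaussian K) (\<lambda>z. G z * (\<Sum>k\<in>K. A k * z k))"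
    unfolding eq using i by (intro Bochner_Integration.integrable_sum integrable_mult_right)
  show "(\<integral>z. G z * (\<Sum>k\<in>K. A k * z k) \<partial>gaussian K) = (\<Sum>k\<in>K. A k * (\<integral>z. z k * G z \<partial>gaussian K))"
    unfolding eq using i by (subst Bochner_Integration.integral_sum) simp_all
qed

lemma bounded_measurable_gaussian:
  fixes C :: "'p \<Rightarrow> 'k \<Rightarrow> real"
  assumes "bounded_measurable F"
  shows "(\<lambda>z. F (\<lambda>p. c p + (\<Sum>k\<in>K. C p k * z k))) \<in> borel_measurable (gaussian K)"
    and "integrable (gaussian K) (\<lambda>z. F (\<lambda>p. c p + (\<Sum>k\<in>K. C p k * z k)))"
proof -
  interpret GK: prob_space "gaussian K" by (rule prob_space_gaussian)
  have "(\<lambda>z p. c p + (\<Sum>k\<in>K. C p k * z k)) \<in> measurable (gaussian K) (Pi\<^sub>M UNIV (\<lambda>_. borel))"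
    by (intro measurable_PiM_single' borel_measurable_add borel_measurable_sum borel_measurable_times
        borel_measurable_const measurable_gaussian_component) auto
  from measurable_compose[OF this] assms
  show m: "(\<lambda>z. F (\<lambda>p. c p + (\<Sum>k\<in>K. C p k * z k))) \<in> borel_measurable (gaussian K)"
    unfolding bounded_measurable_def by blast
  obtain B where "\<And>w. \<bar>F w\<bar> \<le> B" using assms unfolding bounded_measurable_def by blast
  then show "integrable (gaussian K) (\<lambda>z. F (\<lambda>p. c p + (\<Sum>k\<in>K. C p k * z k)))"
    by (intro GK.integrable_const_bound[where B = B] m) simp
qed

text \<open>\<open>W\<close> is affine in \<open>z\<close>, and \<open>C q k\<close> is the slope of
  its coordinate \<open>q\<close> in direction \<open>k\<close>. The chain rule thus turns
  \<open>stein_identity_gaussian\<close> into a sum over the coordinates.\<close>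

lemma gaussian_integration_by_parts:
  fixes C :: "'p \<Rightarrow> 'k \<Rightarrow> real" and c :: "'p \<Rightarrow> real"
  assumes K: "finite K" "k \<in> K" and G: "has_gradient_on P G E" "bounded_measurable G"
    and E: "\<And>q. q \<in> P \<Longrightarrow> bounded_measurable (E q)" and P: "finite P"
  defines "W \<equiv> \<lambda>z p. c p + (\<Sum>k\<in>K. C p k * z k)"
  shows "(\<integral>z. z k * G (W z) \<partial>gaussian K) = (\<Sum>q\<in>P. C q k * (\<integral>z. E q (W z) \<partial>gaussian K))"
proof -
  obtain B where B: "\<And>w. \<bar>G w\<bar> \<le> B" using G(2) unfolding bounded_measurable_def by blast
  have "\<forall>q. \<exists>b. q \<in> P \<longrightarrow> (\<forall>w. \<bar>E q w\<bar> \<le> b)"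
    using E unfolding bounded_measurable_def by blast
  then obtain b where b: "\<And>q w. q \<in> P \<Longrightarrow> \<bar>E q w\<bar> \<le> b q" by metis
  \<comment> \<open>One constant has to dominate both the function and its derivative, as
    \<open>stein_identity_gaussian\<close> asks.\<close>
  define B' where "B' = \<bar>B\<bar> + (\<Sum>q\<in>P. b q * \<bar>C q k\<bar>)"
  have bsum: "\<bar>\<Sum>q\<in>P. E q w * C q k\<bar> \<le> (\<Sum>q\<in>P. b q * \<bar>C q k\<bar>)" for w
    using b by (intro order_trans[OF sum_abs] sum_mono) (simp add: abs_mult mult_right_mono)
  have i: "integrable (gaussian K) (\<lambda>z. E q (W z))" if "q \<in> P" for q
    unfolding W_def by (rule bounded_measurable_gaussian[OF E[OF that]])
  have "(\<integral>z. z k * G (W z) \<partial>gaussian K) = (\<integral>z. (\<Sum>q\<in>P. E q (W z) * C q k) \<partial>gaussian K)"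
  proof (rule stein_identity_gaussian[OF K])
    show "(\<lambda>z. G (W z)) \<in> borel_measurable (gaussian K)"
      unfolding W_def by (rule bounded_measurable_gaussian[OF G(2)])
    show "(\<lambda>z. \<Sum>q\<in>P. E q (W z) * C q k) \<in> borel_measurable (gaussian K)"
      using i by (intro borel_measurable_sum borel_measurable_times borel_measurable_const borel_measurable_integrable)
    have "0 \<le> (\<Sum>q\<in>P. b q * \<bar>C q k\<bar>)" using bsum abs_ge_zero order_trans by blast
    then show "\<bar>G (W z)\<bar> \<le> B'" for z
      using B[of "W z"] unfolding B'_def by linarith
    show "\<bar>\<Sum>q\<in>P. E q (W z) * C q k\<bar> \<le> B'" for z
      using bsum[of "W z"] unfolding B'_def by linarith
  next
    fix z :: "'k \<Rightarrow> real" and s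
    have "((\<lambda>s. W (z(k := s)) p) has_real_derivative C p k) (at s)" for p
    proof -
      have eq: "W (z(k := s)) p = c p + C p k * s + (\<Sum>l\<in>K - {k}. C p l * z l)" for s
        unfolding W_def using K by (simp add: sum.remove[of K k])
      show ?thesis unfolding eq by (auto intro!: derivative_eq_intros)
    qed
    then show "((\<lambda>s. G (W (z(k := s)))) has_real_derivative
        (\<Sum>q\<in>P. E q (W (z(k := s))) * C q k)) (at s)"
      by (rule has_gradient_onD[OF G(1), where w = "\<lambda>s. W (z(k := s))"])
  qed
  also have "\<dots> = (\<Sum>q\<in>P. C q k * (\<integral>z. E q (W z) \<partial>gaussian K))"
    using i by (subst Bochner_Integration.integral_sum) (simp_all add: mult.commute)
  finally show ?thesis .
qed

text \<open>The two Gaussian vectors are rotated into each other; along the rotation the derivative of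
  the expectation is a sum of cross derivatives weighted by the differences of the covariances.\<close>

lemma gordon_expectation:
  fixes A B :: "'p \<Rightarrow> 'k \<Rightarrow> real" and b :: "'p \<Rightarrow> 'b"
  assumes K: "finite K" and P: "finite P" and F: "crosspositive P b F"
    and orth: "\<And>p q. p \<in> P \<Longrightarrow> q \<in> P \<Longrightarrow> (\<Sum>k\<in>K. A p k * B q k) = 0"
    and same: "\<And>p q. p \<in> P \<Longrightarrow> q \<in> P \<Longrightarrow> b p = b q \<Longrightarrow>
      (\<Sum>k\<in>K. A p k * A q k) = (\<Sum>k\<in>K. B p k * B q k)"
    and diff: "\<And>p q. p \<in> P \<Longrightarrow> q \<in> P \<Longrightarrow> b p \<noteq> b q \<Longrightarrow>
      (\<Sum>k\<in>K. B p k * B q k) \<le> (\<Sum>k\<in>K. A p k * A q k)"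
  shows "(\<integral>z. F (\<lambda>p. c p + (\<Sum>k\<in>K. B p k * z k)) \<partial>gaussian K) \<le>
         (\<integral>z. F (\<lambda>p. c p + (\<Sum>k\<in>K. A p k * z k)) \<partial>gaussian K)"
proof -
  from F obtain D D2 where S: "smooth2 P F D D2"
    and pos: "\<And>p q w. p \<in> P \<Longrightarrow> q \<in> P \<Longrightarrow> b p \<noteq> b q \<Longrightarrow> 0 \<le> D2 p q w"
    unfolding crosspositive_def by (elim exE conjE) blast
  have gF: "has_gradient_on P F D" and bF: "bounded_measurable F"
    and gD: "\<And>p. p \<in> P \<Longrightarrow> has_gradient_on P (D p) (D2 p)"
    and bD: "\<And>p. p \<in> P \<Longrightarrow> bounded_measurable (D p)"
    and bD2: "\<And>p q. p \<in> P \<Longrightarrow> q \<in> P \<Longrightarrow> bounded_measurable (D2 p q)"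
    using S unfolding smooth2_def by blast+
  have "\<forall>p. \<exists>d. p \<in> P \<longrightarrow> (\<forall>w. \<bar>D p w\<bar> \<le> d)"
    using bD unfolding bounded_measurable_def by blast
  then obtain d where d: "\<And>p w. p \<in> P \<Longrightarrow> \<bar>D p w\<bar> \<le> d p" by metis
  \<comment> \<open>\<open>C\<close> runs from \<open>A\<close> at angle 0 to \<open>B\<close> at
    angle \<open>pi / 2\<close>; \<open>C'\<close> is its derivative in the angle.\<close>
  define C where "C \<theta> p k = cos \<theta> * A p k + sin \<theta> * B p k" for \<theta> p k
  define C' where "C' \<theta> p k = cos \<theta> * B p k - sin \<theta> * A p k" for \<theta> p k
  define W where "W \<theta> z p = c p + (\<Sum>k\<in>K. C \<theta> p k * z k)" for \<theta> z p
  define h' where "h' \<theta> z = (\<Sum>p\<in>P. D p (W \<theta> z) * (\<Sum>k\<in>K. C' \<theta> p k * z k))" for \<theta> z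
  define a where "a \<theta> = (\<integral>z. F (W \<theta> z) \<partial>gaussian K)" for \<theta>
  have iD: "integrable (gaussian K) (\<lambda>z. D p (W \<theta> z) * (\<Sum>k\<in>K. C' \<theta> p k * z k))" if "p \<in> P" for p \<theta>
    unfolding W_def by (rule integral_mult_sum_gaussian(1)[OF K bounded_measurable_gaussian(1)[OF bD[OF that]] d[OF that]])
  have deriv: "(a has_real_derivative (\<integral>z. h' \<theta> z \<partial>gaussian K)) (at \<theta>)" for \<theta>
    unfolding a_def
  proof (rule DERIV_under_integral)
    show "integrable (gaussian K) (\<lambda>z. F (W \<theta> z))" for \<theta>
      unfolding W_def by (rule bounded_measurable_gaussian[OF bF])
    show "h' \<theta> \<in> borel_measurable (gaussian K)"
      unfolding h'_def using iD by (intro borel_measurable_sum borel_measurable_integrable)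
    show "((\<lambda>\<theta>. F (W \<theta> z)) has_real_derivative h' \<theta> z) (at \<theta>)" for \<theta> z
    proof -
      have "((\<lambda>\<theta>. W \<theta> z p) has_real_derivative (\<Sum>k\<in>K. C' \<theta> p k * z k)) (at \<theta>)" for p
        unfolding W_def C_def C'_def
        by (auto intro!: derivative_eq_intros simp: algebra_simps)
      then show ?thesis
        unfolding h'_def by (rule has_gradient_onD[OF gF, where w = "\<lambda>\<theta>. W \<theta> z"])
    qed
    \<comment> \<open>Bounding sine and cosine by 1 gives a dominating function that does not depend
      on the angle.\<close>
    show "integrable (gaussian K) (\<lambda>z. \<Sum>p\<in>P. d p * (\<Sum>k\<in>K. (\<bar>A p k\<bar> + \<bar>B p k\<bar>) * \<bar>z k\<bar>))"
      by (intro Bochner_Integration.integrable_sum integrable_mult_right integrable_abs integrable_gaussian_component)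
    show "\<bar>h' \<theta> z\<bar> \<le> (\<Sum>p\<in>P. d p * (\<Sum>k\<in>K. (\<bar>A p k\<bar> + \<bar>B p k\<bar>) * \<bar>z k\<bar>))" for \<theta> z
      unfolding h'_def
    proof (intro order_trans[OF sum_abs] sum_mono)
      fix p assume p: "p \<in> P"
      have "\<bar>C' \<theta> p k\<bar> \<le> \<bar>A p k\<bar> + \<bar>B p k\<bar>" for k
      proof -
        have "\<bar>cos \<theta> * B p k\<bar> \<le> 1 * \<bar>B p k\<bar>" "\<bar>sin \<theta> * A p k\<bar> \<le> 1 * \<bar>A p k\<bar>"
          unfolding abs_mult by (intro mult_right_mono; simp)+
        then show ?thesis unfolding C'_def by linarith
      qed
      then have "\<bar>\<Sum>k\<in>K. C' \<theta> p k * z k\<bar> \<le> (\<Sum>k\<in>K. (\<bar>A p k\<bar> + \<bar>B p k\<bar>) * \<bar>z k\<bar>)"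
        by (intro order_trans[OF sum_abs] sum_mono) (simp add: abs_mult mult_right_mono)
      then show "\<bar>D p (W \<theta> z) * (\<Sum>k\<in>K. C' \<theta> p k * z k)\<bar> \<le>
          d p * (\<Sum>k\<in>K. (\<bar>A p k\<bar> + \<bar>B p k\<bar>) * \<bar>z k\<bar>)"
        unfolding abs_mult using d[OF p] by (intro mult_mono) (auto intro: order_trans[OF abs_ge_zero])
    qed
  qed
  \<comment> \<open>\<open>orth\<close> removes the terms with squared sine and cosine, which leaves
    the difference of the two covariances.\<close>
  have cov: "(\<Sum>k\<in>K. C' \<theta> p k * C \<theta> q k) =
      sin \<theta> * cos \<theta> * ((\<Sum>k\<in>K. B p k * B q k) - (\<Sum>k\<in>K. A p k * A q k))" if "p \<in> P" "q \<in> P" for \<theta> p q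
  proof -
    have "(\<Sum>k\<in>K. C' \<theta> p k * C \<theta> q k) = sin \<theta> * cos \<theta> * (\<Sum>k\<in>K. B p k * B q k)
        - sin \<theta> * cos \<theta> * (\<Sum>k\<in>K. A p k * A q k)
        + (cos \<theta> * cos \<theta> * (\<Sum>k\<in>K. A q k * B p k) - sin \<theta> * sin \<theta> * (\<Sum>k\<in>K. A p k * B q k))"
      unfolding sum_distrib_left sum_subtractf[symmetric] sum.distrib[symmetric]
      by (intro sum.cong refl) (simp add: C_def C'_def algebra_simps)
    then show ?thesis using orth that by (simp add: algebra_simps)
  qed
  have "(\<integral>z. h' \<theta> z \<partial>gaussian K) \<le> 0" if \<theta>: "0 \<le> \<theta>" "\<theta> \<le> pi / 2" for \<theta>
  proof -
    have "(\<integral>z. h' \<theta> z \<partial>gaussian K) =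
        (\<Sum>p\<in>P. \<integral>z. D p (W \<theta> z) * (\<Sum>k\<in>K. C' \<theta> p k * z k) \<partial>gaussian K)"
      unfolding h'_def using iD by (rule Bochner_Integration.integral_sum)
    also have "\<dots> = (\<Sum>p\<in>P. \<Sum>k\<in>K. C' \<theta> p k * (\<integral>z. z k * D p (W \<theta> z) \<partial>gaussian K))"
      unfolding W_def
      by (intro sum.cong refl integral_mult_sum_gaussian(2)[OF K bounded_measurable_gaussian(1)[OF bD] d])
    also have "\<dots> = (\<Sum>p\<in>P. \<Sum>k\<in>K. C' \<theta> p k * (\<Sum>q\<in>P. C \<theta> q k * (\<integral>z. D2 p q (W \<theta> z) \<partial>gaussian K)))"
      unfolding W_def
      by (intro sum.cong refl arg_cong2[where f = "(*)"] gaussian_integration_by_parts K gD bD bD2 P)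
    also have "\<dots> = (\<Sum>p\<in>P. \<Sum>q\<in>P. (\<Sum>k\<in>K. C' \<theta> p k * C \<theta> q k) * (\<integral>z. D2 p q (W \<theta> z) \<partial>gaussian K))"
      unfolding sum_distrib_left sum_distrib_right mult.assoc by (intro sum.cong refl sum.swap)
    \<comment> \<open>Inside a block the covariance difference is zero. Across blocks it is at most
      zero, against a nonnegative mean of \<open>D2 p q\<close>. The factor
      \<open>sin \<theta> * cos \<theta>\<close> is nonnegative in the first quadrant.\<close>
    also have "\<dots> \<le> 0"
    proof (intro sum_nonpos)
      fix p q assume pq: "p \<in> P" "q \<in> P"
      have sc: "0 \<le> sin \<theta> * cos \<theta>"
        using \<theta> by (intro mult_nonneg_nonneg sin_ge_zero cos_ge_zero) auto
      show "(\<Sum>k\<in>K. C' \<theta> p k * C \<theta> q k) * (\<integral>z. D2 p q (W \<theta> z) \<partial>gaussian K) \<le> 0"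
      proof (cases "b p = b q")
        case True
        then show ?thesis using same[OF pq] cov[OF pq] by simp
      next
        case False
        then have "0 \<le> (\<integral>z. D2 p q (W \<theta> z) \<partial>gaussian K)"
          using pos[OF pq] by (intro Bochner_Integration.integral_nonneg) auto
        moreover have "(\<Sum>k\<in>K. C' \<theta> p k * C \<theta> q k) \<le> 0"
          unfolding cov[OF pq] using diff[OF pq False] sc by (intro mult_nonneg_nonpos) auto
        ultimately show ?thesis by (intro mult_nonpos_nonneg)
      qed
    qed
    finally show ?thesis .
  qed
  then have "a (pi / 2) \<le> a 0"
    by (intro DERIV_nonpos_imp_nonincreasing[of 0 "pi / 2" a]) (auto intro!: exI deriv)
  then show ?thesis
    by (simp add: a_def W_def[abs_def] C_def)
qed

text \<open>The blocks \<open>b p\<close> index the minimum, the points within a block the maximum.\<close>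

theorem gordon_comparison:
  fixes A B :: "'p \<Rightarrow> 'k \<Rightarrow> real" and b :: "'p \<Rightarrow> 'b"
  assumes K: "finite K" and P: "finite P"
    and "\<And>p q. p \<in> P \<Longrightarrow> q \<in> P \<Longrightarrow> (\<Sum>k\<in>K. A p k * B q k) = 0"
    and "\<And>p q. p \<in> P \<Longrightarrow> q \<in> P \<Longrightarrow> b p = b q \<Longrightarrow>
      (\<Sum>k\<in>K. A p k * A q k) = (\<Sum>k\<in>K. B p k * B q k)"
    and "\<And>p q. p \<in> P \<Longrightarrow> q \<in> P \<Longrightarrow> b p \<noteq> b q \<Longrightarrow>
      (\<Sum>k\<in>K. B p k * B q k) \<le> (\<Sum>k\<in>K. A p k * A q k)"
  shows "measure (gaussian K) {z \<in> space (gaussian K).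
            \<forall>i\<in>b ` P. \<exists>p\<in>P. b p = i \<and> 1 \<le> c p + (\<Sum>k\<in>K. B p k * z k)}
       \<le> measure (gaussian K) {z \<in> space (gaussian K).
            \<forall>i\<in>b ` P. \<exists>p\<in>P. b p = i \<and> 0 < c p + (\<Sum>k\<in>K. A p k * z k)}"
    (is "measure _ ?S \<le> measure _ ?T")
proof -
  interpret GK: prob_space "gaussian K" by (rule prob_space_gaussian)
  obtain F where F: "crosspositive P b F"
    "\<And>w. 0 < F w \<Longrightarrow> \<forall>i\<in>b ` P. \<exists>p\<in>P. b p = i \<and> 0 < w p"
    "\<And>w. \<forall>i\<in>b ` P. \<exists>p\<in>P. b p = i \<and> 1 \<le> w p \<Longrightarrow> F w = 1"
    using crosspositive_minmax_exists[OF P] by blast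
  have range: "0 \<le> F w" "F w \<le> 1" and bF: "bounded_measurable F" for w
    using F(1) unfolding crosspositive_def smooth2_def by blast+
  have m: "(\<lambda>z. c p + (\<Sum>k\<in>K. C p k * z k)) \<in> borel_measurable (gaussian K)" for p and C :: "'p \<Rightarrow> 'k \<Rightarrow> real"
    by (intro borel_measurable_add borel_measurable_sum borel_measurable_times
        borel_measurable_const measurable_gaussian_component)
  have mS: "?S \<in> sets (gaussian K)" and mT: "?T \<in> sets (gaussian K)"
    using m[of _ A] m[of _ B] P by (measurable, auto)+
  \<comment> \<open>\<open>F\<close> separates the two indicators: it equals 1 where every block
    reaches 1 and is positive only where every block exceeds 0. The gap between the thresholds is
    the price of smoothness.\<close>
  have "measure (gaussian K) ?S = (\<integral>z. indicator ?S z \<partial>gaussian K)"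
    by (simp, intro arg_cong[where f = "measure _"], blast)
  also have "\<dots> \<le> (\<integral>z. F (\<lambda>p. c p + (\<Sum>k\<in>K. B p k * z k)) \<partial>gaussian K)"
  proof (intro integral_mono bounded_measurable_gaussian(2)[OF bF])
    show "integrable (gaussian K) (indicator ?S :: _ \<Rightarrow> real)"
      by (rule integrable_real_indicator[OF mS]) (simp add: less_top[symmetric])
    show "indicator ?S z \<le> F (\<lambda>p. c p + (\<Sum>k\<in>K. B p k * z k))" for z
      using F(3)[of "\<lambda>p. c p + (\<Sum>k\<in>K. B p k * z k)"] range[of "\<lambda>p. c p + (\<Sum>k\<in>K. B p k * z k)"]
      by (cases "z \<in> ?S") auto
  qed
  also have "\<dots> \<le> (\<integral>z. F (\<lambda>p. c p + (\<Sum>k\<in>K. A p k * z k)) \<partial>gaussian K)"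
    by (rule gordon_expectation[OF K P F(1)]) (use assms in auto)
  also have "\<dots> \<le> (\<integral>z. indicator ?T z \<partial>gaussian K)"
  proof (intro integral_mono bounded_measurable_gaussian(2)[OF bF])
    show "F (\<lambda>p. c p + (\<Sum>k\<in>K. A p k * z k)) \<le> indicator ?T z" if "z \<in> space (gaussian K)" for z
    proof (cases "z \<in> ?T")
      case True
      then show ?thesis using range by simp
    next
      case False
      then have "\<not> 0 < F (\<lambda>p. c p + (\<Sum>k\<in>K. A p k * z k))" using F(2) that by blast
      then show ?thesis using False by simp
    qed
    show "integrable (gaussian K) (indicator ?T :: _ \<Rightarrow> real)"
      by (rule integrable_real_indicator[OF mT]) (simp add: less_top[symmetric])
  qed
  also have "\<dots> = measure (gaussian K) ?T"
    by (simp, intro arg_cong[where f = "measure _"], blast)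
  finally show ?thesis .
qed

section \<open>Weak law and the expected loss\<close>

text \<open>Writes a product of two coordinates as a product over all of \<open>K\<close> with
  trivial factors, the form in which integrals factor over a product measure.\<close>

lemma prod_gaussian_pair:
  fixes f :: "'k \<Rightarrow> real \<Rightarrow> real"
  assumes "finite K" "k \<in> K" "l \<in> K" "k \<noteq> l"
  shows "(\<Prod>i\<in>K. if i \<in> {k, l} then f i (z i) else 1) = f k (z k) * f l (z l)"
proof -
  have "(\<Prod>i\<in>K. if i \<in> {k, l} then f i (z i) else 1) = (\<Prod>i\<in>K \<inter> {k, l}. f i (z i))"
    by (rule prod.inter_restrict[OF assms(1), symmetric])
  also have "K \<inter> {k, l} = {k, l}" using assms by auto
  finally show ?thesis using assms(4) by simp
qed

lemma gaussian_components_orthogonal: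
  fixes \<psi> :: "real \<Rightarrow> real"
  assumes K: "finite K" "k \<in> K" "l \<in> K" "k \<noteq> l"
    and i: "integrable std_normal_distribution \<psi>" and mean: "(\<integral>x. \<psi> x \<partial>std_normal_distribution) = 0"
  shows "integrable (gaussian K) (\<lambda>z. \<psi> (z k) * \<psi> (z l))"
    and "(\<integral>z. \<psi> (z k) * \<psi> (z l) \<partial>gaussian K) = 0"
proof -
  interpret product_prob_space "\<lambda>_. std_normal_distribution" by (rule product_prob_space_std_normal)
  interpret N: prob_space std_normal_distribution by (rule prob_space_std_normal)
  define f where "f i x = (if i \<in> {k, l} then \<psi> x else 1)" for i x
  have fi: "integrable std_normal_distribution (f i)" for i
    using i unfolding f_def by (cases "i \<in> {k, l}") auto
  have eq: "(\<Prod>i\<in>K. f i (z i)) = \<psi> (z k) * \<psi> (z l)" for z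
    unfolding f_def using prod_gaussian_pair[OF K, of "\<lambda>_. \<psi>"] .
  show "integrable (gaussian K) (\<lambda>z. \<psi> (z k) * \<psi> (z l))"
    using product_integrable_prod[OF K(1), of f] fi by (simp add: eq)
  have "(\<integral>z. \<psi> (z k) * \<psi> (z l) \<partial>gaussian K) = (\<Prod>i\<in>K. \<integral>x. f i x \<partial>std_normal_distribution)"
    using product_integral_prod[OF K(1), of f] fi by (simp add: eq)
  also have "\<dots> = 0"
    using K(1,2) mean by (intro prod_zero bexI[of _ k]) (auto simp: f_def)
  finally show "(\<integral>z. \<psi> (z k) * \<psi> (z l) \<partial>gaussian K) = 0" .
qed

text \<open>Chebyshev's inequality: centred components are orthogonal, so the second moment of their
  sum is \<open>card L\<close> times a single variance. The subset \<open>L\<close> allows one row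
  or one column of a larger Gaussian family to be summed.\<close>

lemma gaussian_weak_law:
  fixes \<phi> :: "real \<Rightarrow> real"
  assumes K: "finite K" "L \<subseteq> K" "L \<noteq> {}" and m: "\<phi> \<in> borel_measurable borel"
    and sq: "integrable std_normal_distribution (\<lambda>x. (\<phi> x)\<^sup>2)" and "\<tau> > 0"
  defines "\<mu> \<equiv> \<integral>x. \<phi> x \<partial>std_normal_distribution"
  shows "measure (gaussian K) {z \<in> space (gaussian K). real (card L) * \<tau> \<le> \<bar>(\<Sum>k\<in>L. \<phi> (z k)) - real (card L) * \<mu>\<bar>}
    \<le> (\<integral>x. (\<phi> x - \<mu>)\<^sup>2 \<partial>std_normal_distribution) / (real (card L) * \<tau>\<^sup>2)"
proof -
  interpret GK: prob_space "gaussian K" by (rule prob_space_gaussian)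
  interpret N: prob_space std_normal_distribution by (rule prob_space_std_normal)
  have L: "finite L" "card L > 0" using K finite_subset by (auto simp: card_gt_0_iff)
  have mN: "\<phi> \<in> borel_measurable std_normal_distribution" by (rule borel_measurable_std_normalI[OF m])
  have i\<phi>: "integrable std_normal_distribution \<phi>"
    using N.square_integrable_imp_integrable[OF mN sq] .
  define \<psi> where "\<psi> x = \<phi> x - \<mu>" for x
  have \<psi>: "\<psi> \<in> borel_measurable borel" unfolding \<psi>_def[abs_def] using m by simp
  have i\<psi>: "integrable std_normal_distribution \<psi>" unfolding \<psi>_def[abs_def] using i\<phi> by simp
  have mean: "(\<integral>x. \<psi> x \<partial>std_normal_distribution) = 0"
    unfolding \<psi>_def using i\<phi> by (simp add: \<mu>_def N.prob_space[simplified])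
  have sq\<psi>: "integrable std_normal_distribution (\<lambda>x. (\<psi> x)\<^sup>2)"
    unfolding \<psi>_def power2_diff using sq i\<phi> by (intro Bochner_Integration.integrable_add Bochner_Integration.integrable_diff) auto
  have pair: "integrable (gaussian K) (\<lambda>z. \<psi> (z k) * \<psi> (z l))" if "k \<in> L" "l \<in> L" for k l
  proof (cases "k = l")
    case True
    have "(\<lambda>x. (\<psi> x)\<^sup>2) \<in> borel_measurable borel" using \<psi> by simp
    from integrable_gaussian_component_iff[OF _ this, of k K] sq\<psi> True that K(2) show ?thesis
      by (auto simp: power2_eq_square)
  next
    case False
    then show ?thesis using that K gaussian_components_orthogonal(1)[OF K(1) _ _ False i\<psi> mean] by auto
  qed
  have eq: "(\<Sum>k\<in>L. \<psi> (z k))\<^sup>2 = (\<Sum>k\<in>L. \<Sum>l\<in>L. \<psi> (z k) * \<psi> (z l))" for z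
    by (simp add: power2_eq_square sum_product)
  have int: "integrable (gaussian K) (\<lambda>z. (\<Sum>k\<in>L. \<psi> (z k))\<^sup>2)"
    unfolding eq using pair by (intro Bochner_Integration.integrable_sum)
  define v where "v = (\<integral>x. (\<psi> x)\<^sup>2 \<partial>std_normal_distribution)"
  have cov: "(\<integral>z. \<psi> (z k) * \<psi> (z l) \<partial>gaussian K) = (if k = l then v else 0)" if "k \<in> L" "l \<in> L" for k l
  proof (cases "k = l")
    case True
    have "(\<lambda>x. (\<psi> x)\<^sup>2) \<in> borel_measurable borel" using \<psi> by simp
    from integral_gaussian_component[OF _ this, of k K] True that K(2) show ?thesis
      by (auto simp: power2_eq_square v_def)
  next
    case False
    then show ?thesis using that K gaussian_components_orthogonal(2)[OF K(1) _ _ False i\<psi> mean] by auto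
  qed
  have "(\<integral>z. (\<Sum>k\<in>L. \<psi> (z k))\<^sup>2 \<partial>gaussian K) = (\<Sum>k\<in>L. \<Sum>l\<in>L. \<integral>z. \<psi> (z k) * \<psi> (z l) \<partial>gaussian K)"
    unfolding eq using pair by (simp add: Bochner_Integration.integral_sum Bochner_Integration.integrable_sum)
  also have "\<dots> = (\<Sum>k\<in>L. \<Sum>l\<in>L. if k = l then v else 0)"
    using cov by (intro sum.cong refl) auto
  also have "\<dots> = real (card L) * v" using L by simp
  finally have var: "(\<integral>z. (\<Sum>k\<in>L. \<psi> (z k))\<^sup>2 \<partial>gaussian K) = real (card L) * v" .
  have m\<psi>: "(\<lambda>z. \<Sum>k\<in>L. \<psi> (z k)) \<in> borel_measurable (gaussian K)"
    using K(2) by (intro borel_measurable_sum measurable_compose[OF measurable_gaussian_component \<psi>]) auto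
  have "measure (gaussian K) {z \<in> space (gaussian K). real (card L) * \<tau> \<le> \<bar>\<Sum>k\<in>L. \<psi> (z k)\<bar>}
      \<le> (\<integral>z. (\<Sum>k\<in>L. \<psi> (z k))\<^sup>2 \<partial>gaussian K) / (real (card L) * \<tau>)\<^sup>2"
    using L \<open>\<tau> > 0\<close> by (intro GK.second_moment_method m\<psi> int) auto
  also have "\<dots> = v / (real (card L) * \<tau>\<^sup>2)"
    unfolding var using L by (simp add: power2_eq_square)
  finally show ?thesis
    by (simp add: \<psi>_def v_def sum_subtractf)
qed

section \<open>The error function and Gaussian quantiles\<close>

lemma DERIV_erf: "(erf has_real_derivative 2 / sqrt pi * exp (- x\<^sup>2)) (at x)"
proof -
  \<comment> \<open>Places both 0 and \<open>x\<close> in the interior of the interval, so that the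
    derivative within it is the full derivative.\<close>
  define r where "r = \<bar>x\<bar> + 1"
  have "((\<lambda>u. LBINT t=0..u. exp (- t\<^sup>2)) has_vector_derivative exp (- x\<^sup>2)) (at x within {- r..r})"
    unfolding zero_ereal_def
    by (rule interval_integral_FTC2) (auto simp: r_def intro!: continuous_intros)
  moreover have "at x within {- r..r} = at x"
    by (rule at_within_interior) (auto simp: r_def interior_atLeastAtMost_real)
  ultimately have "((\<lambda>u. LBINT t=0..u. exp (- t\<^sup>2)) has_real_derivative exp (- x\<^sup>2)) (at x)"
    by (simp add: has_real_derivative_iff_has_vector_derivative)
  then show ?thesis
    unfolding erf_def[abs_def] by (rule DERIV_cmult)
qed

lemma erf_minus: "erf (- z) = - erf z"
proof -
  have "(LBINT t=0..- z. exp (- t\<^sup>2)) = (LBINT t=z..0. exp (- t\<^sup>2))"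
    using interval_integral_reflect[of 0 "ereal (- z)" "\<lambda>t. exp (- t\<^sup>2)"] by simp
  also have "\<dots> = - (LBINT t=0..z. exp (- t\<^sup>2))"
    by (rule interval_integral_endpoints_reverse)
  finally show ?thesis by (simp add: erf_def)
qed

lemma measure_std_normal_Icc:
  assumes "a \<le> b"
  shows "measure std_normal_distribution {a..b} = (erf (b / sqrt 2) - erf (a / sqrt 2)) / 2"
proof -
  interpret N: prob_space std_normal_distribution by (rule prob_space_std_normal)
  have d: "((\<lambda>x. erf (x / sqrt 2) / 2) has_real_derivative std_normal_density x) (at x)" for x
    using DERIV_cdivide[OF DERIV_chain2[OF DERIV_erf[of "x / sqrt 2"] DERIV_cdivide[OF DERIV_ident]], of 2]
    by (simp add: std_normal_density_def power_divide real_sqrt_mult field_simps)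
  have "measure std_normal_distribution {a..b} = (\<integral>x. indicator {a..b} x \<partial>std_normal_distribution)"
    by simp
  also have "\<dots> = (\<integral>x. std_normal_density x * indicator {a..b} x \<partial>lborel)"
    by (rule integral_std_normal) simp
  also have "\<dots> = erf (b / sqrt 2) / 2 - erf (a / sqrt 2) / 2"
    by (rule integral_FTC_Icc_nonneg[where F = "\<lambda>x. erf (x / sqrt 2) / 2"])
      (use assms d in \<open>auto simp: normal_density_nonneg intro: has_field_derivative_at_within\<close>)
  finally show ?thesis by (simp add: field_simps)
qed

text \<open>Since \<open>erf\<close> is odd, \<open>erf (n / sqrt 2)\<close> is the mass of
  \<open>[- n, n]\<close>, and the limit is the total mass.\<close>

lemma erf_at_top: "(\<lambda>n. erf (real n / sqrt 2)) \<longlonglongrightarrow> 1"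
proof -
  interpret N: prob_space std_normal_distribution by (rule prob_space_std_normal)
  have "(\<lambda>n. measure std_normal_distribution {- real n..real n}) \<longlonglongrightarrow>
      measure std_normal_distribution (\<Union>n. {- real n..real n})"
    by (rule N.finite_Lim_measure_incseq) (auto simp: incseq_def)
  moreover have "(\<Union>n. {- real n..real n}) = space std_normal_distribution"
  proof -
    have "\<exists>n. x \<in> {- real n..real n}" for x
    proof -
      obtain n where "\<bar>x\<bar> \<le> real n" using real_arch_simple by blast
      then have "x \<in> {- real n..real n}" by auto
      then show ?thesis ..
    qed
    then show ?thesis by auto
  qed
  ultimately show ?thesis
    using N.prob_space by (simp add: measure_std_normal_Icc erf_minus)
qed

text \<open>\<open>inv\<close> picks some preimage whenever there is one, so the equation reduces to
  surjectivity onto \<open>(-1, 1)\<close>, which the intermediate value theorem supplies.\<close>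

lemma erf_erfinv:
  assumes "-1 < y" "y < 1"
  shows "erf (erfinv y) = y"
proof -
  have lim: "\<forall>\<^sub>F n in sequentially. \<bar>y\<bar> < erf (real n / sqrt 2)"
    using order_tendstoD(1)[OF erf_at_top, of "\<bar>y\<bar>"] assms by auto
  then obtain n where n: "\<bar>y\<bar> < erf (real n / sqrt 2)"
    by (auto simp: eventually_sequentially)
  have "\<exists>x\<ge>- (real n / sqrt 2). x \<le> real n / sqrt 2 \<and> erf x = y"
  proof (rule IVT)
    show "erf (- (real n / sqrt 2)) \<le> y" "y \<le> erf (real n / sqrt 2)"
      using n by (auto simp: erf_minus)
    show "- (real n / sqrt 2) \<le> real n / sqrt 2"
      by (rule order_trans[of _ 0]) auto
  qed (use DERIV_isCont[OF DERIV_erf] in auto)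
  then have "y \<in> range erf" by auto
  then show ?thesis unfolding erfinv_def by (rule f_inv_into_f)
qed

text \<open>At \<open>q = sqrt 2 * erfinv (1 - 2 * f)\<close> the value is \<open>f\<close>, which
  identifies this \<open>q\<close> as the \<open>(1 - f)\<close>-quantile.\<close>

lemma measure_std_normal_upper_tail:
  "measure std_normal_distribution {q<..} = (1 - erf (q / sqrt 2)) / 2"
proof -
  interpret N: prob_space std_normal_distribution by (rule prob_space_std_normal)
  have "(\<lambda>n. measure std_normal_distribution {q..q + real n}) \<longlonglongrightarrow>
      measure std_normal_distribution (\<Union>n. {q..q + real n})"
    by (rule N.finite_Lim_measure_incseq) (auto simp: incseq_def)
  moreover have "(\<Union>n. {q..q + real n}) = {q..}"
  proof -
    have "\<exists>n. x \<in> {q..q + real n}" if "q \<le> x" for x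
      using real_arch_simple[of "x - q"] that by (auto simp: algebra_simps)
    then show ?thesis by auto
  qed
  moreover have "(\<lambda>n. measure std_normal_distribution {q..q + real n}) \<longlonglongrightarrow> (1 - erf (q / sqrt 2)) / 2"
  proof -
    \<comment> \<open>\<open>q + n\<close> is at least \<open>n - k\<close>, so the limit already
      known along the integers, shifted by \<open>k\<close>, bounds the sequence from below.\<close>
    obtain k where k: "- q \<le> real k" using real_arch_simple by blast
    have "(\<lambda>n. erf ((q + real n) / sqrt 2)) \<longlonglongrightarrow> 1"
    proof (rule tendsto_sandwich)
      have mono: "erf x \<le> erf y" if "x \<le> y" for x y
        using that by (rule DERIV_nonneg_imp_nondecreasing) (auto intro!: exI DERIV_erf)
      have up: "erf x \<le> 1" for x
      proof -
        obtain k where "x * sqrt 2 \<le> real k" using real_arch_simple by blast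
        then have "\<forall>n\<ge>k. erf x \<le> erf (real n / sqrt 2)"
          by (intro allI impI mono) (simp add: field_simps)
        then show ?thesis by (intro LIMSEQ_le_const[OF erf_at_top]) blast
      qed
      show "\<forall>\<^sub>F n in sequentially. erf ((q + real n) / sqrt 2) \<le> 1" by (simp add: up)
      show "\<forall>\<^sub>F n in sequentially. erf (real (n - k) / sqrt 2) \<le> erf ((q + real n) / sqrt 2)"
        using eventually_ge_at_top[of k]
      proof eventually_elim
        case (elim n)
        then show ?case using k by (intro mono divide_right_mono) (auto simp: of_nat_diff)
      qed
      show "(\<lambda>n. erf (real (n - k) / sqrt 2)) \<longlonglongrightarrow> 1"
        using LIMSEQ_offset[of "\<lambda>n. erf (real (n - k) / sqrt 2)" k] erf_at_top by simp
    qed simp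
    then have "(\<lambda>n. (erf ((q + real n) / sqrt 2) - erf (q / sqrt 2)) / 2) \<longlonglongrightarrow> (1 - erf (q / sqrt 2)) / 2"
      by (intro tendsto_intros) simp_all
    then show ?thesis by (simp add: measure_std_normal_Icc)
  qed
  ultimately have "measure std_normal_distribution {q..} = (1 - erf (q / sqrt 2)) / 2"
    by (metis LIMSEQ_unique)
  moreover have "measure std_normal_distribution {q..} =
      measure std_normal_distribution {q} + measure std_normal_distribution {q<..}"
    by (subst N.finite_measure_Union[symmetric]) (auto intro!: arg_cong[where f = "measure _"])
  moreover have "measure std_normal_distribution {q} = 0"
    using measure_std_normal_Icc[of q q] by simp
  ultimately show ?thesis by simp
qed

text \<open>Capping the losses at the value they take at the \<open>(1 - f)\<close>-quantile linearises the
  sum over the best \<open>(1 - f)\<close>-fraction of the patterns.\<close>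

definition capped_loss :: "real \<Rightarrow> real \<Rightarrow> real \<Rightarrow> real" where
  "capped_loss f \<kappa> t = min ((max 0 (\<kappa> + t))\<^sup>2) (nu_wb f \<kappa>)"

lemma capped_loss_bounds: "0 \<le> capped_loss f \<kappa> t" "capped_loss f \<kappa> t \<le> nu_wb f \<kappa>"
  "capped_loss f \<kappa> t \<le> (max 0 (\<kappa> + t))\<^sup>2"
  by (auto simp: capped_loss_def nu_wb_def)

lemma borel_measurable_capped_loss: "capped_loss f \<kappa> \<in> borel_measurable borel"
  unfolding capped_loss_def[abs_def] by measurable

text \<open>\<open>root\<close> makes \<open>sqrt (nu_wb f \<kappa>) - \<kappa>\<close> equal to the
  quantile \<open>q\<close>. The loss is \<open>(t + \<kappa>)^2\<close> on
  \<open>[- \<kappa>, q]\<close>, which contributes \<open>f_err\<close>, and equals the cap beyond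
  \<open>q\<close>, an event of mass \<open>f\<close>.\<close>

lemma expectation_capped_loss:
  assumes f: "0 < f" "f < 1" and root: "sqrt 2 * erfinv (1 - 2 * f) + \<kappa> \<ge> 0"
  shows "(\<integral>t. capped_loss f \<kappa> t \<partial>std_normal_distribution) = f_err f \<kappa> + nu_wb f \<kappa> * f"
proof -
  interpret N: prob_space std_normal_distribution by (rule prob_space_std_normal)
  define q where "q = sqrt 2 * erfinv (1 - 2 * f)"
  define c where "c = nu_wb f \<kappa>"
  have c: "c = (q + \<kappa>)\<^sup>2" "sqrt c = q + \<kappa>"
    using root by (auto simp: c_def nu_wb_def q_def)
  have q: "- \<kappa> \<le> q" using root by (simp add: q_def)
  have tail: "measure std_normal_distribution {q<..} = f"
    using measure_std_normal_upper_tail[of q] erf_erfinv[of "1 - 2 * f"] f by (simp add: q_def)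
  have split: "capped_loss f \<kappa> t = (t + \<kappa>)\<^sup>2 * indicator {- \<kappa>..q} t + c * indicator {q<..} t" for t
  proof -
    consider "t < - \<kappa>" | "- \<kappa> \<le> t" "t \<le> q" | "q < t" by linarith
    then show ?thesis
    proof cases
      case 1
      then show ?thesis using q c by (simp add: capped_loss_def c_def[symmetric])
    next
      case 2
      then have "(\<kappa> + t)\<^sup>2 \<le> (q + \<kappa>)\<^sup>2" by (intro power_mono) auto
      then show ?thesis using 2 c by (simp add: capped_loss_def c_def[symmetric] add.commute)
    next
      case 3
      then have "(q + \<kappa>)\<^sup>2 \<le> (\<kappa> + t)\<^sup>2" using q by (intro power_mono) auto
      then show ?thesis using 3 q c by (simp add: capped_loss_def c_def[symmetric])
    qed
  qed
  have m1: "(\<lambda>t. (t + \<kappa>)\<^sup>2 * indicator {- \<kappa>..q} t) \<in> borel_measurable borel" by measurable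
  have i1: "integrable std_normal_distribution (\<lambda>t. (t + \<kappa>)\<^sup>2 * indicator {- \<kappa>..q} t)"
  proof (rule N.integrable_const_bound[where B = c])
    have "(t + \<kappa>)\<^sup>2 * indicator {- \<kappa>..q} t \<le> c" for t
      using split[of t] capped_loss_bounds(2)[of f \<kappa> t] c by (auto simp: c_def indicator_def split: if_splits)
    then show "AE t in std_normal_distribution. norm ((t + \<kappa>)\<^sup>2 * indicator {- \<kappa>..q} t) \<le> c"
      by (intro AE_I2) simp
  qed (rule borel_measurable_std_normalI[OF m1])
  have "f_err f \<kappa> = (\<integral>t. std_normal_density t * ((t + \<kappa>)\<^sup>2 * indicator {- \<kappa>..q} t) \<partial>lborel)"
  proof -
    have "(LBINT t=-\<kappa>..sqrt (nu_wb f \<kappa>) - \<kappa>. (t + \<kappa>)\<^sup>2 * exp (- (t\<^sup>2 / 2))) =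
        (LBINT t:{- \<kappa>..q}. (t + \<kappa>)\<^sup>2 * exp (- (t\<^sup>2 / 2)))"
      using interval_integral_Icc[OF q] c by (simp add: c_def)
    then have "f_err f \<kappa> = (\<integral>t. 1 / sqrt (2 * pi) * (indicator {- \<kappa>..q} t *\<^sub>R ((t + \<kappa>)\<^sup>2 * exp (- (t\<^sup>2 / 2)))) \<partial>lborel)"
      unfolding f_err_def set_lebesgue_integral_def by simp
    also have "\<dots> = (\<integral>t. std_normal_density t * ((t + \<kappa>)\<^sup>2 * indicator {- \<kappa>..q} t) \<partial>lborel)"
      by (intro Bochner_Integration.integral_cong refl) (simp add: std_normal_density_def)
    finally show ?thesis .
  qed
  also have "\<dots> = (\<integral>t. (t + \<kappa>)\<^sup>2 * indicator {- \<kappa>..q} t \<partial>std_normal_distribution)"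
    by (rule integral_std_normal[OF m1, symmetric])
  finally have e: "(\<integral>t. (t + \<kappa>)\<^sup>2 * indicator {- \<kappa>..q} t \<partial>std_normal_distribution) = f_err f \<kappa>" ..
  have i2: "integrable std_normal_distribution (indicator {q<..} :: real \<Rightarrow> real)"
    by (rule integrable_real_indicator) (simp_all add: less_top[symmetric])
  have "(\<integral>t. indicator {q<..} t \<partial>std_normal_distribution) = f"
    using tail by simp
  then show ?thesis
    unfolding split using i1 i2 e by (simp add: c_def)
qed

section \<open>The perceptron minimax\<close>

lemma unit_sphere_iff: "x \<in> unit_sphere n \<longleftrightarrow> (\<Sum>j<n. (x j)\<^sup>2) = 1"
  by (simp add: unit_sphere_def L2_set_def)

lemma unit_sphere_abs_le_1:
  assumes "x \<in> unit_sphere n" "j < n"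
  shows "\<bar>x j\<bar> \<le> 1"
proof -
  have "(x j)\<^sup>2 \<le> (\<Sum>j<n. (x j)\<^sup>2)" using assms(2) by (intro member_le_sum) auto
  then show ?thesis using assms(1) by (simp add: unit_sphere_iff abs_square_le_1)
qed

lemma nonneg_unit_sphereD:
  assumes "l \<in> nonneg_unit_sphere m"
  shows "l \<in> unit_sphere m" "i < m \<Longrightarrow> 0 \<le> l i" "i < m \<Longrightarrow> \<bar>l i\<bar> \<le> 1"
  using assms unit_sphere_abs_le_1[of l m i] by (auto simp: nonneg_unit_sphere_def)

lemma selectionsD:
  assumes "d \<in> selections m f" "i < m"
  shows "d i = 0 \<or> d i = 1" "0 \<le> d i" "d i \<le> 1" "\<bar>d i\<bar> \<le> 1" "(d i)\<^sup>2 = d i"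
  using assms by (force simp: selections_def)+

lemma unit_vector_in_unit_sphere: "i < n \<Longrightarrow> (\<lambda>j. if j = i then 1 else 0) \<in> unit_sphere n"
  by (simp add: unit_sphere_iff if_distrib[where f = "\<lambda>x. x\<^sup>2"] sum.delta cong: if_cong)

lemma unit_vector_in_nonneg_unit_sphere:
  "i < n \<Longrightarrow> (\<lambda>j. if j = i then 1 else 0) \<in> nonneg_unit_sphere n"
  using unit_vector_in_unit_sphere by (simp add: nonneg_unit_sphere_def)

lemma selections_nonempty:
  assumes "0 < f" "f < 1" "(1 - f) * real m \<in> \<int>"
  shows "selections m f \<noteq> {}"
proof -
  have "0 \<le> (1 - f) * real m" using assms by simp
  with assms(3) obtain k where k: "(1 - f) * real m = real k"
    by (metis Ints_cases zero_le_imp_eq_int of_int_0_le_iff of_int_of_nat_eq)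
  have "real k \<le> real m" unfolding k[symmetric] using assms by (simp add: mult_left_le_one_le)
  then have "{..<m} \<inter> {i. i < k} = {..<k}" by auto
  then have "(\<Sum>i<m. if i < k then 1 else 0 :: real) = real k"
    by (simp add: sum.If_cases)
  then have "(\<lambda>i. if i < k then 1 else 0) \<in> selections m f"
    by (simp add: selections_def k)
  then show ?thesis by blast
qed

text \<open>A discarded row lets the multiplier concentrate there, which makes the form vanish; this
  is how \<open>xi_wb_nonneg\<close> is obtained.\<close>

lemma selection_zero_exists:
  assumes "0 < f" "0 < m" "d \<in> selections m f"
  obtains i where "i < m" "d i = 0"
proof -
  have "\<exists>i<m. d i = 0"
  proof (rule ccontr)
    assume "\<not> ?thesis"
    then have "d i = 1" if "i < m" for i using selectionsD(1)[OF assms(3) that] that by blast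
    then have "(\<Sum>i<m. d i) = real m" by simp
    then have "(1 - f) * real m = real m" using assms(3) by (simp add: selections_def)
    then show False using assms(1,2) by simp
  qed
  then show ?thesis using that by blast
qed

text \<open>A crude entrywise estimate, used with \<open>e = 1\<close> when the matrix varies and
  with \<open>e\<close> the mesh of a net when \<open>x\<close> varies. Its growth with the
  dimensions is harmless because the mesh is chosen after them.\<close>

lemma abs_bilinear_sum_le:
  fixes G :: "nat \<Rightarrow> nat \<Rightarrow> real"
  assumes "\<And>i. i < m \<Longrightarrow> \<bar>u i\<bar> \<le> 1" "\<And>j. j < n \<Longrightarrow> \<bar>x j\<bar> \<le> e"
  shows "\<bar>\<Sum>i<m. u i * (\<Sum>j<n. G i j * x j)\<bar> \<le> (\<Sum>i<m. \<Sum>j<n. \<bar>G i j\<bar>) * e"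
proof -
  have "\<bar>u i * (\<Sum>j<n. G i j * x j)\<bar> \<le> (\<Sum>j<n. \<bar>G i j\<bar> * e)" if "i < m" for i
  proof -
    have "\<bar>\<Sum>j<n. G i j * x j\<bar> \<le> (\<Sum>j<n. \<bar>G i j\<bar> * e)"
      using assms(2) by (intro order_trans[OF sum_abs] sum_mono) (auto simp: abs_mult intro!: mult_left_mono)
    moreover have "\<bar>u i\<bar> * \<bar>\<Sum>j<n. G i j * x j\<bar> \<le> 1 * \<bar>\<Sum>j<n. G i j * x j\<bar>"
      using assms(1)[OF that] by (intro mult_right_mono) auto
    ultimately show ?thesis by (simp add: abs_mult)
  qed
  then show ?thesis
    unfolding sum_distrib_right by (intro order_trans[OF sum_abs] sum_mono) auto
qed

lemma abs_selected_multiplier_le_1: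
  assumes "d \<in> selections m f" "l \<in> nonneg_unit_sphere m" "i < m"
  shows "\<bar>l i * d i\<bar> \<le> 1"
  using selectionsD(4)[OF assms(1,3)] nonneg_unit_sphereD(3)[OF assms(2,3)]
  by (simp add: abs_mult mult_le_one)

lemma perceptron_form_lipschitz_matrix:
  assumes "x \<in> unit_sphere n" "d \<in> selections m f" "l \<in> nonneg_unit_sphere m"
  shows "\<bar>perceptron_form m n \<kappa> G x d l - perceptron_form m n \<kappa> G' x d l\<bar>
    \<le> (\<Sum>i<m. \<Sum>j<n. \<bar>G i j - G' i j\<bar>)"
proof -
  have "perceptron_form m n \<kappa> G' x d l - perceptron_form m n \<kappa> G x d l =
      (\<Sum>i<m. l i * d i * (\<Sum>j<n. (G i j - G' i j) * x j))"
    by (simp add: perceptron_form_def left_diff_distrib sum_subtractf right_diff_distrib)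
  then show ?thesis
    using abs_bilinear_sum_le[of m "\<lambda>i. l i * d i" n x 1 "\<lambda>i j. G i j - G' i j"]
      abs_selected_multiplier_le_1[OF assms(2,3)] unit_sphere_abs_le_1[OF assms(1)]
    by (simp add: abs_minus_commute)
qed

lemma perceptron_form_lipschitz_vector:
  assumes "\<And>j. j < n \<Longrightarrow> \<bar>x j - x' j\<bar> \<le> e" "d \<in> selections m f" "l \<in> nonneg_unit_sphere m"
  shows "\<bar>perceptron_form m n \<kappa> G x d l - perceptron_form m n \<kappa> G x' d l\<bar>
    \<le> (\<Sum>i<m. \<Sum>j<n. \<bar>G i j\<bar>) * e"
proof -
  have "perceptron_form m n \<kappa> G x' d l - perceptron_form m n \<kappa> G x d l =
      (\<Sum>i<m. l i * d i * (\<Sum>j<n. G i j * (x j - x' j)))"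
    by (simp add: perceptron_form_def sum_subtractf right_diff_distrib)
  then show ?thesis
    using abs_bilinear_sum_le[of m "\<lambda>i. l i * d i" n "\<lambda>j. x j - x' j" e G]
      abs_selected_multiplier_le_1[OF assms(2,3)] assms(1)
    by (simp add: abs_minus_commute)
qed

lemma abs_perceptron_form_le:
  assumes "x \<in> unit_sphere n" "d \<in> selections m f" "l \<in> nonneg_unit_sphere m"
  shows "\<bar>perceptron_form m n \<kappa> G x d l\<bar> \<le> \<bar>\<kappa>\<bar> * real m + (\<Sum>i<m. \<Sum>j<n. \<bar>G i j\<bar>)"
proof -
  have "\<bar>\<Sum>i<m. l i * d i\<bar> \<le> (\<Sum>i<m. 1)"
    using abs_selected_multiplier_le_1[OF assms(2,3)] by (intro order_trans[OF sum_abs] sum_mono) auto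
  then have "\<bar>perceptron_form m n \<kappa> (\<lambda>_ _. 0) x d l\<bar> \<le> \<bar>\<kappa>\<bar> * real m"
    by (simp add: perceptron_form_def abs_mult mult_left_mono)
  then show ?thesis
    using perceptron_form_lipschitz_matrix[OF assms, of \<kappa> G "\<lambda>_ _. 0"] by simp
qed

lemma bdd_above_perceptron_form:
  assumes "x \<in> unit_sphere n" "d \<in> selections m f"
  shows "bdd_above (perceptron_form m n \<kappa> G x d ` nonneg_unit_sphere m)"
  using abs_perceptron_form_le[OF assms]
  by (intro bdd_aboveI2[where M = "\<bar>\<kappa>\<bar> * real m + (\<Sum>i<m. \<Sum>j<n. \<bar>G i j\<bar>)"]) (fastforce dest: abs_le_D1)

text \<open>The reals are only conditionally complete: the infimum needs a nonempty index set and
  the inner supremum an upper bound. Both conditions are settled here.\<close>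

lemma xi_wb_geI:
  assumes "0 < n" "0 < f" "f < 1" "(1 - f) * real m \<in> \<int>"
    and "\<And>x d. x \<in> unit_sphere n \<Longrightarrow> d \<in> selections m f \<Longrightarrow>
      \<exists>l\<in>nonneg_unit_sphere m. c \<le> perceptron_form m n \<kappa> G x d l"
  shows "c \<le> xi_wb m n \<kappa> f G"
  unfolding xi_wb_def
proof (rule cINF_greatest)
  show "unit_sphere n \<times> selections m f \<noteq> {}"
    using selections_nonempty[OF assms(2-4)] unit_vector_in_unit_sphere[OF assms(1)] by blast
  fix p assume "p \<in> unit_sphere n \<times> selections m f"
  then obtain x d where p: "p = (x, d)" "x \<in> unit_sphere n" "d \<in> selections m f" by blast
  obtain l where "l \<in> nonneg_unit_sphere m" "c \<le> perceptron_form m n \<kappa> G x d l"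
    using assms(5)[OF p(2,3)] by blast
  then show "c \<le> (case p of (x, d) \<Rightarrow> SUP l\<in>nonneg_unit_sphere m. perceptron_form m n \<kappa> G x d l)"
    using bdd_above_perceptron_form[OF p(2,3)] p(1) by (auto intro: cSUP_upper2)
qed

lemma xi_wb_nonneg:
  assumes "0 < n" "0 < m" "0 < f" "f < 1" "(1 - f) * real m \<in> \<int>"
  shows "0 \<le> xi_wb m n \<kappa> f G"
proof (rule xi_wb_geI[OF assms(1,3,4,5)])
  fix x d assume "x \<in> unit_sphere n" and d: "d \<in> selections m f"
  obtain i where i: "i < m" "d i = 0" using selection_zero_exists[OF assms(3,2) d] .
  have zero: "(if j = i then 1 else 0) * d j = 0" for j using i by auto
  have "perceptron_form m n \<kappa> G x d (\<lambda>j. if j = i then 1 else 0) = 0"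
    unfolding perceptron_form_def zero by simp
  then show "\<exists>l\<in>nonneg_unit_sphere m. 0 \<le> perceptron_form m n \<kappa> G x d l"
    using unit_vector_in_nonneg_unit_sphere[OF i(1)] by (metis order_refl)
qed

section \<open>Regularity of the minimax\<close>

text \<open>The form is Lipschitz in the matrix uniformly in \<open>x\<close>, \<open>d\<close> and
  \<lambda>, and an infimum of suprema inherits the bound. It yields both measurability and the
  dependence on the entries in the grid alone.\<close>

lemma xi_wb_lipschitz:
  assumes "0 < n" "0 < m" "0 < f" "f < 1" "(1 - f) * real m \<in> \<int>"
  shows "\<bar>xi_wb m n \<kappa> f G - xi_wb m n \<kappa> f G'\<bar> \<le> (\<Sum>i<m. \<Sum>j<n. \<bar>G i j - G' i j\<bar>)"
proof -
  have L: "nonneg_unit_sphere m \<noteq> {}" using unit_vector_in_nonneg_unit_sphere[OF assms(2)] by blast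
  let ?I = "unit_sphere n \<times> selections m f"
  let ?S = "\<lambda>G (x, d). SUP l\<in>nonneg_unit_sphere m. perceptron_form m n \<kappa> G x d l"
  have I: "?I \<noteq> {}"
    using selections_nonempty[OF assms(3-5)] unit_vector_in_unit_sphere[OF assms(1)] by blast
  have one: "xi_wb m n \<kappa> f G - (\<Sum>i<m. \<Sum>j<n. \<bar>G i j - G' i j\<bar>) \<le> xi_wb m n \<kappa> f G'" for G G'
  proof -
    have bdd: "bdd_below (?S G ` ?I)"
    proof (rule bdd_belowI2)
      fix p assume "p \<in> ?I"
      then obtain x d where p: "p = (x, d)" "x \<in> unit_sphere n" "d \<in> selections m f" by blast
      obtain l where l: "l \<in> nonneg_unit_sphere m" using L by blast
      have "- (\<bar>\<kappa>\<bar> * real m + (\<Sum>i<m. \<Sum>j<n. \<bar>G i j\<bar>)) \<le> perceptron_form m n \<kappa> G x d l"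
        using abs_perceptron_form_le[OF p(2,3) l, of \<kappa> G] by linarith
      also have "\<dots> \<le> ?S G p"
        using bdd_above_perceptron_form[OF p(2,3)] l p(1) by (auto intro: cSUP_upper)
      finally show "- (\<bar>\<kappa>\<bar> * real m + (\<Sum>i<m. \<Sum>j<n. \<bar>G i j\<bar>)) \<le> ?S G p" .
    qed
    show ?thesis
      unfolding xi_wb_def[of m n \<kappa> f G']
    proof (rule cINF_greatest[OF I])
      fix p assume pI: "p \<in> ?I"
      then obtain x d where p: "p = (x, d)" "x \<in> unit_sphere n" "d \<in> selections m f" by blast
      have "xi_wb m n \<kappa> f G \<le> ?S G p"
        unfolding xi_wb_def by (rule cINF_lower[OF bdd pI])
      also have "\<dots> \<le> ?S G' p + (\<Sum>i<m. \<Sum>j<n. \<bar>G i j - G' i j\<bar>)"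
        unfolding p(1) prod.case
      proof (rule cSUP_least[OF L])
        fix l assume l: "l \<in> nonneg_unit_sphere m"
        have "perceptron_form m n \<kappa> G x d l \<le>
            perceptron_form m n \<kappa> G' x d l + (\<Sum>i<m. \<Sum>j<n. \<bar>G i j - G' i j\<bar>)"
          using perceptron_form_lipschitz_matrix[OF p(2,3) l, of \<kappa> G G'] by linarith
        also have "perceptron_form m n \<kappa> G' x d l \<le> (SUP l\<in>nonneg_unit_sphere m. perceptron_form m n \<kappa> G' x d l)"
          using bdd_above_perceptron_form[OF p(2,3)] l by (rule cSUP_upper[rotated])
        finally show "perceptron_form m n \<kappa> G x d l \<le> (SUP l\<in>nonneg_unit_sphere m. perceptron_form m n \<kappa> G' x d l)
            + (\<Sum>i<m. \<Sum>j<n. \<bar>G i j - G' i j\<bar>)" by simp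
      qed
      finally show "xi_wb m n \<kappa> f G - (\<Sum>i<m. \<Sum>j<n. \<bar>G i j - G' i j\<bar>) \<le> ?S G' p" by linarith
    qed
  qed
  show ?thesis
    using one[of G G'] one[of G' G] by (simp add: abs_le_iff abs_minus_commute algebra_simps)
qed

text \<open>The optimisation runs over uncountable sets, so measurability is drawn from continuity
  in the product topology. Its Borel sets form the product sigma-algebra because the index type is
  countable.\<close>

lemma borel_measurable_xi_wb:
  assumes "0 < n" "0 < m" "0 < f" "f < 1" "(1 - f) * real m \<in> \<int>"
  shows "(\<lambda>G. xi_wb m n \<kappa> f (\<lambda>i j. G (i, j))) \<in> borel_measurable (Pi\<^sub>M UNIV (\<lambda>_ :: nat \<times> nat. borel))"
proof -
  have "isCont (\<lambda>G :: nat \<times> nat \<Rightarrow> real. xi_wb m n \<kappa> f (\<lambda>i j. G (i, j))) G0" for G0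
    unfolding isCont_def
  proof (rule Lim_null_comparison[THEN LIM_zero_cancel])
    show "\<forall>\<^sub>F G in at G0. norm (xi_wb m n \<kappa> f (\<lambda>i j. G (i, j)) - xi_wb m n \<kappa> f (\<lambda>i j. G0 (i, j)))
        \<le> (\<Sum>i<m. \<Sum>j<n. \<bar>G (i, j) - G0 (i, j)\<bar>)"
      using xi_wb_lipschitz[OF assms] by (intro always_eventually) simp
    have "isCont (\<lambda>G :: nat \<times> nat \<Rightarrow> real. \<Sum>i<m. \<Sum>j<n. \<bar>G (i, j) - G0 (i, j)\<bar>) G0"
      by (rule continuous_on_interior[of UNIV])
        (auto intro!: continuous_intros continuous_on_product_coordinates)
    then show "((\<lambda>G. \<Sum>i<m. \<Sum>j<n. \<bar>G (i, j) - G0 (i, j)\<bar>) \<longlongrightarrow> 0) (at G0)"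
      by (simp add: isCont_def)
  qed
  then have "continuous_on UNIV (\<lambda>G :: nat \<times> nat \<Rightarrow> real. xi_wb m n \<kappa> f (\<lambda>i j. G (i, j)))"
    by (intro continuous_at_imp_continuous_on) blast
  then have "(\<lambda>G. xi_wb m n \<kappa> f (\<lambda>i j. G (i, j))) \<in> borel_measurable (borel :: (nat \<times> nat \<Rightarrow> real) measure)"
    by (rule borel_measurable_continuous_onI)
  then show ?thesis
    using measurable_cong_sets[OF sets_PiM_equal_borel refl] by blast
qed

section \<open>Nets, selections and multipliers\<close>

text \<open>Rounding coordinates down to multiples of \<open>e\<close> leaves finitely many cells,
  and one representative of each occupied cell is a net. Taking representatives in \<open>T\<close>
  itself preserves the exact constraints of spheres and selections.\<close>

lemma finite_coordinatewise_net:
  fixes T :: "(nat \<Rightarrow> real) set"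
  assumes "\<And>x j. x \<in> T \<Longrightarrow> j < n \<Longrightarrow> \<bar>x j\<bar> \<le> 1" "0 < e"
  obtains N where "finite N" "N \<subseteq> T" "\<And>x. x \<in> T \<Longrightarrow> \<exists>y\<in>N. \<forall>j<n. \<bar>x j - y j\<bar> \<le> e"
proof
  define cell where "cell x = (\<lambda>j\<in>{..<n}. \<lfloor>x j / e\<rfloor>)" for x
  define N where "N = inv_into T cell ` cell ` T"
  define B where "B = \<lceil>1 / e\<rceil> + 1"
  have "cell x \<in> {..<n} \<rightarrow>\<^sub>E {- B..B}" if "x \<in> T" for x
  proof (intro PiE_I)
    fix j assume j: "j \<in> {..<n}"
    then have x: "\<bar>x j\<bar> \<le> 1" using assms(1)[OF that] by auto
    have "x j / e \<le> 1 / e" "- (1 / e) \<le> x j / e"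
      using x assms(2) by (auto simp: field_simps abs_le_iff)
    then show "cell x j \<in> {- B..B}"
      using j unfolding cell_def B_def by simp linarith
  qed (simp add: cell_def)
  then have "finite (cell ` T)"
    by (intro finite_subset[of "cell ` T" "{..<n} \<rightarrow>\<^sub>E {- B..B}"] finite_PiE) auto
  then show "finite N" by (simp add: N_def)
  show "N \<subseteq> T" by (auto simp: N_def inv_into_into)
  fix x assume x: "x \<in> T"
  define y where "y = inv_into T cell (cell x)"
  have y: "y \<in> N" "cell y = cell x"
    using x by (auto simp: N_def y_def f_inv_into_f)
  have "\<bar>x j - y j\<bar> \<le> e" if "j < n" for j
  proof -
    have "\<lfloor>y j / e\<rfloor> = \<lfloor>x j / e\<rfloor>" using fun_cong[OF y(2), of j] that by (simp add: cell_def)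
    then have "\<bar>x j / e - y j / e\<bar> \<le> 1" by linarith
    then have "\<bar>x j - y j\<bar> / e \<le> 1"
      using assms(2) by (simp add: diff_divide_distrib[symmetric])
    then show ?thesis using assms(2) by (simp add: pos_divide_le_eq)
  qed
  then show "\<exists>y\<in>N. \<forall>j<n. \<bar>x j - y j\<bar> \<le> e" using y(1) by blast
qed

text \<open>Dropping a row loses at most \<open>c\<close>, and exactly \<open>f * m\<close> rows are
  dropped. The lower bound does not depend on \<open>d\<close>, so a single event controls all
  selections.\<close>

lemma sum_selection_ge_capped:
  fixes a a' d :: "nat \<Rightarrow> real"
  assumes d: "d \<in> selections m f" and a': "\<And>i. i < m \<Longrightarrow> 0 \<le> a' i" "\<And>i. i < m \<Longrightarrow> a' i \<le> c" "\<And>i. i < m \<Longrightarrow> a' i \<le> a i"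
  shows "(\<Sum>i<m. a' i) - f * real m * c \<le> (\<Sum>i<m. d i * a i)"
proof -
  have "a' i - (1 - d i) * c \<le> d i * a i" if "i < m" for i
    using selectionsD(1)[OF d that] a'[OF that] by auto
  then have "(\<Sum>i<m. a' i - (1 - d i) * c) \<le> (\<Sum>i<m. d i * a i)" by (intro sum_mono) auto
  moreover have "(\<Sum>i<m. 1 - d i) = f * real m"
    using d by (simp add: sum_subtractf selections_def algebra_simps)
  ultimately show ?thesis
    by (simp add: sum_subtractf sum_distrib_right[symmetric])
qed

lemma maximizing_multiplier:
  assumes d: "d \<in> selections m f" and "0 < \<zeta>" "\<zeta>\<^sup>2 \<le> (\<Sum>i<m. d i * (max 0 (v i))\<^sup>2)"
  obtains l where "l \<in> nonneg_unit_sphere m" "\<zeta> \<le> (\<Sum>i<m. l i * d i * v i)"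
proof
  \<comment> \<open>\<open>s\<close> is the norm of the selected positive part, and dividing by it
    gives the equality case of Cauchy-Schwarz. \<open>0 < \<zeta>\<close> ensures that
    \<open>s\<close> is not zero.\<close>
  define s where "s = sqrt (\<Sum>i<m. d i * (max 0 (v i))\<^sup>2)"
  have "0 < (\<Sum>i<m. d i * (max 0 (v i))\<^sup>2)" using assms(2,3) by (meson less_le_trans zero_less_power)
  then have s: "0 < s" "s\<^sup>2 = (\<Sum>i<m. d i * (max 0 (v i))\<^sup>2)" by (auto simp: s_def)
  define l where "l i = d i * max 0 (v i) / s" for i
  have "(\<Sum>i<m. (l i)\<^sup>2) = (\<Sum>i<m. d i * (max 0 (v i))\<^sup>2 / s\<^sup>2)"
    using selectionsD(5)[OF d] by (intro sum.cong refl) (simp add: l_def power_divide power_mult_distrib)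
  also have "\<dots> = s\<^sup>2 / s\<^sup>2" unfolding s(2) by (rule sum_divide_distrib[symmetric])
  also have "\<dots> = 1" using s(1) by simp
  finally show "l \<in> nonneg_unit_sphere m"
    using selectionsD(2)[OF d] s(1) by (simp add: nonneg_unit_sphere_def unit_sphere_iff l_def)
  have "l i * d i * v i = d i * (max 0 (v i))\<^sup>2 / s" if "i < m" for i
  proof -
    have "l i * d i * v i = (d i)\<^sup>2 * (max 0 (v i) * v i) / s" by (simp add: l_def power2_eq_square)
    also have "max 0 (v i) * v i = (max 0 (v i))\<^sup>2" by (simp add: max_def power2_eq_square)
    finally show ?thesis using selectionsD(5)[OF d that] by simp
  qed
  then have "(\<Sum>i<m. l i * d i * v i) = (\<Sum>i<m. d i * (max 0 (v i))\<^sup>2) / s"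
    by (simp add: sum_divide_distrib)
  also have "\<dots> = s" unfolding s(2)[symmetric] using s(1) by (simp add: power2_eq_square)
  finally show "\<zeta> \<le> (\<Sum>i<m. l i * d i * v i)"
    using assms(2,3) by (simp add: s_def real_le_rsqrt)
qed

section \<open>Comparison for the perceptron\<close>

lemma sum_mult_le_L2_set:
  fixes a b :: "'i \<Rightarrow> real"
  shows "(\<Sum>i\<in>I. a i * b i) \<le> L2_set a I * L2_set b I" "\<bar>\<Sum>i\<in>I. a i * b i\<bar> \<le> L2_set a I * L2_set b I"
proof -
  have "\<bar>\<Sum>i\<in>I. a i * b i\<bar> \<le> (\<Sum>i\<in>I. \<bar>a i\<bar> * \<bar>b i\<bar>)"
    by (rule order_trans[OF sum_abs]) (simp add: abs_mult)
  also have "\<dots> \<le> L2_set a I * L2_set b I" by (rule L2_set_mult_ineq)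
  finally show "\<bar>\<Sum>i\<in>I. a i * b i\<bar> \<le> L2_set a I * L2_set b I" .
  then show "(\<Sum>i\<in>I. a i * b i) \<le> L2_set a I * L2_set b I" by linarith
qed

text \<open>One family of Gaussian variables carries both processes: the entries with positive indices are
  the matrix, the first column and the first row are the two vectors of the comparison process,
  and the corner is the scalar that equalises the variances.\<close>

abbreviation bordered_grid :: "nat \<Rightarrow> nat \<Rightarrow> (nat \<times> nat) set" where
  "bordered_grid m n \<equiv> {..<Suc m} \<times> {..<Suc n}"

fun bordered :: "real \<Rightarrow> (nat \<Rightarrow> real) \<Rightarrow> (nat \<Rightarrow> real) \<Rightarrow> (nat \<Rightarrow> nat \<Rightarrow> real) \<Rightarrow> nat \<times> nat \<Rightarrow> real" where
  "bordered c h g G (0, 0) = c"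
| "bordered c h g G (0, Suc j) = h j"
| "bordered c h g G (Suc i, 0) = g i"
| "bordered c h g G (Suc i, Suc j) = G i j"

lemma sum_bordered_grid:
  fixes a :: "nat \<times> nat \<Rightarrow> real"
  shows "(\<Sum>k\<in>bordered_grid m n. a k) = a (0, 0) + (\<Sum>j<n. a (0, Suc j)) + (\<Sum>i<m. a (Suc i, 0))
    + (\<Sum>i<m. \<Sum>j<n. a (Suc i, Suc j))"
proof -
  have "(\<Sum>k\<in>bordered_grid m n. a k) = (\<Sum>i<Suc m. \<Sum>j<Suc n. a (i, j))"
    by (simp only: sum.cartesian_product case_prod_eta split_def prod.collapse)
  also have "\<dots> = a (0, 0) + (\<Sum>j<n. a (0, Suc j)) + (\<Sum>i<m. a (Suc i, 0))
    + (\<Sum>i<m. \<Sum>j<n. a (Suc i, Suc j))"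
    by (simp only: sum.lessThan_Suc_shift sum.distrib add.assoc)
  finally show ?thesis .
qed

text \<open>A point \<open>p\<close> is \<open>((x, d), l)\<close>, its block is
  \<open>(x, d)\<close>, and \<open>u p\<close> is the selected multiplier. \<open>A\<close> and
  \<open>B\<close> occupy disjoint cells of the grid, hence are orthogonal. Their covariances differ
  by \<open>(R p * R q - <u p, u q>) * (1 - <y p, y q>)\<close>, which has the required sign by
  Cauchy-Schwarz. The level \<open>s\<close> is moved into the constant \<open>c p\<close>, so that
  the thresholds 0 and 1 become \<open>s\<close> and \<open>s + 1\<close>.\<close>

lemma gordon_perceptron:
  fixes Nx Nd Nl :: "(nat \<Rightarrow> real) set" and m n :: nat
  assumes fin: "finite Nx" "finite Nd" "finite Nl" and "Nl \<noteq> {}"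
    and Nx: "Nx \<subseteq> unit_sphere n"
  defines "r \<equiv> \<lambda>d l. L2_set (\<lambda>i. l i * d i) {..<m}"
  shows "measure (gaussian (bordered_grid m n)) {z \<in> space (gaussian (bordered_grid m n)).
      \<forall>x\<in>Nx. \<forall>d\<in>Nd. \<exists>l\<in>Nl. s + 1 \<le> \<kappa> * (\<Sum>i<m. l i * d i) + (\<Sum>i<m. l i * d i * z (Suc i, 0))
        + r d l * (\<Sum>j<n. x j * z (0, Suc j))}
    \<le> measure (gaussian (bordered_grid m n)) {z \<in> space (gaussian (bordered_grid m n)).
      \<forall>x\<in>Nx. \<forall>d\<in>Nd. \<exists>l\<in>Nl.
        s < perceptron_form m n \<kappa> (\<lambda>i j. z (Suc i, Suc j)) x d l + r d l * z (0, 0)}"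
    (is "measure ?M ?S \<le> measure ?M ?T")
proof -
  let ?K = "bordered_grid m n"
  define P where "P = (Nx \<times> Nd) \<times> Nl"
  define u where "u p i = snd p i * snd (fst p) i" for p :: "((nat \<Rightarrow> real) \<times> (nat \<Rightarrow> real)) \<times> (nat \<Rightarrow> real)" and i :: nat
  define y where "y p = fst (fst p)" for p :: "((nat \<Rightarrow> real) \<times> (nat \<Rightarrow> real)) \<times> (nat \<Rightarrow> real)"
  define R where "R p = L2_set (u p) {..<m}" for p
  define A where "A p = bordered (R p) (\<lambda>_. 0) (\<lambda>_. 0) (\<lambda>i j. - (u p i * y p j))" for p
  define B where "B p = bordered 0 (\<lambda>j. R p * y p j) (u p) (\<lambda>_ _. 0)" for p
  define c where "c p = \<kappa> * (\<Sum>i<m. u p i) - s" for p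
  have AA: "(\<Sum>k\<in>?K. A p k * A q k) = R p * R q + (\<Sum>i<m. u p i * u q i) * (\<Sum>j<n. y p j * y q j)" for p q
    unfolding sum_bordered_grid A_def by (simp add: sum_product mult_ac)
  have BB: "(\<Sum>k\<in>?K. B p k * B q k) = R p * R q * (\<Sum>j<n. y p j * y q j) + (\<Sum>i<m. u p i * u q i)" for p q
    unfolding sum_bordered_grid B_def by (simp add: sum_distrib_left mult_ac)
  have AB: "(\<Sum>k\<in>?K. A p k * B q k) = 0" for p q
    unfolding sum_bordered_grid A_def B_def by simp
  have quantifiers: "(\<forall>i\<in>fst ` P. \<exists>p\<in>P. fst p = i \<and> Q p) \<longleftrightarrow> (\<forall>x\<in>Nx. \<forall>d\<in>Nd. \<exists>l\<in>Nl. Q ((x, d), l))" for Q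
  proof -
    have "(\<exists>p\<in>P. fst p = (x, d) \<and> Q p) \<longleftrightarrow> (\<exists>l\<in>Nl. Q ((x, d), l))" if "x \<in> Nx" "d \<in> Nd" for x d
      using that by (force simp: P_def)
    moreover have "fst ` P = Nx \<times> Nd" using \<open>Nl \<noteq> {}\<close> by (force simp: P_def image_iff)
    ultimately show ?thesis by simp
  qed
  have "measure ?M {z \<in> space ?M. \<forall>i\<in>fst ` P. \<exists>p\<in>P. fst p = i \<and> 1 \<le> c p + (\<Sum>k\<in>?K. B p k * z k)}
      \<le> measure ?M {z \<in> space ?M. \<forall>i\<in>fst ` P. \<exists>p\<in>P. fst p = i \<and> 0 < c p + (\<Sum>k\<in>?K. A p k * z k)}"
  proof (rule gordon_comparison)
    show "finite ?K" by simp
    show "finite P" using fin by (simp add: P_def)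
  next
    fix p q assume pq: "p \<in> P" "q \<in> P" "fst p = fst q"
    then have "y p = y q" "y p \<in> unit_sphere n" using Nx by (auto simp: y_def P_def)
    then have "(\<Sum>j<n. y p j * y q j) = 1" by (simp add: unit_sphere_iff power2_eq_square)
    then show "(\<Sum>k\<in>?K. A p k * A q k) = (\<Sum>k\<in>?K. B p k * B q k)"
      unfolding AA BB by simp
  next
    fix p q assume pq: "p \<in> P" "q \<in> P"
    then have "y p \<in> unit_sphere n" "y q \<in> unit_sphere n" using Nx by (auto simp: y_def P_def)
    then have "(\<Sum>j<n. y p j * y q j) \<le> 1"
      using sum_mult_le_L2_set(1)[of "y p" "y q" "{..<n}"] by (simp add: unit_sphere_def)
    moreover have "(\<Sum>i<m. u p i * u q i) \<le> R p * R q"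
      unfolding R_def by (rule sum_mult_le_L2_set)
    ultimately have "0 \<le> (R p * R q - (\<Sum>i<m. u p i * u q i)) * (1 - (\<Sum>j<n. y p j * y q j))"
      by (intro mult_nonneg_nonneg) auto
    then show "(\<Sum>k\<in>?K. B p k * B q k) \<le> (\<Sum>k\<in>?K. A p k * A q k)"
      unfolding AA BB by (simp add: algebra_simps)
  qed (rule AB)
  moreover have "{z \<in> space ?M. \<forall>i\<in>fst ` P. \<exists>p\<in>P. fst p = i \<and> 1 \<le> c p + (\<Sum>k\<in>?K. B p k * z k)} = ?S"
  proof -
    have "c ((x, d), l) + (\<Sum>k\<in>?K. B ((x, d), l) k * z k) = \<kappa> * (\<Sum>i<m. l i * d i)
        + (\<Sum>i<m. l i * d i * z (Suc i, 0)) + r d l * (\<Sum>j<n. x j * z (0, Suc j)) - s" for x d l z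
      unfolding sum_bordered_grid B_def c_def R_def u_def y_def r_def
      by (simp add: sum_distrib_left mult_ac)
    then have *: "1 \<le> c ((x, d), l) + (\<Sum>k\<in>?K. B ((x, d), l) k * z k) \<longleftrightarrow> s + 1 \<le> \<kappa> * (\<Sum>i<m. l i * d i)
        + (\<Sum>i<m. l i * d i * z (Suc i, 0)) + r d l * (\<Sum>j<n. x j * z (0, Suc j))" for x d l z
      by auto
    show ?thesis unfolding quantifiers * ..
  qed
  moreover have "{z \<in> space ?M. \<forall>i\<in>fst ` P. \<exists>p\<in>P. fst p = i \<and> 0 < c p + (\<Sum>k\<in>?K. A p k * z k)} = ?T"
  proof -
    have "c ((x, d), l) + (\<Sum>k\<in>?K. A ((x, d), l) k * z k) =
        perceptron_form m n \<kappa> (\<lambda>i j. z (Suc i, Suc j)) x d l + r d l * z (0, 0) - s" for x d l z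
      unfolding sum_bordered_grid A_def c_def R_def u_def y_def r_def perceptron_form_def
      by (simp add: sum_distrib_left mult_ac sum_negf)
    then have *: "0 < c ((x, d), l) + (\<Sum>k\<in>?K. A ((x, d), l) k * z k) \<longleftrightarrow>
        s < perceptron_form m n \<kappa> (\<lambda>i j. z (Suc i, Suc j)) x d l + r d l * z (0, 0)" for x d l z
      by auto
    show ?thesis unfolding quantifiers * ..
  qed
  ultimately show ?thesis by simp
qed

section \<open>From the random matrix to the product measure\<close>

lemma xi_wb_cong:
  assumes "0 < n" "0 < m" "0 < f" "f < 1" "(1 - f) * real m \<in> \<int>"
    and "\<And>i j. i < m \<Longrightarrow> j < n \<Longrightarrow> G i j = G' i j"
  shows "xi_wb m n \<kappa> f G = xi_wb m n \<kappa> f G'"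
  using xi_wb_lipschitz[OF assms(1-5), of \<kappa> G G'] assms(6) by simp

lemma sets_xi_wb_ge:
  assumes "0 < n" "0 < m" "0 < f" "f < 1" "(1 - f) * real m \<in> \<int>"
  shows "{w \<in> space (gaussian ({..<m} \<times> {..<n})). c \<le> xi_wb m n \<kappa> f (\<lambda>i j. w (i, j))}
    \<in> sets (gaussian ({..<m} \<times> {..<n}))"
proof -
  let ?I = "{..<m} \<times> {..<n}"
  \<comment> \<open>Points of the product over the grid are unspecified off it, so they are extended
    by zero to reach the measurability result on \<open>UNIV\<close>; by \<open>xi_wb_cong\<close>
    the extension leaves \<open>xi_wb\<close> unchanged.\<close>
  have ext: "(\<lambda>w p. if p \<in> ?I then w p else 0) \<in> measurable (gaussian ?I) (Pi\<^sub>M UNIV (\<lambda>_. borel))"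
  proof (rule measurable_PiM_single')
    fix p :: "nat \<times> nat"
    show "(\<lambda>w. if p \<in> ?I then w p else 0) \<in> borel_measurable (gaussian ?I)"
      using measurable_gaussian_component[of p ?I] by (cases "p \<in> ?I") simp_all
  qed simp
  have "(\<lambda>w. xi_wb m n \<kappa> f (\<lambda>i j. if (i, j) \<in> ?I then w (i, j) else 0)) \<in> borel_measurable (gaussian ?I)"
    using measurable_compose[OF ext borel_measurable_xi_wb[OF assms]] .
  moreover have "xi_wb m n \<kappa> f (\<lambda>i j. if (i, j) \<in> ?I then w (i, j) else 0) = xi_wb m n \<kappa> f (\<lambda>i j. w (i, j))" for w
    by (rule xi_wb_cong[OF assms]) simp
  ultimately have "(\<lambda>w. xi_wb m n \<kappa> f (\<lambda>i j. w (i, j))) \<in> borel_measurable (gaussian ?I)" by simp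
  then show ?thesis by (intro borel_measurable_le borel_measurable_const)
qed

text \<open>The interior of the bordered grid, with both indices shifted by one, has the law of the
  plain matrix; the border is integrated out.\<close>

lemma measure_xi_wb_bordered:
  assumes "0 < n" "0 < m" "0 < f" "f < 1" "(1 - f) * real m \<in> \<int>"
  shows "{z \<in> space (gaussian (bordered_grid m n)). c \<le> xi_wb m n \<kappa> f (\<lambda>i j. z (Suc i, Suc j))}
      \<in> sets (gaussian (bordered_grid m n))" (is ?sets)
    and "measure (gaussian (bordered_grid m n))
      {z \<in> space (gaussian (bordered_grid m n)). c \<le> xi_wb m n \<kappa> f (\<lambda>i j. z (Suc i, Suc j))}
    = measure (gaussian ({..<m} \<times> {..<n}))
      {w \<in> space (gaussian ({..<m} \<times> {..<n})). c \<le> xi_wb m n \<kappa> f (\<lambda>i j. w (i, j))}" (is ?eq)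
proof -
  let ?I = "{..<m} \<times> {..<n}" and ?K = "bordered_grid m n"
  let ?T = "\<lambda>z. \<lambda>p\<in>?I. z (map_prod Suc Suc p)" 
  let ?E = "{w \<in> space (gaussian ?I). c \<le> xi_wb m n \<kappa> f (\<lambda>i j. w (i, j))}"
  have maps: "map_prod Suc Suc \<in> ?I \<rightarrow> ?K" by auto
  have T: "?T \<in> measurable (gaussian ?K) (gaussian ?I)"
    using maps by (intro measurable_restrict measurable_component_singleton) auto
  have d: "distr (gaussian ?K) (gaussian ?I) ?T = gaussian ?I"
    by (rule distr_PiM_reindex[OF prob_space_std_normal _ maps]) (auto simp: inj_on_def)
  have "xi_wb m n \<kappa> f (\<lambda>i j. ?T z (i, j)) = xi_wb m n \<kappa> f (\<lambda>i j. z (Suc i, Suc j))" for z :: "nat \<times> nat \<Rightarrow> real"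
    by (rule xi_wb_cong[OF assms]) simp
  then have eq: "?T -` ?E \<inter> space (gaussian ?K) =
      {z \<in> space (gaussian ?K). c \<le> xi_wb m n \<kappa> f (\<lambda>i j. z (Suc i, Suc j))}"
    using measurable_space[OF T] by auto
  show ?sets using measurable_sets[OF T sets_xi_wb_ge[OF assms, where c = c and \<kappa> = \<kappa>]] unfolding eq .
  show ?eq using measure_distr[OF T sets_xi_wb_ge[OF assms, where c = c and \<kappa> = \<kappa>]] unfolding d eq by simp
qed

text \<open>Independence together with the normal marginals says that the joint law of the entries
  is a product measure, so the probability can be computed on \<open>gaussian\<close>.\<close>

lemma measure_xi_wb_iid:
  fixes H :: "nat \<Rightarrow> nat \<Rightarrow> 'a \<Rightarrow> real"
  assumes "prob_space M" and iid: "iid_std_normal_matrix M m n H"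
    and p: "0 < n" "0 < m" "0 < f" "f < 1" "(1 - f) * real m \<in> \<int>"
  shows "measure M {\<omega> \<in> space M. c \<le> xi_wb m n \<kappa> f (\<lambda>i j. H i j \<omega>)}
    = measure (gaussian ({..<m} \<times> {..<n}))
      {w \<in> space (gaussian ({..<m} \<times> {..<n})). c \<le> xi_wb m n \<kappa> f (\<lambda>i j. w (i, j))}"
proof -
  interpret prob_space M by fact
  let ?I = "{..<m} \<times> {..<n}"
  let ?X = "\<lambda>(i, j). H i j"
  let ?T = "\<lambda>\<omega>. \<lambda>p\<in>?I. ?X p \<omega>" 
  let ?E = "{w \<in> space (gaussian ?I). c \<le> xi_wb m n \<kappa> f (\<lambda>i j. w (i, j))}"
  have D: "distributed M lborel (H i j) std_normal_density" if "i < m" "j < n" for i j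
    using iid that by (auto simp: iid_std_normal_matrix_def)
  have rv: "?X p \<in> borel_measurable M" if "p \<in> ?I" for p
    using that distributed_measurable[OF D] by auto
  have dX: "distr M borel (?X p) = std_normal_distribution" if "p \<in> ?I" for p
  proof -
    have "distr M borel (?X p) = distr M lborel (?X p)" by (rule distr_cong) simp_all
    also have "\<dots> = std_normal_distribution"
      using that distributed_distr_eq_density[OF D] by auto
    finally show ?thesis .
  qed
  have sets_eq: "sets (gaussian ?I) = sets (Pi\<^sub>M ?I (\<lambda>_. borel))"
    by (rule sets_PiM_cong) simp_all
  have "indep_vars (\<lambda>_. borel) ?X ?I"
    using iid by (simp add: iid_std_normal_matrix_def)
  then have "distr M (Pi\<^sub>M ?I (\<lambda>_. borel)) ?T = Pi\<^sub>M ?I (\<lambda>p. distr M borel (?X p))"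
    using p(1,2) by (subst (asm) indep_vars_iff_distr_eq_PiM'[OF _ rv]) auto
  also have "\<dots> = gaussian ?I" by (rule PiM_cong) (simp_all only: dX)
  finally have d: "distr M (Pi\<^sub>M ?I (\<lambda>_. borel)) ?T = gaussian ?I" .
  have T: "?T \<in> measurable M (Pi\<^sub>M ?I (\<lambda>_. borel))"
    using rv by (intro measurable_restrict)
  have E: "?E \<in> sets (Pi\<^sub>M ?I (\<lambda>_. borel))" using sets_xi_wb_ge[OF p] sets_eq by simp
  have "xi_wb m n \<kappa> f (\<lambda>i j. ?T \<omega> (i, j)) = xi_wb m n \<kappa> f (\<lambda>i j. H i j \<omega>)" for \<omega>
    by (rule xi_wb_cong[OF p]) simp
  moreover have "?T \<omega> \<in> space (gaussian ?I)" for \<omega> by (simp add: space_PiM)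
  ultimately have eq: "?T -` ?E \<inter> space M = {\<omega> \<in> space M. c \<le> xi_wb m n \<kappa> f (\<lambda>i j. H i j \<omega>)}"
    by auto
  show ?thesis using measure_distr[OF T E] unfolding d eq by simp
qed

section \<open>Bounds outside the exceptional events\<close>

lemma L2_set_selected_le_1:
  assumes "d \<in> selections m f" "l \<in> nonneg_unit_sphere m"
  shows "L2_set (\<lambda>i. l i * d i) {..<m} \<le> 1"
proof -
  have "L2_set (\<lambda>i. l i * d i) {..<m} \<le> L2_set l {..<m}"
    using selectionsD(2,3)[OF assms(1)] nonneg_unit_sphereD(2)[OF assms(2)]
    by (intro L2_set_mono) (auto intro: mult_left_le)
  then show ?thesis using nonneg_unit_sphereD(1)[OF assms(2)] by (simp add: unit_sphere_def)
qed

text \<open>The capped sum keeps the norm of the selected positive part above \<zeta> for every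
  \<open>d\<close>. Rounding the maximiser to the net costs at most 1 by the size of
  \<open>e\<close>. The term with \<open>h\<close> is at least \<open>- \<rho>\<close>, as the
  selected multiplier has norm at most 1 and \<open>x\<close> has norm 1.\<close>

lemma comparison_process_ge:
  assumes x: "x \<in> unit_sphere n" and d: "d \<in> selections m f" and "0 \<le> \<rho>" "0 < \<zeta>" "0 \<le> e"
    and h: "(\<Sum>j<n. (h j)\<^sup>2) \<le> \<rho>\<^sup>2"
    and g: "\<zeta>\<^sup>2 \<le> (\<Sum>i<m. capped_loss f \<kappa> (g i)) - f * real m * nu_wb f \<kappa>"
    and N: "N \<subseteq> nonneg_unit_sphere m" "\<And>l. l \<in> nonneg_unit_sphere m \<Longrightarrow> \<exists>l'\<in>N. \<forall>i<m. \<bar>l i - l' i\<bar> \<le> e"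
    and e: "e * ((\<Sum>i<m. \<bar>g i\<bar>) + real m * \<bar>\<kappa>\<bar>) \<le> 1"
  shows "\<exists>l\<in>N. \<zeta> - \<rho> - 1 \<le> \<kappa> * (\<Sum>i<m. l i * d i) + (\<Sum>i<m. l i * d i * g i)
    + L2_set (\<lambda>i. l i * d i) {..<m} * (\<Sum>j<n. x j * h j)"
proof -
  have "\<zeta>\<^sup>2 \<le> (\<Sum>i<m. d i * (max 0 (\<kappa> + g i))\<^sup>2)"
    using g sum_selection_ge_capped[OF d, of "\<lambda>i. capped_loss f \<kappa> (g i)" "nu_wb f \<kappa>" "\<lambda>i. (max 0 (\<kappa> + g i))\<^sup>2"]
      capped_loss_bounds by fastforce
  then obtain l' where l': "l' \<in> nonneg_unit_sphere m" "\<zeta> \<le> (\<Sum>i<m. l' i * d i * (\<kappa> + g i))"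
    using maximizing_multiplier[OF d \<open>0 < \<zeta>\<close>] by metis
  obtain l where l: "l \<in> N" "\<And>i. i < m \<Longrightarrow> \<bar>l' i - l i\<bar> \<le> e" using N(2)[OF l'(1)] by blast
  have "(\<Sum>i<m. l' i * d i * (\<kappa> + g i)) - (\<Sum>i<m. l i * d i * (\<kappa> + g i)) = (\<Sum>i<m. (l' i - l i) * d i * (\<kappa> + g i))"
    by (simp add: sum_subtractf left_diff_distrib)
  also have "\<dots> \<le> (\<Sum>i<m. e * (\<bar>g i\<bar> + \<bar>\<kappa>\<bar>))"
  proof (intro sum_mono)
    fix i assume i: "i \<in> {..<m}"
    have "\<bar>(l' i - l i) * d i\<bar> \<le> e * 1"
      unfolding abs_mult using l(2) selectionsD(4)[OF d] i \<open>0 \<le> e\<close> by (intro mult_mono) auto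
    then have "\<bar>(l' i - l i) * d i * (\<kappa> + g i)\<bar> \<le> e * (\<bar>g i\<bar> + \<bar>\<kappa>\<bar>)"
      unfolding abs_mult[of _ "\<kappa> + g i"] using \<open>0 \<le> e\<close> by (intro mult_mono) auto
    then show "(l' i - l i) * d i * (\<kappa> + g i) \<le> e * (\<bar>g i\<bar> + \<bar>\<kappa>\<bar>)" by linarith
  qed
  also have "\<dots> \<le> 1" using e by (simp add: sum_distrib_left[symmetric] sum.distrib)
  finally have 1: "\<zeta> - 1 \<le> (\<Sum>i<m. l i * d i * (\<kappa> + g i))" using l'(2) by linarith
  have "(\<Sum>i<m. l i * d i * (\<kappa> + g i)) = \<kappa> * (\<Sum>i<m. l i * d i) + (\<Sum>i<m. l i * d i * g i)"
    by (simp add: sum_distrib_left sum.distrib distrib_left mult_ac)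
  moreover have "- \<rho> \<le> L2_set (\<lambda>i. l i * d i) {..<m} * (\<Sum>j<n. x j * h j)"
  proof -
    have "L2_set h {..<n} \<le> \<rho>"
      unfolding L2_set_def using h \<open>0 \<le> \<rho>\<close> by (intro real_le_lsqrt) (auto intro: sum_nonneg)
    then have "\<bar>\<Sum>j<n. x j * h j\<bar> \<le> \<rho>"
      using sum_mult_le_L2_set(2)[of x h "{..<n}"] x by (simp add: unit_sphere_def)
    then have "\<bar>L2_set (\<lambda>i. l i * d i) {..<m} * (\<Sum>j<n. x j * h j)\<bar> \<le> 1 * \<rho>"
      unfolding abs_mult using L2_set_selected_le_1[OF d, of l] l(1) N(1) by (intro mult_mono) auto
    then show ?thesis by linarith
  qed
  ultimately show ?thesis using 1 l(1) by (intro bexI[of _ l]) linarith+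
qed

text \<open>Rounding \<open>x\<close> costs at most 1. Rounding \<open>d\<close> is exact, since 0-1
  vectors within 1/2 of each other agree on the index range; a finite net of selections is taken
  because functions differing outside that range are distinct. Multipliers from \<open>Nl\<close>
  are already admissible.\<close>

lemma xi_wb_ge_of_nets:
  assumes p: "0 < n" "0 < f" "f < 1" "(1 - f) * real m \<in> \<int>" and "0 \<le> e"
    and Nx: "\<And>x. x \<in> unit_sphere n \<Longrightarrow> \<exists>x'\<in>Nx. \<forall>j<n. \<bar>x j - x' j\<bar> \<le> e"
    and Nd: "Nd \<subseteq> selections m f" "\<And>d. d \<in> selections m f \<Longrightarrow> \<exists>d'\<in>Nd. \<forall>i<m. \<bar>d i - d' i\<bar> \<le> 1 / 2"
    and Nl: "Nl \<subseteq> nonneg_unit_sphere m"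
    and e: "(\<Sum>i<m. \<Sum>j<n. \<bar>G i j\<bar>) * e \<le> 1" and \<theta>: "\<bar>\<gamma>\<bar> \<le> \<theta>"
    and S: "\<forall>x\<in>Nx. \<forall>d\<in>Nd. \<exists>l\<in>Nl. s < perceptron_form m n \<kappa> G x d l + L2_set (\<lambda>i. l i * d i) {..<m} * \<gamma>"
  shows "s - \<theta> - 1 \<le> xi_wb m n \<kappa> f G"
proof (rule xi_wb_geI[OF p])
  fix x d assume x: "x \<in> unit_sphere n" and d: "d \<in> selections m f"
  obtain x' where x': "x' \<in> Nx" "\<And>j. j < n \<Longrightarrow> \<bar>x j - x' j\<bar> \<le> e" using Nx[OF x] by blast
  obtain d' where d': "d' \<in> Nd" "\<And>i. i < m \<Longrightarrow> \<bar>d i - d' i\<bar> \<le> 1 / 2" using Nd(2)[OF d] by blast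
  have dd: "d' i = d i" if "i < m" for i
    using d'(2)[OF that] selectionsD(1)[OF d that] selectionsD(1)[OF subsetD[OF Nd(1) d'(1)] that] by auto
  obtain l where l: "l \<in> Nl" "s < perceptron_form m n \<kappa> G x' d' l + L2_set (\<lambda>i. l i * d' i) {..<m} * \<gamma>"
    using S x'(1) d'(1) by blast
  have lN: "l \<in> nonneg_unit_sphere m" using l(1) Nl by blast
  have "perceptron_form m n \<kappa> G x' d' l = perceptron_form m n \<kappa> G x' d l"
    using dd by (simp add: perceptron_form_def)
  moreover have "\<bar>L2_set (\<lambda>i. l i * d' i) {..<m} * \<gamma>\<bar> \<le> 1 * \<theta>"
    unfolding abs_mult using L2_set_selected_le_1[OF subsetD[OF Nd(1) d'(1)] lN] \<theta>
    by (intro mult_mono) auto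
  moreover have "\<bar>perceptron_form m n \<kappa> G x d l - perceptron_form m n \<kappa> G x' d l\<bar> \<le> 1"
    by (rule order_trans[OF perceptron_form_lipschitz_vector[OF _ d lN] e]) (rule x'(2))
  ultimately have "s - \<theta> - 1 \<le> perceptron_form m n \<kappa> G x d l" using l(2) by linarith
  then show "\<exists>l\<in>nonneg_unit_sphere m. s - \<theta> - 1 \<le> perceptron_form m n \<kappa> G x d l"
    using lN by blast
qed

text \<open>The loss of 3 consists of one unit for the net of multipliers, one for the gap in
  Gordon's inequality and one for the net of \<open>x\<close>. Large entries are paid for twice:
  they are excluded for the comparison process and again for the matrix process.\<close>

lemma xi_wb_tail:
  assumes p: "0 < n" "0 < m" "0 < f" "f < 1" "(1 - f) * real m \<in> \<int>"
    and pos: "0 < \<zeta>" "0 \<le> \<rho>" "0 < R"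
  defines "M \<equiv> gaussian (bordered_grid m n)"
  shows "1 - measure M {z \<in> space M. \<rho>\<^sup>2 < (\<Sum>j<n. (z (0, Suc j))\<^sup>2)}
      - measure M {z \<in> space M. (\<Sum>i<m. capped_loss f \<kappa> (z (Suc i, 0))) - f * real m * nu_wb f \<kappa> < \<zeta>\<^sup>2}
      - 2 * measure M {z \<in> space M. R < (\<Sum>k\<in>bordered_grid m n. \<bar>z k\<bar>)}
      - measure M {z \<in> space M. \<theta> < \<bar>z (0, 0)\<bar>}
    \<le> measure M {z \<in> space M. \<zeta> - \<rho> - \<theta> - 3 \<le> xi_wb m n \<kappa> f (\<lambda>i j. z (Suc i, Suc j))}"
    (is "1 - measure M ?B1 - measure M ?B2 - 2 * measure M ?B3 - measure M ?B4 \<le> measure M ?E")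
proof -
  interpret prob_space M unfolding M_def by (rule prob_space_gaussian)
  let ?K = "bordered_grid m n"
  \<comment> \<open>The nets have to be fixed before the Gaussian sample, so the mesh is tuned to
    the deterministic level \<open>R\<close>. One choice serves the rounding of both
    \<open>x\<close> and the multipliers.\<close>
  define e where "e = 1 / (R + real m * \<bar>\<kappa>\<bar>)"
  have e: "0 < e" "e * (R + real m * \<bar>\<kappa>\<bar>) = 1"
    using add_pos_nonneg[OF pos(3), of "real m * \<bar>\<kappa>\<bar>"] by (auto simp: e_def)
  have eR: "e * R \<le> 1" using e mult_left_mono[of R "R + real m * \<bar>\<kappa>\<bar>" e] by simp
  obtain Nx where Nx: "finite Nx" "Nx \<subseteq> unit_sphere n"
      "\<And>x. x \<in> unit_sphere n \<Longrightarrow> \<exists>y\<in>Nx. \<forall>j<n. \<bar>x j - y j\<bar> \<le> e"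
    using finite_coordinatewise_net[of "unit_sphere n" n e] unit_sphere_abs_le_1 e(1) by metis
  obtain Nd where Nd: "finite Nd" "Nd \<subseteq> selections m f"
      "\<And>d. d \<in> selections m f \<Longrightarrow> \<exists>y\<in>Nd. \<forall>i<m. \<bar>d i - y i\<bar> \<le> 1 / 2"
    using finite_coordinatewise_net[of "selections m f" m "1 / 2"] selectionsD(4) by (metis half_gt_zero_iff zero_less_one)
  obtain Nl where Nl: "finite Nl" "Nl \<subseteq> nonneg_unit_sphere m"
      "\<And>l. l \<in> nonneg_unit_sphere m \<Longrightarrow> \<exists>y\<in>Nl. \<forall>i<m. \<bar>l i - y i\<bar> \<le> e"
    using finite_coordinatewise_net[of "nonneg_unit_sphere m" m e] nonneg_unit_sphereD(3) e(1) by metis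
  have "Nl \<noteq> {}" using Nl(3) unit_vector_in_nonneg_unit_sphere[OF p(2)] by blast
  \<comment> \<open>\<open>s + 1\<close> is the level that the comparison process still reaches
    after rounding the multiplier.\<close>
  define s where "s = \<zeta> - \<rho> - 2"
  let ?r = "\<lambda>d l. L2_set (\<lambda>i. l i * d i) {..<m}"
  let ?S = "{z \<in> space M. \<forall>x\<in>Nx. \<forall>d\<in>Nd. \<exists>l\<in>Nl. s + 1 \<le> \<kappa> * (\<Sum>i<m. l i * d i) + (\<Sum>i<m. l i * d i * z (Suc i, 0))
        + ?r d l * (\<Sum>j<n. x j * z (0, Suc j))}"
  let ?T = "{z \<in> space M. \<forall>x\<in>Nx. \<forall>d\<in>Nd. \<exists>l\<in>Nl.
        s < perceptron_form m n \<kappa> (\<lambda>i j. z (Suc i, Suc j)) x d l + ?r d l * z (0, 0)}"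
  have comp: "(\<lambda>z. z k) \<in> borel_measurable M" if "k \<in> ?K" for k
    unfolding M_def by (rule measurable_gaussian_component[OF that])
  have c00: "(0, 0) \<in> ?K" and c0: "\<And>j. j < n \<Longrightarrow> (0, Suc j) \<in> ?K" and ci: "\<And>i. i < m \<Longrightarrow> (Suc i, 0) \<in> ?K"
    and cij: "\<And>i j. i < m \<Longrightarrow> j < n \<Longrightarrow> (Suc i, Suc j) \<in> ?K" by auto
  note meas = borel_measurable_add borel_measurable_sum borel_measurable_times borel_measurable_diff
    borel_measurable_power borel_measurable_abs borel_measurable_const
    comp[OF c00] comp[OF c0] comp[OF ci] comp[OF cij]
  have sB1: "?B1 \<in> sets M" by (intro borel_measurable_less meas) auto
  have sB2: "?B2 \<in> sets M"
    by (intro borel_measurable_less meas measurable_compose[OF comp[OF ci] borel_measurable_capped_loss]) auto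
  have sB3: "?B3 \<in> sets M" by (intro borel_measurable_less meas comp)
  have sB4: "?B4 \<in> sets M" by (intro borel_measurable_less meas)
  have sS: "?S \<in> sets M"
    using Nx(1) Nd(1) Nl(1)
    by (intro sets.sets_Collect_finite_All sets.sets_Collect_finite_Ex borel_measurable_le meas) auto
  have sT: "?T \<in> sets M"
    unfolding perceptron_form_def using Nx(1) Nd(1) Nl(1)
    by (intro sets.sets_Collect_finite_All sets.sets_Collect_finite_Ex borel_measurable_less meas) auto
  have sE: "?E \<in> sets M"
    unfolding M_def by (rule measure_xi_wb_bordered(1)[OF p])
  have parts: "(\<Sum>i<m. \<bar>z (Suc i, 0)\<bar>) \<le> (\<Sum>k\<in>?K. \<bar>z k\<bar>)"
    "(\<Sum>i<m. \<Sum>j<n. \<bar>z (Suc i, Suc j)\<bar>) \<le> (\<Sum>k\<in>?K. \<bar>z k\<bar>)" for z :: "nat \<times> nat \<Rightarrow> real"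
    unfolding sum_bordered_grid[of "\<lambda>k. \<bar>z k\<bar>"] by (simp_all add: sum_nonneg add_nonneg_nonneg)
  have "space M \<subseteq> ?S \<union> (?B1 \<union> (?B2 \<union> ?B3))"
  proof
    fix z assume z: "z \<in> space M"
    show "z \<in> ?S \<union> (?B1 \<union> (?B2 \<union> ?B3))"
    proof (rule ccontr)
      assume "\<not> ?thesis"
      then have notS: "z \<notin> ?S" and b: "(\<Sum>j<n. (z (0, Suc j))\<^sup>2) \<le> \<rho>\<^sup>2"
        "\<zeta>\<^sup>2 \<le> (\<Sum>i<m. capped_loss f \<kappa> (z (Suc i, 0))) - f * real m * nu_wb f \<kappa>"
        "(\<Sum>k\<in>?K. \<bar>z k\<bar>) \<le> R"
        using z by (auto simp: not_less)
      have "e * ((\<Sum>i<m. \<bar>z (Suc i, 0)\<bar>) + real m * \<bar>\<kappa>\<bar>) \<le> e * (R + real m * \<bar>\<kappa>\<bar>)"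
        using parts(1)[of z] b(3) e(1) by (intro mult_left_mono) auto
      then have fine: "e * ((\<Sum>i<m. \<bar>z (Suc i, 0)\<bar>) + real m * \<bar>\<kappa>\<bar>) \<le> 1" using e(2) by simp
      have "\<exists>l\<in>Nl. \<zeta> - \<rho> - 1 \<le> \<kappa> * (\<Sum>i<m. l i * d i) + (\<Sum>i<m. l i * d i * z (Suc i, 0))
        + ?r d l * (\<Sum>j<n. x j * z (0, Suc j))" if "x \<in> Nx" "d \<in> Nd" for x d
        using that Nx(2) Nd(2) e(1)
        by (intro comparison_process_ge[OF _ _ pos(2,1) _ b(1,2) Nl(2,3) fine]) auto
      then have "z \<in> ?S" using z by (simp add: s_def)
      with notS show False ..
    qed
  qed
  then have "measure M (space M) \<le> measure M (?S \<union> (?B1 \<union> (?B2 \<union> ?B3)))"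
    using sS sB1 sB2 sB3 by (intro finite_measure_mono) auto
  also have "\<dots> \<le> measure M ?S + measure M (?B1 \<union> (?B2 \<union> ?B3))"
    using sS sB1 sB2 sB3 by (intro measure_Un_le sets.Un)
  also have "measure M (?B1 \<union> (?B2 \<union> ?B3)) \<le> measure M ?B1 + measure M (?B2 \<union> ?B3)"
    using sB1 sB2 sB3 by (intro measure_Un_le sets.Un)
  also have "measure M (?B2 \<union> ?B3) \<le> measure M ?B2 + measure M ?B3"
    using sB2 sB3 by (intro measure_Un_le)
  finally have 1: "1 \<le> measure M ?S + (measure M ?B1 + (measure M ?B2 + measure M ?B3))"
    by (simp add: prob_space)
  have 2: "measure M ?S \<le> measure M ?T"
    unfolding M_def by (rule gordon_perceptron[OF Nx(1) Nd(1) Nl(1) \<open>Nl \<noteq> {}\<close> Nx(2)])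
  have "?T \<subseteq> ?E \<union> (?B3 \<union> ?B4)"
  proof
    fix z assume z: "z \<in> ?T"
    show "z \<in> ?E \<union> (?B3 \<union> ?B4)"
    proof (rule ccontr)
      assume "\<not> ?thesis"
      then have notE: "z \<notin> ?E" and b: "(\<Sum>k\<in>?K. \<bar>z k\<bar>) \<le> R" "\<bar>z (0, 0)\<bar> \<le> \<theta>"
        using z by (auto simp: not_less)
      have "(\<Sum>i<m. \<Sum>j<n. \<bar>z (Suc i, Suc j)\<bar>) * e \<le> R * e"
        using parts(2)[of z] b(1) e(1) by (intro mult_right_mono) auto
      also have "\<dots> \<le> 1" using eR by (simp add: mult.commute)
      finally have fine: "(\<Sum>i<m. \<Sum>j<n. \<bar>z (Suc i, Suc j)\<bar>) * e \<le> 1" .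
      have "s - \<theta> - 1 \<le> xi_wb m n \<kappa> f (\<lambda>i j. z (Suc i, Suc j))"
        using z e(1) by (intro xi_wb_ge_of_nets[OF p(1,3-5) _ Nx(3) Nd(2,3) Nl(2) fine b(2)]) auto
      then have "z \<in> ?E" using z by (simp add: s_def algebra_simps)
      with notE show False ..
    qed
  qed
  then have "measure M ?T \<le> measure M (?E \<union> (?B3 \<union> ?B4))"
    using sE sB3 sB4 by (intro finite_measure_mono) auto
  also have "\<dots> \<le> measure M ?E + measure M (?B3 \<union> ?B4)"
    using sE sB3 sB4 by (intro measure_Un_le sets.Un)
  also have "measure M (?B3 \<union> ?B4) \<le> measure M ?B3 + measure M ?B4"
    using sB3 sB4 by (intro measure_Un_le)
  finally have "measure M ?T \<le> measure M ?E + (measure M ?B3 + measure M ?B4)" by simp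
  with 1 2 show ?thesis by linarith
qed

section \<open>The limit\<close>

lemma gaussian_weak_law_one_sided:
  fixes \<phi> :: "real \<Rightarrow> real" and \<iota> :: "nat \<Rightarrow> 'k"
  assumes K: "finite K" and \<iota>: "inj_on \<iota> {..<N}" "\<iota> ` {..<N} \<subseteq> K" and "0 < N" and m: "\<phi> \<in> borel_measurable borel"
    and sq: "integrable std_normal_distribution (\<lambda>x. (\<phi> x)\<^sup>2)" and "\<tau> > 0"
  defines "\<mu> \<equiv> \<integral>x. \<phi> x \<partial>std_normal_distribution"
  defines "V \<equiv> \<integral>x. (\<phi> x - \<mu>)\<^sup>2 \<partial>std_normal_distribution"
  shows "real N * (\<mu> + \<tau>) \<le> c \<Longrightarrow> measure (gaussian K) {z \<in> space (gaussian K). c < (\<Sum>i<N. \<phi> (z (\<iota> i)))} \<le> V / (real N * \<tau>\<^sup>2)"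
    and "c \<le> real N * (\<mu> - \<tau>) \<Longrightarrow> measure (gaussian K) {z \<in> space (gaussian K). (\<Sum>i<N. \<phi> (z (\<iota> i))) < c} \<le> V / (real N * \<tau>\<^sup>2)"
proof -
  interpret GK: prob_space "gaussian K" by (rule prob_space_gaussian)
  have sum: "(\<Sum>k\<in>\<iota> ` {..<N}. \<phi> (z k)) = (\<Sum>i<N. \<phi> (z (\<iota> i)))" for z :: "'k \<Rightarrow> real"
    using sum.reindex[OF \<iota>(1), of "\<lambda>k. \<phi> (z k)"] by (simp add: comp_def)
  have card: "card (\<iota> ` {..<N}) = N" using card_image[OF \<iota>(1)] by simp
  let ?B = "{z \<in> space (gaussian K). real N * \<tau> \<le> \<bar>(\<Sum>i<N. \<phi> (z (\<iota> i))) - real N * \<mu>\<bar>}"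
  have B: "measure (gaussian K) ?B \<le> V / (real N * \<tau>\<^sup>2)"
    using gaussian_weak_law[OF K \<iota>(2) _ m sq \<open>\<tau> > 0\<close>] \<open>0 < N\<close>
    unfolding sum card \<mu>_def[symmetric] V_def[symmetric] by auto
  have "(\<lambda>z. \<phi> (z (\<iota> i))) \<in> borel_measurable (gaussian K)" if "i < N" for i
    using \<iota>(2) that by (intro measurable_compose[OF measurable_gaussian_component m]) auto
  then have sB: "?B \<in> sets (gaussian K)"
    by (intro borel_measurable_le borel_measurable_abs borel_measurable_diff borel_measurable_sum borel_measurable_const) auto
  have sub: "measure (gaussian K) X \<le> V / (real N * \<tau>\<^sup>2)" if "X \<subseteq> ?B" for X
    using GK.finite_measure_mono[OF that sB] B by linarith
  show "real N * (\<mu> + \<tau>) \<le> c \<Longrightarrow> measure (gaussian K) {z \<in> space (gaussian K). c < (\<Sum>i<N. \<phi> (z (\<iota> i)))} \<le> V / (real N * \<tau>\<^sup>2)"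
    by (rule sub) (auto simp: distrib_left)
  show "c \<le> real N * (\<mu> - \<tau>) \<Longrightarrow> measure (gaussian K) {z \<in> space (gaussian K). (\<Sum>i<N. \<phi> (z (\<iota> i))) < c} \<le> V / (real N * \<tau>\<^sup>2)"
    by (rule sub) (auto simp: right_diff_distrib)
qed

lemma gaussian_component_tail:
  assumes "k \<in> K" "0 < \<theta>"
  shows "measure (gaussian K) {z \<in> space (gaussian K). \<theta> < \<bar>z k\<bar>} \<le> 1 / \<theta>\<^sup>2"
proof -
  interpret GK: prob_space "gaussian K" by (rule prob_space_gaussian)
  have c: "(\<lambda>z. z k) \<in> borel_measurable (gaussian K)" by (rule measurable_gaussian_component[OF assms(1)])
  have sq: "(\<lambda>x :: real. x\<^sup>2) \<in> borel_measurable borel" by simp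
  have int: "integrable (gaussian K) (\<lambda>z. (z k)\<^sup>2)"
    using integrable_gaussian_component_iff[OF assms(1) sq] integrable_std_normal_distribution_moment[of 2] by blast
  have E: "(\<integral>z. (z k)\<^sup>2 \<partial>gaussian K) = 1"
    using integral_gaussian_component[OF assms(1) sq] std_normal_distribution_even_moments(1)[of 1] by simp
  have "measure (gaussian K) {z \<in> space (gaussian K). \<theta> < \<bar>z k\<bar>} \<le>
      measure (gaussian K) {z \<in> space (gaussian K). \<theta> \<le> \<bar>z k\<bar>}"
    by (intro GK.finite_measure_mono borel_measurable_le borel_measurable_abs borel_measurable_const c) auto
  also have "\<dots> \<le> 1 / \<theta>\<^sup>2"
    using GK.second_moment_method[OF c int assms(2)] unfolding E .
  finally show ?thesis .
qed

lemma gaussian_l1_norm_tail: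
  assumes K: "finite K" and R: "0 < R"
  shows "measure (gaussian K) {z \<in> space (gaussian K). R < (\<Sum>k\<in>K. \<bar>z k\<bar>)}
    \<le> real (card K) * (\<integral>x. \<bar>x\<bar> \<partial>std_normal_distribution) / R"
proof -
  interpret GK: prob_space "gaussian K" by (rule prob_space_gaussian)
  have c: "(\<lambda>z. \<Sum>k\<in>K. \<bar>z k\<bar>) \<in> borel_measurable (gaussian K)"
    by (intro borel_measurable_sum borel_measurable_abs measurable_gaussian_component)
  have abs: "(abs :: real \<Rightarrow> real) \<in> borel_measurable borel" by simp
  have i: "integrable (gaussian K) (\<lambda>z. \<bar>z k\<bar>)" if "k \<in> K" for k
    by (intro integrable_abs integrable_gaussian_component that)
  have E: "(\<integral>z. (\<Sum>k\<in>K. \<bar>z k\<bar>) \<partial>gaussian K) = real (card K) * (\<integral>x. \<bar>x\<bar> \<partial>std_normal_distribution)"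
  proof -
    have "(\<integral>z. (\<Sum>k\<in>K. \<bar>z k\<bar>) \<partial>gaussian K) = (\<Sum>k\<in>K. \<integral>z. \<bar>z k\<bar> \<partial>gaussian K)"
      using i by (rule Bochner_Integration.integral_sum)
    also have "\<dots> = (\<Sum>k\<in>K. \<integral>x. \<bar>x\<bar> \<partial>std_normal_distribution)"
      by (intro sum.cong refl integral_gaussian_component[OF _ abs])
    finally show ?thesis by simp
  qed
  have "measure (gaussian K) {z \<in> space (gaussian K). R < (\<Sum>k\<in>K. \<bar>z k\<bar>)} \<le>
      measure (gaussian K) {z \<in> space (gaussian K). R \<le> (\<Sum>k\<in>K. \<bar>z k\<bar>)}"
    by (intro GK.finite_measure_mono borel_measurable_le borel_measurable_const c) auto
  also have "\<dots> \<le> (\<integral>z. (\<Sum>k\<in>K. \<bar>z k\<bar>) \<partial>gaussian K) / R"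
    by (rule integral_Markov_inequality_measure[where A = "{}"])
      (use i R in \<open>auto intro!: Bochner_Integration.integrable_sum AE_I2 sum_nonneg\<close>)
  finally show ?thesis unfolding E .
qed

lemma f_err_nonneg: "0 \<le> f_err f \<kappa>"
proof -
  have "- \<kappa> \<le> sqrt (nu_wb f \<kappa>) - \<kappa>" by (simp add: nu_wb_def)
  from interval_integral_Icc[OF this, of "\<lambda>t. (t + \<kappa>)\<^sup>2 * exp (- (t\<^sup>2 / 2))"] show ?thesis
    unfolding f_err_def by (auto simp: set_lebesgue_integral_def intro!: mult_nonneg_nonneg Bochner_Integration.integral_nonneg)
qed

text \<open>\<open>C\<close> is independent of the dimensions: \<open>m\<close> is proportional to
  \<open>n\<close>, and each exceptional event of \<open>xi_wb_tail\<close> has probability at most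
  a constant over \<open>n\<close>.\<close>

lemma xi_wb_probability_bound:
  fixes \<alpha> \<kappa> f \<epsilon> \<epsilon>' \<delta> :: real
  assumes \<alpha>: "0 < \<alpha>" and f: "0 < f" "f < 1" and root: "sqrt 2 * erfinv (1 - 2 * f) + \<kappa> \<ge> 0"
    and err: "0 < f_err f \<kappa>" and \<epsilon>: "0 < \<epsilon>" "\<epsilon> < 1" "0 < \<epsilon>'" "0 < \<delta>"
  obtains C where "\<And>m n. 0 < n \<Longrightarrow> real m = \<alpha> * real n \<Longrightarrow> (1 - f) * real m \<in> \<int> \<Longrightarrow>
    1 - C / real n \<le> measure (gaussian (bordered_grid m n)) {z \<in> space (gaussian (bordered_grid m n)).
      (1 - \<epsilon>) * sqrt (\<alpha> * f_err f \<kappa>) * sqrt (real n) - (1 + \<epsilon>') * sqrt (real n) - \<delta> * sqrt (real n) - 3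
        \<le> xi_wb m n \<kappa> f (\<lambda>i j. z (Suc i, Suc j))}"
proof
  interpret N: prob_space std_normal_distribution by (rule prob_space_std_normal)
  define \<mu> where "\<mu> = f_err f \<kappa> + nu_wb f \<kappa> * f"
  \<comment> \<open>The slack for which \<open>f_err f \<kappa> - \<tau>\<close> is
    \<open>(1 - \<epsilon>)^2 * f_err f \<kappa>\<close>, so that \<open>\<zeta>^2\<close> is
    exactly \<open>m\<close> times that number.\<close>
  define \<tau> where "\<tau> = f_err f \<kappa> * (1 - (1 - \<epsilon>)\<^sup>2)"
  define V1 where "V1 = (\<integral>x. (x\<^sup>2 - 1)\<^sup>2 \<partial>std_normal_distribution)"
  define V2 where "V2 = (\<integral>x. (capped_loss f \<kappa> x - \<mu>)\<^sup>2 \<partial>std_normal_distribution)"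
  define E1 where "E1 = (\<integral>x. \<bar>x\<bar> \<partial>std_normal_distribution)"
  define C where "C = V1 / (2 * \<epsilon>')\<^sup>2 + V2 / (\<alpha> * \<tau>\<^sup>2) + 2 * E1 + 1 / \<delta>\<^sup>2"
  have "(1 - \<epsilon>)\<^sup>2 < 1" using \<epsilon> by (simp add: power_less_one_iff)
  then have \<tau>: "0 < \<tau>" using err by (simp add: \<tau>_def)
  fix m n :: nat assume n: "0 < n" and m: "real m = \<alpha> * real n" and int: "(1 - f) * real m \<in> \<int>"
  have m0: "0 < m" using n m \<alpha> by (metis mult_pos_pos of_nat_0_less_iff)
  let ?K = "bordered_grid m n"
  let ?M = "gaussian ?K"
  define \<zeta> where "\<zeta> = (1 - \<epsilon>) * sqrt (\<alpha> * f_err f \<kappa>) * sqrt (real n)"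
  define \<rho> where "\<rho> = (1 + \<epsilon>') * sqrt (real n)"
  define \<theta> where "\<theta> = \<delta> * sqrt (real n)"
  \<comment> \<open>With \<open>n\<close> times the number of entries, Markov's inequality gives
    failure probability \<open>E1 / n\<close>. A large \<open>R\<close> merely refines the
    nets.\<close>
  define R where "R = real n * real (card ?K)"
  have pos: "0 < \<zeta>" "0 \<le> \<rho>" "0 < R" "0 < \<theta>"
    using \<epsilon> \<alpha> err n by (auto simp: \<zeta>_def \<rho>_def R_def \<theta>_def intro!: mult_pos_pos add_pos_nonneg)
  have b1: "measure ?M {z \<in> space ?M. \<rho>\<^sup>2 < (\<Sum>j<n. (z (0, Suc j))\<^sup>2)} \<le> V1 / (2 * \<epsilon>')\<^sup>2 / real n"
  proof -
    have mean: "(\<integral>x. x\<^sup>2 \<partial>std_normal_distribution) = 1"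
      using std_normal_distribution_even_moments(1)[of 1] by simp
    \<comment> \<open>The squared norm of the column of length \<open>n\<close> has mean
      \<open>n\<close>; the linear part \<open>2 * \<epsilon>'\<close> of the allowed excess serves
      as the deviation in Chebyshev's inequality.\<close>
    have "real n * (1 + 2 * \<epsilon>') \<le> real n * (1 + \<epsilon>')\<^sup>2"
      by (intro mult_left_mono) (auto simp: power2_eq_square algebra_simps)
    also have "\<dots> = \<rho>\<^sup>2" by (simp add: \<rho>_def power_mult_distrib)
    finally have le: "real n * ((\<integral>x. x\<^sup>2 \<partial>std_normal_distribution) + 2 * \<epsilon>') \<le> \<rho>\<^sup>2" unfolding mean .
    have "measure ?M {z \<in> space ?M. \<rho>\<^sup>2 < (\<Sum>j<n. (z (0, Suc j))\<^sup>2)}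
        \<le> (\<integral>x. (x\<^sup>2 - (\<integral>x. x\<^sup>2 \<partial>std_normal_distribution))\<^sup>2 \<partial>std_normal_distribution) / (real n * (2 * \<epsilon>')\<^sup>2)"
    proof (rule gaussian_weak_law_one_sided(1)[where \<iota> = "\<lambda>j. (0, Suc j)" and \<phi> = "\<lambda>x. x\<^sup>2", OF _ _ _ n _ _ _ le])
      show "integrable std_normal_distribution (\<lambda>x. (x\<^sup>2)\<^sup>2)"
        using integrable_std_normal_distribution_moment[of 4] by simp
      show "(\<lambda>x :: real. x\<^sup>2) \<in> borel_measurable borel" by simp
    qed (use \<epsilon> in \<open>auto simp: inj_on_def\<close>)
    then show ?thesis unfolding mean V1_def by (simp add: mult.commute)
  qed
  have b2: "measure ?M {z \<in> space ?M. (\<Sum>i<m. capped_loss f \<kappa> (z (Suc i, 0))) - f * real m * nu_wb f \<kappa> < \<zeta>\<^sup>2}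
      \<le> V2 / (\<alpha> * \<tau>\<^sup>2) / real n"
  proof -
    have mean: "(\<integral>x. capped_loss f \<kappa> x \<partial>std_normal_distribution) = \<mu>"
      unfolding \<mu>_def by (rule expectation_capped_loss[OF f root])
    have "\<zeta>\<^sup>2 = (1 - \<epsilon>)\<^sup>2 * (\<alpha> * f_err f \<kappa>) * real n"
      unfolding \<zeta>_def power_mult_distrib using \<alpha> err by simp
    also have "\<dots> = real m * (f_err f \<kappa> - \<tau>)"
      by (simp add: \<tau>_def m algebra_simps)
    finally have "\<zeta>\<^sup>2 = real m * (f_err f \<kappa> - \<tau>)" .
    then have le: "\<zeta>\<^sup>2 + f * real m * nu_wb f \<kappa> \<le> real m * ((\<integral>x. capped_loss f \<kappa> x \<partial>std_normal_distribution) - \<tau>)"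
      unfolding mean \<mu>_def by (simp add: algebra_simps)
    have "measure ?M {z \<in> space ?M. (\<Sum>i<m. capped_loss f \<kappa> (z (Suc i, 0))) < \<zeta>\<^sup>2 + f * real m * nu_wb f \<kappa>}
        \<le> (\<integral>x. (capped_loss f \<kappa> x - (\<integral>x. capped_loss f \<kappa> x \<partial>std_normal_distribution))\<^sup>2 \<partial>std_normal_distribution) / (real m * \<tau>\<^sup>2)"
    proof (rule gaussian_weak_law_one_sided(2)[where \<iota> = "\<lambda>i. (Suc i, 0)", OF _ _ _ m0 borel_measurable_capped_loss _ \<tau> le])
      show "integrable std_normal_distribution (\<lambda>x. (capped_loss f \<kappa> x)\<^sup>2)"
      proof (rule N.integrable_const_bound)
        show "AE x in std_normal_distribution. norm ((capped_loss f \<kappa> x)\<^sup>2) \<le> (nu_wb f \<kappa>)\<^sup>2"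
          using capped_loss_bounds by (intro AE_I2) (simp add: power_mono)
        show "(\<lambda>x. (capped_loss f \<kappa> x)\<^sup>2) \<in> borel_measurable std_normal_distribution"
          by (intro borel_measurable_power borel_measurable_std_normalI borel_measurable_capped_loss)
      qed
    qed (auto simp: inj_on_def)
    then show ?thesis unfolding mean V2_def m by (simp add: mult_ac less_diff_eq diff_less_eq)
  qed
  have b3: "measure ?M {z \<in> space ?M. R < (\<Sum>k\<in>?K. \<bar>z k\<bar>)} \<le> E1 / real n"
  proof -
    have "real (card ?K) * E1 / R = E1 / real n"
      using pos(3) unfolding R_def by (cases "real (card ?K) = 0") auto
    then show ?thesis
      using gaussian_l1_norm_tail[of ?K R] pos(3) unfolding E1_def by (simp del: card_cartesian_product)
  qed
  have b4: "measure ?M {z \<in> space ?M. \<theta> < \<bar>z (0, 0)\<bar>} \<le> 1 / \<delta>\<^sup>2 / real n"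
    using gaussian_component_tail[of "(0, 0)" ?K \<theta>] pos(4) by (simp add: \<theta>_def power_mult_distrib)
  have "C / real n = V1 / (2 * \<epsilon>')\<^sup>2 / real n + V2 / (\<alpha> * \<tau>\<^sup>2) / real n + 2 * (E1 / real n) + 1 / \<delta>\<^sup>2 / real n"
    by (simp add: C_def add_divide_distrib)
  then have "1 - C / real n \<le> measure ?M {z \<in> space ?M. \<zeta> - \<rho> - \<theta> - 3 \<le> xi_wb m n \<kappa> f (\<lambda>i j. z (Suc i, Suc j))}"
    using xi_wb_tail[OF n m0 f int pos(1-3), where \<theta> = \<theta> and \<kappa> = \<kappa>] b1 b2 b3 b4 by linarith
  then show "1 - C / real n \<le> measure ?M {z \<in> space ?M.
      (1 - \<epsilon>) * sqrt (\<alpha> * f_err f \<kappa>) * sqrt (real n) - (1 + \<epsilon>') * sqrt (real n) - \<delta> * sqrt (real n) - 3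
        \<le> xi_wb m n \<kappa> f (\<lambda>i j. z (Suc i, Suc j))}"
    by (simp add: \<zeta>_def \<rho>_def \<theta>_def)
qed

lemma admissible_dimsD:
  assumes "n \<in> admissible_dims \<alpha> f" "0 < \<alpha>"
  shows "real (num_patterns \<alpha> n) = \<alpha> * real n" "(1 - f) * real (num_patterns \<alpha> n) \<in> \<int>"
    "0 < n \<Longrightarrow> 0 < num_patterns \<alpha> n"
proof -
  have "0 \<le> \<alpha> * real n" using assms(2) by simp
  then show *: "real (num_patterns \<alpha> n) = \<alpha> * real n"
    using assms(1) by (auto simp: admissible_dims_def num_patterns_def elim!: Ints_cases)
  show "(1 - f) * real (num_patterns \<alpha> n) \<in> \<int>"
    using assms(1) unfolding * by (simp add: admissible_dims_def)
  show "0 < num_patterns \<alpha> n" if "0 < n"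
    using * that assms(2) by (metis mult_pos_pos of_nat_0_less_iff)
qed

text \<open>\<open>root_nonneg\<close> settles a sign: it makes
  \<open>sqrt (nu_wb f_wb \<kappa>)\<close> equal to
  \<open>sqrt 2 * erfinv (1 - 2 * f_wb) + \<kappa>\<close> and not to its negative, so that the
  integral in \<open>f_err\<close> ends at the \<open>(1 - f_wb)\<close>-quantile. The limit follows
  by squeezing the probability between \<open>1 - C / n\<close> and 1.\<close>

theorem theorem6:
  fixes \<alpha> \<kappa> f_wb \<epsilon>1m \<epsilon>1n \<epsilon>5g :: real
    and M :: "nat \<Rightarrow> 'a measure"
    and H :: "nat \<Rightarrow> nat \<Rightarrow> nat \<Rightarrow> 'a \<Rightarrow> real"
    and \<xi>l :: "nat \<Rightarrow> real"
  assumes "\<alpha> > 0" and "0 < f_wb" and "f_wb < 1"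
    and root_nonneg: "sqrt 2 * erfinv (1 - 2 * f_wb) + \<kappa> \<ge> 0"
    and "\<epsilon>1m > 0" and "\<epsilon>1n > 0" and "\<epsilon>5g > 0"
    and "\<And>n. n \<in> admissible_dims \<alpha> f_wb \<Longrightarrow> prob_space (M n)"
    and "\<And>n. n \<in> admissible_dims \<alpha> f_wb \<Longrightarrow>
           iid_std_normal_matrix (M n) (num_patterns \<alpha> n) n (H n)"
    and "\<forall>\<^sub>F n in along_dims \<alpha> f_wb.
           (1 - \<epsilon>1m) * sqrt (\<alpha> * f_err f_wb \<kappa>) - (1 + \<epsilon>1n) - \<epsilon>5g > \<xi>l n / sqrt (real n)"
  shows "((\<lambda>n. measure (M n)
            {\<omega> \<in> space (M n). xi_wb (num_patterns \<alpha> n) n \<kappa> f_wb (\<lambda>i j. H n i j \<omega>) \<ge> \<xi>l n})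
          \<longlongrightarrow> 1) (along_dims \<alpha> f_wb)"
    (is "(?q \<longlongrightarrow> 1) ?F")
proof -
  have eventually_dims: "eventually Q ?F \<longleftrightarrow> (\<forall>\<^sub>F n in sequentially. n \<in> admissible_dims \<alpha> f_wb \<longrightarrow> Q n)" for Q
    unfolding along_dims_def by (rule eventually_inf_principal)
  define X where "X = (1 - \<epsilon>1m) * sqrt (\<alpha> * f_err f_wb \<kappa>) - (1 + \<epsilon>1n) - \<epsilon>5g"
  have \<xi>l: "\<forall>\<^sub>F n in sequentially. n \<in> admissible_dims \<alpha> f_wb \<longrightarrow> \<xi>l n / sqrt (real n) < X"
    using assms(10) unfolding eventually_dims X_def .
  have adm: "\<forall>\<^sub>F n in ?F. n \<in> admissible_dims \<alpha> f_wb" unfolding eventually_dims by simp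
  have "\<exists>C. \<forall>\<^sub>F n in ?F. 1 - C / real n \<le> ?q n"
  proof (cases "0 < f_err f_wb \<kappa> \<and> \<epsilon>1m < 1")
    case True
    \<comment> \<open>Half of \<open>\<epsilon>5g\<close> pays for the scalar Gaussian. The other
      half, multiplied by \<open>sqrt n\<close>, covers the constant 3 once \<open>n\<close> is at
      least \<open>(3 / \<delta>)^2\<close>.\<close>
    define \<delta> where "\<delta> = \<epsilon>5g / 2"
    have \<delta>: "0 < \<delta>" "\<epsilon>5g = \<delta> + \<delta>" using assms(7) by (auto simp: \<delta>_def)
    from True obtain C where C: "\<And>m n. 0 < n \<Longrightarrow> real m = \<alpha> * real n \<Longrightarrow> (1 - f_wb) * real m \<in> \<int> \<Longrightarrow>
      1 - C / real n \<le> measure (gaussian (bordered_grid m n)) {z \<in> space (gaussian (bordered_grid m n)).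
        (1 - \<epsilon>1m) * sqrt (\<alpha> * f_err f_wb \<kappa>) * sqrt (real n) - (1 + \<epsilon>1n) * sqrt (real n) - \<delta> * sqrt (real n) - 3
          \<le> xi_wb m n \<kappa> f_wb (\<lambda>i j. z (Suc i, Suc j))}"
      using xi_wb_probability_bound[OF assms(1-4) _ assms(5) _ assms(6) \<delta>(1)] by blast
    have "\<forall>\<^sub>F n in sequentially. n \<in> admissible_dims \<alpha> f_wb \<longrightarrow> 1 - C / real n \<le> ?q n"
      using \<xi>l eventually_gt_at_top[of 0] eventually_ge_at_top[of "nat \<lceil>(3 / \<delta>)\<^sup>2\<rceil>"]
    proof eventually_elim
      case (elim n)
      show ?case
      proof
        assume a: "n \<in> admissible_dims \<alpha> f_wb"
        let ?m = "num_patterns \<alpha> n"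
        let ?G = "gaussian (bordered_grid ?m n)"
        note d = admissible_dimsD[OF a assms(1)]
        note p = elim(2) d(3)[OF elim(2)] assms(2,3) d(2)
        interpret G: prob_space ?G by (rule prob_space_gaussian)
        have "(3 / \<delta>)\<^sup>2 \<le> real n" using elim(3) by linarith
        then have "3 / \<delta> \<le> sqrt (real n)" by (rule real_le_rsqrt)
        then have three: "3 \<le> \<delta> * sqrt (real n)" using \<delta>(1) by (simp add: field_simps)
        have "\<xi>l n < X * sqrt (real n)" using elim(1) a elim(2) by (simp add: pos_divide_less_eq)
        also have "\<dots> \<le> (1 - \<epsilon>1m) * sqrt (\<alpha> * f_err f_wb \<kappa>) * sqrt (real n) - (1 + \<epsilon>1n) * sqrt (real n) - \<delta> * sqrt (real n) - 3"
          using three unfolding X_def \<delta>(2) by (simp add: algebra_simps)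
        finally have le: "\<xi>l n \<le> (1 - \<epsilon>1m) * sqrt (\<alpha> * f_err f_wb \<kappa>) * sqrt (real n) - (1 + \<epsilon>1n) * sqrt (real n) - \<delta> * sqrt (real n) - 3"
          by simp
        have "1 - C / real n \<le> measure ?G {z \<in> space ?G.
          (1 - \<epsilon>1m) * sqrt (\<alpha> * f_err f_wb \<kappa>) * sqrt (real n) - (1 + \<epsilon>1n) * sqrt (real n) - \<delta> * sqrt (real n) - 3
            \<le> xi_wb ?m n \<kappa> f_wb (\<lambda>i j. z (Suc i, Suc j))}"
          by (rule C[OF elim(2) d(1,2)])
        also have "\<dots> \<le> measure ?G {z \<in> space ?G. \<xi>l n \<le> xi_wb ?m n \<kappa> f_wb (\<lambda>i j. z (Suc i, Suc j))}"
          using le by (intro G.finite_measure_mono measure_xi_wb_bordered(1)[OF p]) auto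
        also have "\<dots> = ?q n"
          unfolding measure_xi_wb_bordered(2)[OF p] by (rule measure_xi_wb_iid[OF assms(8,9)[OF a] p, symmetric])
        finally show "1 - C / real n \<le> ?q n" .
      qed
    qed
    then show ?thesis unfolding eventually_dims by blast
  next
    case False
    \<comment> \<open>Either \<open>f_err\<close> is zero or \<open>1 - \<epsilon>1m\<close> is not
      positive. The prescribed level is then negative while \<open>xi_wb\<close> never is, so the
      event is the whole space.\<close>
    then have "(1 - \<epsilon>1m) * sqrt (\<alpha> * f_err f_wb \<kappa>) \<le> 0"
      using f_err_nonneg[of f_wb \<kappa>] assms(1) by (cases "f_err f_wb \<kappa> = 0") (auto intro: mult_nonpos_nonneg)
    then have X: "X < 0" using assms(6,7) by (simp add: X_def)
    have "\<forall>\<^sub>F n in sequentially. n \<in> admissible_dims \<alpha> f_wb \<longrightarrow> 1 - 0 / real n \<le> ?q n"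
      using \<xi>l eventually_gt_at_top[of 0]
    proof eventually_elim
      case (elim n)
      show ?case
      proof
        assume a: "n \<in> admissible_dims \<alpha> f_wb"
        interpret prob_space "M n" by (rule assms(8)[OF a])
        note d = admissible_dimsD[OF a assms(1)]
        have "\<xi>l n / sqrt (real n) < 0" using elim(1) a X by linarith
        then have "\<xi>l n \<le> 0" using elim(2) by (simp add: divide_less_0_iff)
        then have "\<xi>l n \<le> xi_wb (num_patterns \<alpha> n) n \<kappa> f_wb G" for G
          using xi_wb_nonneg[OF elim(2) d(3)[OF elim(2)] assms(2,3) d(2), of \<kappa> G] by linarith
        then show "1 - 0 / real n \<le> ?q n" by (simp add: prob_space)
      qed
    qed
    then show ?thesis unfolding eventually_dims by blast
  qed
  then obtain C where C: "\<forall>\<^sub>F n in ?F. 1 - C / real n \<le> ?q n" by blast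
  have le_1: "\<forall>\<^sub>F n in ?F. ?q n \<le> 1"
    using adm by eventually_elim (rule prob_space.prob_le_1[OF assms(8)])
  have "(\<lambda>n. 1 - C / real n) \<longlonglongrightarrow> 1 - 0"
    by (intro tendsto_diff tendsto_const lim_const_over_n)
  then have lower: "((\<lambda>n. 1 - C / real n) \<longlongrightarrow> 1) ?F"
    unfolding along_dims_def by (intro tendsto_mono[OF inf_le1]) simp
  show ?thesis by (rule tendsto_sandwich[OF C le_1 lower tendsto_const])
qed

end
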